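(* Let $n\ge 2$, $1<p<+\infty$, let $\Omega\subset\mathbb{R}^n$ be a $C^1$ domain (bounded or unbounded), let $f\in C^1(\mathbb{R})$ and let $\kappa\ge 0$ be a constant. Let $u$ be a bounded $C^3$ solution of \[ \begin{cases} \mathrm{div}\left(|\nabla u|^{p-2}\nabla u\right)+f(u)=0 & \text{in } \Omega,\\ u>0 & \text{in } \Omega,\\ u=0 & \text{on } \partial\Omega,\\ \partial_\nu u=-\kappa & \text{on } \partial\Omega, \end{cases} \] where $\nu$ is the exterior unit normal to $\partial\Omega$. Let $F\in C^2(\mathbb{R})$ be a primitive of $f$ with $F\le 0$ on $\mathbb{R}$, and define \[ Q(x)=\frac{p-1}{p}|\nabla u(x)|^p+F(u(x)),\qquad x\in\Omega . \] Then \[ Q(x)\le \max\Big\{0,\;F(0)+\frac{p-1}{p}\kappa^p\Big\}\quad\text{for all } x\in\Omega . \] Moreover, if there exists $x_0\in\Omega$ with $Q(x_0)=\max\{0,F(0)+\frac{p-1}{p}\kappa^p\}$, and, in the case $p>2$, it is additionally assumed that for every $u_0\in\mathbb{R}$ with $F(u_0)=0$ one has $F(s)=O(|s-u_0|^p)$ as $s\to u_0$, then $Q$ is constant in $\Omega$, $\Omega$ is a half-space and $u$ is parallel.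
   Context: A primitive of $f$ is a function $F$ with $F'=f$. A solution $u$ on a half-space $\Omega$ is called parallel (one-dimensional) if there exist $x_0,a\in\mathbb{R}^n$ and $g:[0,+\infty)\to\mathbb{R}$ such that $\Omega=\{x: a\cdot(x-x_0)>0\}$ and $u(x)=g(a\cdot(x-x_0))$ on $\Omega$.
   Formalization: Ω is assumed different from the whole space (for Ω = ℝⁿ, u constant with F(u) = 0 violates the half-space conclusion); the equation is taken in the weak sense, and u and ∇u are assumed to extend continuously to the closure of Ω so that the boundary conditions make sense. *)

theory Defs
  imports "HOL-Analysis.Analysis" "HOL-Library.Landau_Symbols"
begin

definition grad :: "('a::euclidean_space \<Rightarrow> real) \<Rightarrow> 'a \<Rightarrow> 'a" where
  "grad u x = (SOME D. GDERIV u x :> D)"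

fun Ck :: "nat \<Rightarrow> 'a::euclidean_space set \<Rightarrow> ('a \<Rightarrow> 'b::real_normed_vector) \<Rightarrow> bool" where
  "Ck 0 S f = continuous_on S f"
| "Ck (Suc k) S f = ((\<forall>x\<in>S. f differentiable (at x)) \<and>
      (\<forall>v. Ck k S (\<lambda>x. frechet_derivative f (at x) v)))"

definition C1_domain :: "'a::euclidean_space set \<Rightarrow> bool" where
  "C1_domain \<Omega> \<longleftrightarrow> open \<Omega> \<and> connected \<Omega> \<and> \<Omega> \<noteq> {} \<and> \<Omega> \<noteq> UNIV \<and>
     (\<forall>z\<in>frontier \<Omega>. \<exists>r>0. \<exists>e (h::'a \<Rightarrow> real). norm e = 1 \<and> Ck 1 UNIV h \<and>
        \<Omega> \<inter> ball z r = {x \<in> ball z r. x \<bullet> e > h (x - (x \<bullet> e) *\<^sub>R e)})"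

definition exterior_normal :: "'a::euclidean_space set \<Rightarrow> 'a \<Rightarrow> 'a \<Rightarrow> bool" where
  "exterior_normal \<Omega> z \<nu> \<longleftrightarrow> z \<in> frontier \<Omega> \<and> norm \<nu> = 1 \<and>
     (\<forall>\<epsilon>>0. \<exists>\<delta>>0. \<forall>x\<in>ball z \<delta>.
        ((x - z) \<bullet> \<nu> < - \<epsilon> * norm (x - z) \<longrightarrow> x \<in> \<Omega>) \<and>
        ((x - z) \<bullet> \<nu> > \<epsilon> * norm (x - z) \<longrightarrow> x \<notin> \<Omega>))"

text \<open>Weak formulation of  div(|grad u|^(p-2) grad u) + f(u) = 0  in Omega.\<close>
definition p_laplace_solution ::
    "real \<Rightarrow> (real \<Rightarrow> real) \<Rightarrow> 'a::euclidean_space set \<Rightarrow> ('a \<Rightarrow> real) \<Rightarrow> bool" where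
  "p_laplace_solution p f \<Omega> u \<longleftrightarrow>
     (\<forall>\<phi>::'a \<Rightarrow> real. Ck 1 UNIV \<phi> \<and> compact (closure {x. \<phi> x \<noteq> 0}) \<and>
        closure {x. \<phi> x \<noteq> 0} \<subseteq> \<Omega> \<longrightarrow>
        integral \<Omega> (\<lambda>x. norm (grad u x) powr (p - 2) * (grad u x \<bullet> grad \<phi> x))
          = integral \<Omega> (\<lambda>x. f (u x) * \<phi> x))"

definition halfspace :: "'a::euclidean_space set \<Rightarrow> bool" where
  "halfspace \<Omega> \<longleftrightarrow> (\<exists>a x0. a \<noteq> 0 \<and> \<Omega> = {x. a \<bullet> (x - x0) > 0})"

definition parallel_solution :: "'a::euclidean_space set \<Rightarrow> ('a \<Rightarrow> real) \<Rightarrow> bool" where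
  "parallel_solution \<Omega> u \<longleftrightarrow> (\<exists>x0 a (g::real \<Rightarrow> real).
     \<Omega> = {x. a \<bullet> (x - x0) > 0} \<and> (\<forall>x\<in>\<Omega>. u x = g (a \<bullet> (x - x0))))"

end

theory Submission
  imports Defs
begin

text \<open>
  Where the gradient of \<open>u\<close> does not vanish, \<open>Q\<close> is a subsolution of a linear elliptic equation: the second
  order part is that of the linearised p-Laplacian, the drift is \<open>p f(u) |\<nabla>u|^(-p) \<nabla>u\<close>, and the defect is an
  explicit sum of squares. Let \<open>M\<close> be the claimed bound. On the boundary the gradient has length \<open>\<kappa>\<close>, so
  \<open>Q \<le> M\<close> there, and at points where \<open>Q > M\<close> the sign of \<open>F\<close> forces the gradient away from zero.

  Neither compactness of translates nor an a priori gradient bound is needed. If \<open>Q\<close> exceeds \<open>M + \<sigma>\<close> at \<open>x0\<close>,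
  touch \<open>Q - M - \<sigma>\<close> from above in the ball of radius \<open>R\<close> around \<open>x0\<close> by a multiple \<open>\<mu>\<close> of
  \<open>(A - exp (l u)) \<zeta>^(-k)\<close> with \<open>\<zeta> = 1 - |x - x0|^2 / R^2\<close>. As \<open>u\<close> is bounded, the concave factor is bounded
  between positive constants and produces a term of order \<open>|\<nabla>u|^2\<close> of the right sign, so that \<open>|\<nabla>u| \<zeta>\<close> is
  at most \<open>c / R\<close> at the contact point, with \<open>c\<close> independent of \<open>R\<close>. For \<open>k \<ge> p\<close> this gives
  \<open>\<mu> \<le> (c / R)^p\<close>, and \<open>R \<rightarrow> \<infinity>\<close> yields a contradiction.

  If \<open>Q\<close> attains \<open>M\<close>, the contact point is not critical: otherwise \<open>M = 0\<close>, \<open>F\<close> vanishes at \<open>u0 = u(x0)\<close>, and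
  \<open>Q \<le> 0\<close> with the growth of \<open>F\<close> gives \<open>|\<nabla>u| \<le> B |u - u0|\<close>, whence \<open>u\<close> is constant. The strong maximum
  principle then makes \<open>Q\<close> constant, the sum of squares vanishes, and the Hessian is a multiple of
  \<open>\<nabla>u \<otimes> \<nabla>u\<close>. So \<open>\<nabla>u\<close> has a constant direction \<open>a\<close>, and moving from a point of \<open>\<Omega>\<close> in a direction \<open>v\<close> with
  \<open>a \<bullet> v \<ge> 0\<close> never decreases \<open>u\<close>, hence never meets the boundary.
\<close>

section \<open>Calculus along lines and symmetry of second derivatives\<close>

lemma has_integral_integral_cbox:
  fixes k :: "'a::euclidean_space \<Rightarrow> real"
  assumes "continuous_on UNIV k" and "\<And>x. x \<notin> cbox a b \<Longrightarrow> k x = 0"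
  shows "(k has_integral integral (cbox a b) k) UNIV"
proof (rule has_integral_on_superset)
  show "(k has_integral integral (cbox a b) k) (cbox a b)"
    by (intro integrable_integral integrable_continuous continuous_on_subset[OF assms(1)]) simp
qed (use assms in auto)

text \<open>If \<open>d\<close> were positive, \<open>\<phi>1\<close> would be positive just to the
  right of 0, and the mean value theorem would lift \<open>\<phi>\<close> above its maximum.
  \<open>\<phi>1\<close> is differentiated at 0 only, which is the form in which second derivatives
  of \<open>Q\<close> and of barriers are available along a line.\<close>

lemma second_derivative_nonpos_at_local_max:
  fixes \<phi> :: "real \<Rightarrow> real"
  assumes d1: "\<forall>\<^sub>F t in nhds 0. (\<phi> has_real_derivative \<phi>1 t) (at t)"
    and d2: "(\<phi>1 has_real_derivative d) (at 0)"
    and le: "\<forall>\<^sub>F t in nhds 0. \<phi> t \<le> \<phi> 0"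
  shows "\<phi>1 0 = 0" and "d \<le> 0"
proof -
  have "\<forall>\<^sub>F t in nhds 0. (\<phi> has_real_derivative \<phi>1 t) (at t) \<and> \<phi> t \<le> \<phi> 0"
    using d1 le by eventually_elim auto
  then obtain e where e: "e > 0"
    and ev: "\<And>t. \<bar>t\<bar> < e \<Longrightarrow> (\<phi> has_real_derivative \<phi>1 t) (at t)" "\<And>t. \<bar>t\<bar> < e \<Longrightarrow> \<phi> t \<le> \<phi> 0"
    by (auto simp: eventually_nhds_metric dist_real_def)
  show z: "\<phi>1 0 = 0"
    using ev e by (intro DERIV_local_max[of \<phi> _ 0 e]) auto
  show "d \<le> 0"
  proof (rule ccontr)
    assume "\<not> d \<le> 0"
    then obtain c where c: "c > 0" "\<And>h. h > 0 \<Longrightarrow> h < c \<Longrightarrow> \<phi>1 h > \<phi>1 0"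
      using DERIV_pos_inc_right[OF d2] by auto
    define h where "h = min c e / 2"
    have h: "0 < h" "h < c" "h < e" using c e by (auto simp: h_def min_def)
    have "\<exists>y. 0 < y \<and> y < h \<and> \<phi> h - \<phi> 0 = (h - 0) * \<phi>1 y"
      using h ev by (intro MVT2) auto
    then obtain y where y: "0 < y" "y < h" "\<phi> h - \<phi> 0 = h * \<phi>1 y" by auto
    then have "h * \<phi>1 y > 0" using h c(2)[of y] z by simp
    with y(3) ev(2)[of h] h show False by simp
  qed
qed

lemma has_real_derivative_along_line:
  fixes f :: "'a::real_normed_vector \<Rightarrow> real"
  assumes "(f has_derivative f') (at (x + t *\<^sub>R v))"
  shows "((\<lambda>t. f (x + t *\<^sub>R v)) has_real_derivative f' v) (at t)"
proof -
  have *: "((\<lambda>t. x + t *\<^sub>R v) has_derivative (\<lambda>h. h *\<^sub>R v)) (at t)"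
    by (auto intro!: derivative_eq_intros)
  have "((\<lambda>t. f (x + t *\<^sub>R v)) has_derivative (\<lambda>h. f' (h *\<^sub>R v))) (at t)"
    using has_derivative_compose[OF * assms] .
  moreover have "f' (h *\<^sub>R v) = h * f' v" for h
    using has_derivative_bounded_linear[OF assms]
    by (simp add: linear_simps)
  ultimately show ?thesis
    by (simp add: has_field_derivative_def mult_commute_abs)
qed

lemma tendsto_along_line:
  fixes y v :: "'a::real_normed_vector"
  shows "((\<lambda>t. y + t *\<^sub>R v) \<longlongrightarrow> y) (nhds 0)"
proof -
  have "isCont (\<lambda>t. y + t *\<^sub>R v) 0" by (intro continuous_intros)
  then show ?thesis
    using tendsto_at_iff_tendsto_nhds[of "\<lambda>t. y + t *\<^sub>R v" 0] by (simp add: continuous_at)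
qed

text \<open>Two mean value theorems for the second difference over a parallelogram: one in direction
  \<open>v\<close> for the difference of \<open>f\<close> across opposite sides, then one in
  direction \<open>w\<close> for \<open>f' _ v\<close>. Exchanging \<open>v\<close> and
  \<open>w\<close> leaves the second difference unchanged.\<close>

lemma mixed_difference_mvt:
  fixes f :: "'a::real_normed_vector \<Rightarrow> real"
  assumes d1: "\<And>s t. 0 \<le> s \<Longrightarrow> s \<le> h \<Longrightarrow> 0 \<le> t \<Longrightarrow> t \<le> h \<Longrightarrow>
      (f has_derivative f' (x + s *\<^sub>R v + t *\<^sub>R w)) (at (x + s *\<^sub>R v + t *\<^sub>R w))"
    and d2: "\<And>s t. 0 \<le> s \<Longrightarrow> s \<le> h \<Longrightarrow> 0 \<le> t \<Longrightarrow> t \<le> h \<Longrightarrow>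
      ((\<lambda>x. f' x v) has_derivative f'' (x + s *\<^sub>R v + t *\<^sub>R w)) (at (x + s *\<^sub>R v + t *\<^sub>R w))"
    and h: "0 < h"
  obtains s t where "0 \<le> s" "s \<le> h" "0 \<le> t" "t \<le> h"
    "f (x + h *\<^sub>R v + h *\<^sub>R w) - f (x + h *\<^sub>R v) - f (x + h *\<^sub>R w) + f x = h * h * f'' (x + s *\<^sub>R v + t *\<^sub>R w) w"
proof -
  have line: "((\<lambda>s. f (x + s *\<^sub>R v + t *\<^sub>R w)) has_real_derivative f' (x + s *\<^sub>R v + t *\<^sub>R w) v) (at s)"
    if "0 \<le> s" "s \<le> h" "0 \<le> t" "t \<le> h" for s t
  proof -
    have "(f has_derivative f' (x + s *\<^sub>R v + t *\<^sub>R w)) (at ((x + t *\<^sub>R w) + s *\<^sub>R v))"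
      using d1[OF that] by (simp add: add_ac)
    from has_real_derivative_along_line[OF this] show ?thesis by (simp add: add_ac)
  qed
  have "\<exists>s. 0 < s \<and> s < h \<and>
      (f (x + h *\<^sub>R v + h *\<^sub>R w) - f (x + h *\<^sub>R v + 0 *\<^sub>R w)) - (f (x + 0 *\<^sub>R v + h *\<^sub>R w) - f (x + 0 *\<^sub>R v + 0 *\<^sub>R w))
      = (h - 0) * (f' (x + s *\<^sub>R v + h *\<^sub>R w) v - f' (x + s *\<^sub>R v + 0 *\<^sub>R w) v)"
    by (rule MVT2[OF h]) (use h in \<open>intro DERIV_diff line; simp\<close>)
  then obtain s where s: "0 < s" "s < h" and seq:
    "f (x + h *\<^sub>R v + h *\<^sub>R w) - f (x + h *\<^sub>R v) - f (x + h *\<^sub>R w) + f x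
      = h * (f' (x + s *\<^sub>R v + h *\<^sub>R w) v - f' (x + s *\<^sub>R v) v)"
    by (auto simp: algebra_simps)
  have "\<exists>t. 0 < t \<and> t < h \<and> f' (x + s *\<^sub>R v + h *\<^sub>R w) v - f' (x + s *\<^sub>R v + 0 *\<^sub>R w) v
     = (h - 0) * f'' (x + s *\<^sub>R v + t *\<^sub>R w) w"
    by (rule MVT2[OF h]) (use s in \<open>intro has_real_derivative_along_line[of "\<lambda>x. f' x v"] d2; simp\<close>)
  then obtain t where t: "0 < t" "t < h" and
    "f' (x + s *\<^sub>R v + h *\<^sub>R w) v - f' (x + s *\<^sub>R v) v = h * f'' (x + s *\<^sub>R v + t *\<^sub>R w) w"
    by auto
  then have "f (x + h *\<^sub>R v + h *\<^sub>R w) - f (x + h *\<^sub>R v) - f (x + h *\<^sub>R w) + f x = h * h * f'' (x + s *\<^sub>R v + t *\<^sub>R w) w"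
    using seq by (simp add: mult.assoc)
  with s t show thesis by (intro that[of s t]) auto
qed

text \<open>The second difference over one small parallelogram is \<open>h * h\<close> times either
  mixed derivative at some nearby point, and continuity moves both points to \<open>x\<close>.
  Continuity is stated for each pair of directions separately, as \<open>Ck\<close> provides
  it.\<close>

theorem second_derivative_symmetric:
  fixes f :: "'a::real_normed_vector \<Rightarrow> real"
  assumes S: "open S" "x \<in> S"
    and d1: "\<And>x. x \<in> S \<Longrightarrow> (f has_derivative f' x) (at x)"
    and d2: "\<And>x v. x \<in> S \<Longrightarrow> ((\<lambda>x. f' x v) has_derivative f'' x v) (at x)"
    and cont: "\<And>v w. continuous_on S (\<lambda>x. f'' x v w)"
  shows "f'' x v w = f'' x w v"
proof (rule ccontr)
  assume ne: "f'' x v w \<noteq> f'' x w v"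
  define e where "e = \<bar>f'' x v w - f'' x w v\<bar> / 2"
  have e: "e > 0" using ne by (simp add: e_def)
  obtain r0 where r0: "r0 > 0" "ball x r0 \<subseteq> S"
    using S by (meson openE)
  have *: "\<exists>d>0. \<forall>y. dist y x < d \<longrightarrow> \<bar>f'' y a b - f'' x a b\<bar> < e" for a b
    using cont[of a b] S e by (auto simp: continuous_on_eq_continuous_at continuous_at_eps_delta dist_real_def)
  obtain r1 where r1: "r1 > 0" "\<And>y. dist y x < r1 \<Longrightarrow> \<bar>f'' y v w - f'' x v w\<bar> < e"
    using *[of v w] by auto
  obtain r2 where r2: "r2 > 0" "\<And>y. dist y x < r2 \<Longrightarrow> \<bar>f'' y w v - f'' x w v\<bar> < e"
    using *[of w v] by auto
  define r where "r = min r0 (min r1 r2)"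
  \<comment> \<open>The parallelogram of scale \<open>h\<close> stays within distance
    \<open>r\<close> of \<open>x\<close>; the summand 1 keeps the denominator positive when both
    directions vanish.\<close>
  define h where "h = r / (norm v + norm w + 1)"
  have rp: "r > 0" using r0(1) r1(1) r2(1) by (simp add: r_def)
  have h: "h > 0" unfolding h_def using rp by (intro divide_pos_pos) (auto intro: add_nonneg_pos)
  have near: "dist (x + s *\<^sub>R v + t *\<^sub>R w) x < r" if "0 \<le> s" "s \<le> h" "0 \<le> t" "t \<le> h" for s t
  proof -
    have "dist (x + s *\<^sub>R v + t *\<^sub>R w) x = norm (s *\<^sub>R v + t *\<^sub>R w)" by (simp add: dist_norm)
    also have "\<dots> \<le> s * norm v + t * norm w"
      using norm_triangle_ineq[of "s *\<^sub>R v" "t *\<^sub>R w"] that by simp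
    also have "\<dots> \<le> h * norm v + h * norm w" using that by (intro add_mono mult_right_mono) auto
    also have "\<dots> < h * (norm v + norm w + 1)" using h by (simp add: algebra_simps)
    also have "h * (norm v + norm w + 1) = r"
      using add_nonneg_pos[of "norm v + norm w" 1] by (simp add: h_def)
    finally show ?thesis .
  qed
  have nearS: "x + s *\<^sub>R v + t *\<^sub>R w \<in> S" if "0 \<le> s" "s \<le> h" "0 \<le> t" "t \<le> h" for s t
    using near[OF that] r0(2) by (auto simp: r_def dist_commute)
  have sw: "x + s *\<^sub>R w + t *\<^sub>R v = x + t *\<^sub>R v + s *\<^sub>R w" for s t by simp
  obtain s t where st: "0 \<le> s" "s \<le> h" "0 \<le> t" "t \<le> h"
    "f (x + h *\<^sub>R v + h *\<^sub>R w) - f (x + h *\<^sub>R v) - f (x + h *\<^sub>R w) + f x = h * h * f'' (x + s *\<^sub>R v + t *\<^sub>R w) v w"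
    by (rule mixed_difference_mvt[of h f f' x v w "\<lambda>y. f'' y v"]) (auto intro!: d1 d2 nearS h)
  obtain s' t' where st': "0 \<le> s'" "s' \<le> h" "0 \<le> t'" "t' \<le> h"
    "f (x + h *\<^sub>R w + h *\<^sub>R v) - f (x + h *\<^sub>R w) - f (x + h *\<^sub>R v) + f x = h * h * f'' (x + s' *\<^sub>R w + t' *\<^sub>R v) w v"
    by (rule mixed_difference_mvt[of h f f' x w v "\<lambda>y. f'' y w"]) (auto intro!: d1 d2 nearS h simp only: sw)
  have "h * h * f'' (x + s *\<^sub>R v + t *\<^sub>R w) v w = h * h * f'' (x + s' *\<^sub>R w + t' *\<^sub>R v) w v"
    using st(5) st'(5) by (simp only: sw[of h h])
  then have "f'' (x + s *\<^sub>R v + t *\<^sub>R w) v w = f'' (x + s' *\<^sub>R w + t' *\<^sub>R v) w v"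
    using h by simp
  moreover have "\<bar>f'' (x + s *\<^sub>R v + t *\<^sub>R w) v w - f'' x v w\<bar> < e"
    using near[OF st(1-4)] by (intro r1(2)) (simp add: r_def)
  moreover have "\<bar>f'' (x + s' *\<^sub>R w + t' *\<^sub>R v) w v - f'' x w v\<bar> < e"
    using near[OF st'(3,4,1,2)] by (intro r2(2)) (simp add: r_def sw[of s' t'])
  ultimately have "\<bar>f'' x v w - f'' x w v\<bar> < e + e" by linarith
  then show False by (simp add: e_def)
qed

text \<open>Translating a compactly supported function along \<open>e\<close> does not change its
  integral, so the derivative of that integral in the translation parameter is 0; differentiation
  under the integral sign at 0 identifies it. This replaces the divergence theorem.\<close>

lemma has_integral_directional_derivative_0:
  fixes \<psi> :: "'a::euclidean_space \<Rightarrow> real"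
  assumes d: "\<And>x. (\<psi> has_derivative \<psi>' x) (at x)"
    and cont: "continuous_on UNIV (\<lambda>x. \<psi>' x e)"
    and supp: "\<And>x. x \<notin> cball y r \<Longrightarrow> \<psi> x = 0"
  shows "((\<lambda>x. \<psi>' x e) has_integral 0) UNIV"
proof -
  have c\<psi>: "continuous_on UNIV \<psi>"
    using d by (meson continuous_at_imp_continuous_on has_derivative_continuous)
  \<comment> \<open>Enlarging the radius by \<open>norm e\<close> lets one fixed box contain the
    support of every translate with parameter in [-1, 1].\<close>
  obtain a where a: "cball y (r + norm e) \<subseteq> cbox (-a) a"
    using bounded_subset_cbox_symmetric[OF bounded_cball] by blast
  obtain c where c: "cball y r \<subseteq> cbox (-c) c"
    using bounded_subset_cbox_symmetric[OF bounded_cball] by blast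
  have zero: "\<psi> (x + t *\<^sub>R e) = 0" if "x \<notin> cbox (-a) a" "\<bar>t\<bar> \<le> 1" for x t
  proof -
    have "x \<notin> cball y (r + norm e)" using that a by auto
    moreover have "norm (t *\<^sub>R e) \<le> norm e" using that by (simp add: mult_left_le_one_le)
    moreover have "dist y x \<le> dist y (x + t *\<^sub>R e) + norm (t *\<^sub>R e)"
      using dist_triangle[of y x "x + t *\<^sub>R e"] by (simp add: dist_norm)
    ultimately have "x + t *\<^sub>R e \<notin> cball y r" by auto
    then show ?thesis by (rule supp)
  qed
  define I where "I = integral (cbox (-c) c) \<psi>"
  have I: "(\<psi> has_integral I) UNIV"
    unfolding I_def using c supp by (intro has_integral_integral_cbox c\<psi>) blast
  have It: "integral (cbox (-a) a) (\<lambda>x. \<psi> (x + t *\<^sub>R e)) = I" if "\<bar>t\<bar> \<le> 1" for t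
  proof -
    have "((\<lambda>x. \<psi> (x + t *\<^sub>R e)) has_integral I) UNIV"
    proof -
      have "(\<psi> has_integral I) (cbox (-c) c)"
        unfolding I_def by (intro integrable_integral integrable_continuous continuous_on_subset[OF c\<psi>]) auto
      from has_integral_affinity[OF this, of 1 "t *\<^sub>R e"]
      have "((\<lambda>x. \<psi> (x + t *\<^sub>R e)) has_integral I) ((\<lambda>x. x - t *\<^sub>R e) ` cbox (- c) c)"
        by simp
      moreover have "\<psi> (x + t *\<^sub>R e) = 0" if "x \<notin> (\<lambda>x. x - t *\<^sub>R e) ` cbox (- c) c" for x
      proof -
        have "x + t *\<^sub>R e \<notin> cbox (-c) c"
        proof
          assume "x + t *\<^sub>R e \<in> cbox (-c) c"
          then have "(x + t *\<^sub>R e) - t *\<^sub>R e \<in> (\<lambda>x. x - t *\<^sub>R e) ` cbox (- c) c" by (rule imageI)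
          with that show False by simp
        qed
        with c supp show ?thesis by blast
      qed
      ultimately show ?thesis by (rule has_integral_on_superset) auto
    qed
    moreover have "((\<lambda>x. \<psi> (x + t *\<^sub>R e)) has_integral integral (cbox (-a) a) (\<lambda>x. \<psi> (x + t *\<^sub>R e))) UNIV"
      by (intro has_integral_integral_cbox continuous_on_compose2[OF c\<psi>] continuous_intros)
        (use zero that in auto)
    ultimately show ?thesis by (rule has_integral_unique[symmetric])
  qed
  let ?U = "{-1<..<1::real}"
  have "((\<lambda>t. integral (cbox (-a) a) (\<lambda>x. \<psi> (x + t *\<^sub>R e))) has_field_derivative
      integral (cbox (-a) a) (\<lambda>x. \<psi>' (x + 0 *\<^sub>R e) e)) (at 0 within ?U)"
  proof (rule leibniz_rule_field_derivative[where fx = "\<lambda>t x. \<psi>' (x + t *\<^sub>R e) e"])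
    show "((\<lambda>t. \<psi> (x + t *\<^sub>R e)) has_real_derivative \<psi>' (x + t *\<^sub>R e) e) (at t within ?U)" for x t
      using has_real_derivative_along_line[OF d] has_field_derivative_at_within by blast
    show "(\<lambda>x. \<psi> (x + t *\<^sub>R e)) integrable_on cbox (-a) a" for t
      by (intro integrable_continuous continuous_on_compose2[OF c\<psi>] continuous_intros) auto
    show "continuous_on (?U \<times> cbox (-a) a) (\<lambda>(t, x). \<psi>' (x + t *\<^sub>R e) e)"
      unfolding split_beta by (intro continuous_on_compose2[OF cont] continuous_intros) auto
  qed auto
  then have "((\<lambda>t. integral (cbox (-a) a) (\<lambda>x. \<psi> (x + t *\<^sub>R e))) has_field_derivative
      integral (cbox (-a) a) (\<lambda>x. \<psi>' x e)) (at 0)"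
    by (subst (asm) at_within_open) auto
  moreover have "((\<lambda>t. integral (cbox (-a) a) (\<lambda>x. \<psi> (x + t *\<^sub>R e))) has_field_derivative 0) (at 0)"
    by (rule has_field_derivative_transform_within_open[OF DERIV_const[of I], where S = ?U]) (use It in auto)
  ultimately have "integral (cbox (-a) a) (\<lambda>x. \<psi>' x e) = 0" by (rule DERIV_unique)
  moreover have "\<psi>' x e = 0" if "x \<notin> cbox (-a) a" for x
  proof -
    have "cball y r \<subseteq> cball y (r + norm e)" by (intro subset_cball) simp
    with that a have "x \<notin> cball y r" by blast
    then have "(\<psi> has_derivative (\<lambda>_. 0)) (at x)"
      by (intro has_derivative_transform_within_open[OF has_derivative_const[of 0], where s = "- cball y r"])
        (use supp in auto)
    from has_derivative_unique[OF this d] show ?thesis by metis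
  qed
  ultimately show ?thesis
    using has_integral_integral_cbox[OF cont, of "-a" a] by auto
qed

section \<open>From the weak to the pointwise equation\<close>

text \<open>Squaring removes the corner of the positive part, since the difference quotient at 0 is
  at most |h|. This is what makes \<open>bump\<close> continuously differentiable.\<close>

lemma has_real_derivative_max_0_sq:
  "((\<lambda>s::real. (max 0 s)\<^sup>2) has_real_derivative 2 * max 0 s) (at s)"
proof -
  consider "s < 0" | "s = 0" | "s > 0" by linarith
  then show ?thesis
  proof cases
    case 1
    have "((\<lambda>s::real. (max 0 s)\<^sup>2) has_real_derivative 0) (at s)"
      by (rule has_field_derivative_transform_within_open[OF DERIV_const[of 0], where S = "{..<0}"]) (use 1 in auto)
    then show ?thesis using 1 by simp
  next
    case 2
    have "((\<lambda>h::real. (max 0 h)\<^sup>2 / h) \<longlongrightarrow> 0) (at 0)"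
    proof (rule Lim_null_comparison)
      show "\<forall>\<^sub>F h::real in at 0. norm ((max 0 h)\<^sup>2 / h) \<le> \<bar>h\<bar>"
        by (auto simp: max_def power2_eq_square intro: always_eventually)
      show "((\<lambda>h::real. \<bar>h\<bar>) \<longlongrightarrow> 0) (at 0)" by (auto intro!: tendsto_eq_intros)
    qed
    then show ?thesis by (simp add: 2 DERIV_def)
  next
    case 3
    have "((\<lambda>s::real. s\<^sup>2) has_real_derivative 2 * s) (at s)"
      by (auto intro!: derivative_eq_intros)
    then have "((\<lambda>s::real. (max 0 s)\<^sup>2) has_real_derivative 2 * s) (at s)"
      by (rule has_field_derivative_transform_within_open[where S = "{0<..}"]) (use 3 in auto)
    then show ?thesis using 3 by simp
  qed
qed

text \<open>\<open>p_laplace_solution\<close> admits all test functions of class C^1, so a squared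
  truncated paraboloid, positive exactly on the ball when \<open>\<rho>\<close> is positive, serves
  as cutoff.\<close>

definition bump :: "'a::euclidean_space \<Rightarrow> real \<Rightarrow> 'a \<Rightarrow> real" where
  "bump y \<rho> x = (max 0 (\<rho>\<^sup>2 - (x - y) \<bullet> (x - y)))\<^sup>2"

definition bump_grad :: "'a::euclidean_space \<Rightarrow> real \<Rightarrow> 'a \<Rightarrow> 'a" where
  "bump_grad y \<rho> x = (- 4 * max 0 (\<rho>\<^sup>2 - (x - y) \<bullet> (x - y))) *\<^sub>R (x - y)"

lemma bump_has_derivative: "(bump y \<rho> has_derivative (\<lambda>v. bump_grad y \<rho> x \<bullet> v)) (at x)"
proof -
  have 1: "((\<lambda>x. \<rho>\<^sup>2 - (x - y) \<bullet> (x - y)) has_derivative (\<lambda>v. - 2 * ((x - y) \<bullet> v))) (at x)"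
    by (auto intro!: derivative_eq_intros simp: inner_commute algebra_simps)
  show ?thesis
    unfolding bump_def[abs_def] bump_grad_def
    using has_derivative_compose[OF 1 has_real_derivative_max_0_sq[unfolded has_field_derivative_def]]
    by (simp add: algebra_simps)
qed

text \<open>\<open>grad\<close> is a Hilbert choice: the vector \<open>g\<close> witnesses that
  there is something to choose, and uniqueness of the derivative identifies the chosen
  vector.\<close>

lemma grad_eqI: "(\<phi> has_derivative (\<lambda>v. g \<bullet> v)) (at x) \<Longrightarrow> grad \<phi> x = g"
  for \<phi> :: "'a::euclidean_space \<Rightarrow> real"
proof -
  assume d: "(\<phi> has_derivative (\<lambda>v. g \<bullet> v)) (at x)"
  then have "GDERIV \<phi> x :> g" by (simp add: gderiv_def inner_commute)
  then have "GDERIV \<phi> x :> grad \<phi> x" unfolding grad_def by (rule someI)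
  then have "(\<phi> has_derivative (\<lambda>v. v \<bullet> grad \<phi> x)) (at x)" by (simp add: gderiv_def)
  from fun_cong[OF has_derivative_unique[OF this d]]
  have "\<And>v. grad \<phi> x \<bullet> v = g \<bullet> v" by (simp add: inner_commute)
  then show ?thesis using vector_eq_rdot by blast
qed

lemma has_derivative_grad:
  fixes \<phi> :: "'a::euclidean_space \<Rightarrow> real"
  assumes "\<phi> differentiable (at x)"
  shows "(\<phi> has_derivative (\<lambda>v. grad \<phi> x \<bullet> v)) (at x)"
proof -
  let ?D = "frechet_derivative \<phi> (at x)"
  have d: "(\<phi> has_derivative ?D) (at x)" using assms by (simp add: frechet_derivative_works)
  have "?D v = (\<Sum>b\<in>Basis. ?D b *\<^sub>R b) \<bullet> v" for v
  proof -
    have "?D v = ?D (\<Sum>b\<in>Basis. (v \<bullet> b) *\<^sub>R b)" by (simp add: euclidean_representation)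
    also have "\<dots> = (\<Sum>b\<in>Basis. (v \<bullet> b) * ?D b)"
      using has_derivative_linear[OF d] by (simp add: linear_sum linear_cmul)
    also have "\<dots> = (\<Sum>b\<in>Basis. ?D b *\<^sub>R b) \<bullet> v"
      by (simp add: inner_sum_right inner_commute[of _ v] mult.commute)
    finally show ?thesis .
  qed
  then have eq: "?D = (\<lambda>v. (\<Sum>b\<in>Basis. ?D b *\<^sub>R b) \<bullet> v)" by blast
  have "(\<phi> has_derivative (\<lambda>v. (\<Sum>b\<in>Basis. ?D b *\<^sub>R b) \<bullet> v)) (at x)"
    using d by (subst (asm) eq)
  then show ?thesis using grad_eqI by metis
qed

lemma frechet_derivative_bump: "frechet_derivative (bump y \<rho>) (at x) v = bump_grad y \<rho> x \<bullet> v"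
  using frechet_derivative_at[OF bump_has_derivative] by metis

lemma continuous_on_bump_grad: "continuous_on S (bump_grad y \<rho>)"
  unfolding bump_grad_def[abs_def] by (intro continuous_intros)

lemma continuous_on_bump: "continuous_on S (bump y \<rho>)"
  unfolding bump_def[abs_def] by (intro continuous_intros)

lemma bump_C1: "Ck 1 UNIV (bump y \<rho>)"
  unfolding One_nat_def Ck.simps frechet_derivative_bump
  by (intro conjI ballI allI differentiableI[OF bump_has_derivative] continuous_on_inner
      continuous_on_bump_grad continuous_on_const)

lemma bump_pos: "x \<in> ball y \<rho> \<Longrightarrow> bump y \<rho> x > 0"
  and bump_zero: "0 \<le> \<rho> \<Longrightarrow> x \<notin> ball y \<rho> \<Longrightarrow> bump y \<rho> x = 0 \<and> bump_grad y \<rho> x = 0"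
proof -
  assume "x \<in> ball y \<rho>"
  then have "norm (x - y) < \<rho>" by (simp add: dist_norm norm_minus_commute)
  then have "(norm (x - y))\<^sup>2 < \<rho>\<^sup>2" by (intro power_strict_mono) auto
  then show "bump y \<rho> x > 0" by (simp add: bump_def power2_norm_eq_inner)
next
  assume "0 \<le> \<rho>" "x \<notin> ball y \<rho>"
  then have "norm (x - y) \<ge> \<rho>" by (simp add: dist_norm norm_minus_commute)
  then have "(norm (x - y))\<^sup>2 \<ge> \<rho>\<^sup>2" using \<open>0 \<le> \<rho>\<close> by (intro power_mono) auto
  then show "bump y \<rho> x = 0 \<and> bump_grad y \<rho> x = 0" by (simp add: bump_def bump_grad_def power2_norm_eq_inner)
qed

lemma closure_bump_support: "\<rho> > 0 \<Longrightarrow> closure {x. bump y \<rho> x \<noteq> 0} = cball y \<rho>"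
proof -
  assume r: "\<rho> > 0"
  have "bump y \<rho> x \<noteq> 0 \<longleftrightarrow> x \<in> ball y \<rho>" for x
    using bump_pos[of x y \<rho>] bump_zero[of \<rho> x y] r by (cases "x \<in> ball y \<rho>") auto
  then have "{x. bump y \<rho> x \<noteq> 0} = ball y \<rho>" by blast
  then show ?thesis using r by simp
qed

text \<open>\<open>S\<close> and the complement of \<open>K\<close> form an open cover, with
  continuity on each. It is meant for products of a cutoff with fields that are controlled on
  \<open>S\<close> only.\<close>

lemma continuous_on_UNIV_zero_extension:
  fixes k :: "'a::topological_space \<Rightarrow> 'b::{topological_space,zero}"
  assumes "open S" "closed K" "K \<subseteq> S" "continuous_on S k" "\<And>x. x \<notin> K \<Longrightarrow> k x = 0"
  shows "continuous_on UNIV k"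
proof -
  have "continuous_on (- K) k"
    using assms(5) continuous_on_const[of "- K" 0] by (subst continuous_on_cong[OF refl]) auto
  then have "continuous_on (S \<union> - K) k"
    using assms by (intro continuous_on_open_Un) auto
  moreover have "S \<union> - K = UNIV" using assms(3) by auto
  ultimately show ?thesis by simp
qed

lemma integral_subset_eq_UNIV:
  fixes k :: "'a::euclidean_space \<Rightarrow> real"
  assumes "K \<subseteq> S" "\<And>x. x \<notin> K \<Longrightarrow> k x = 0"
  shows "integral S k = integral UNIV k"
proof -
  have "(\<lambda>x. if x \<in> S then k x else 0) = k"
  proof
    show "(if x \<in> S then k x else 0) = k x" for x using assms(1) assms(2)[of x] by auto
  qed
  then show ?thesis by (metis integral_restrict_UNIV)
qed

lemma has_integral_integral_if_zero_outside_cball: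
  fixes k :: "'a::euclidean_space \<Rightarrow> real"
  assumes "continuous_on UNIV k" "cball y \<rho> \<subseteq> S" "\<And>x. x \<notin> cball y \<rho> \<Longrightarrow> k x = 0"
  shows "(k has_integral integral S k) UNIV"
proof -
  obtain a where "cball y \<rho> \<subseteq> cbox (-a) a"
    using bounded_subset_cbox_symmetric[OF bounded_cball] by blast
  then have "(k has_integral integral (cbox (-a) a) k) UNIV"
    by (intro has_integral_integral_cbox assms) blast
  then show ?thesis
    using integral_subset_eq_UNIV[of "cball y \<rho>" S k, OF assms(2,3)] by (simp add: integral_unique)
qed

text \<open>Integration by parts followed by the fundamental lemma of the calculus of variations: a
  nonzero residual keeps its sign on a small ball, where the bump detects it. Differentiability of
  \<open>V\<close> is asked on \<open>S\<close> only, because |\<nabla>u|^(p-2) \<nabla>u may fail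
  to be differentiable at critical points of u.\<close>

lemma weak_divergence_imp_pointwise:
  fixes V :: "'a::euclidean_space \<Rightarrow> 'a" and c :: "'a \<Rightarrow> real"
  assumes S: "open S" "S \<subseteq> \<Omega>" "y \<in> S"
    and V: "\<And>x. x \<in> S \<Longrightarrow> (V has_derivative V' x) (at x)"
    and V': "\<And>v. continuous_on S (\<lambda>x. V' x v)"
    and c: "continuous_on S c"
    and weak: "\<And>\<phi>. Ck 1 UNIV \<phi> \<Longrightarrow> compact (closure {x. \<phi> x \<noteq> 0}) \<Longrightarrow> closure {x. \<phi> x \<noteq> 0} \<subseteq> \<Omega> \<Longrightarrow>
        integral \<Omega> (\<lambda>x. V x \<bullet> grad \<phi> x) = integral \<Omega> (\<lambda>x. c x * \<phi> x)"
  shows "(\<Sum>b\<in>Basis. V' y b \<bullet> b) + c y = 0"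
proof (rule ccontr)
  define E where "E x = (\<Sum>b\<in>Basis. V' x b \<bullet> b) + c x" for x
  assume "\<not> ?thesis"
  then have Ey: "E y \<noteq> 0" by (simp add: E_def)
  have contE: "continuous_on S E"
    unfolding E_def by (intro continuous_intros V' c)
  \<comment> \<open>Multiplying by the constant \<open>E y\<close> treats both signs of the residual
    at once.\<close>
  have "open {x \<in> S. E x * E y > 0}"
    using continuous_on_open_vimage[OF S(1), THEN iffD1, OF continuous_on_mult_right[OF contE, of "E y"], rule_format, of "{0<..}"]
    by (auto simp: vimage_def Int_def conj_commute)
  moreover have "y \<in> {x \<in> S. E x * E y > 0}" using Ey S by (auto simp: zero_less_mult_iff)
  ultimately obtain \<rho> where \<rho>: "\<rho> > 0" "cball y \<rho> \<subseteq> {x \<in> S. E x * E y > 0}"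
    using open_contains_cball by blast
  then have cS: "cball y \<rho> \<subseteq> S" by blast
  have contV: "continuous_on S V"
    using V by (meson continuous_at_imp_continuous_on has_derivative_continuous)
  let ?\<phi> = "bump y \<rho>" and ?g = "bump_grad y \<rho>"
  have out: "?\<phi> x = 0" "?g x = 0" if "x \<notin> cball y \<rho>" for x
    using bump_zero[of \<rho> x y] \<rho>(1) that by auto
  \<comment> \<open>Integration by parts, one coordinate at a time: the integrand is the derivative
    in direction \<open>b\<close> of the bump times the component of \<open>V\<close> along
    \<open>b\<close>.\<close>
  have "((\<lambda>x. (?g x \<bullet> b) * (V x \<bullet> b) + ?\<phi> x * (V' x b \<bullet> b)) has_integral 0) UNIV" for b
  proof (rule has_integral_directional_derivative_0[where \<psi>' = "\<lambda>x v. (?g x \<bullet> v) * (V x \<bullet> b) + ?\<phi> x * (V' x v \<bullet> b)"])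
    show "((\<lambda>x. ?\<phi> x * (V x \<bullet> b)) has_derivative (\<lambda>v. (?g x \<bullet> v) * (V x \<bullet> b) + ?\<phi> x * (V' x v \<bullet> b))) (at x)" for x
    proof (cases "x \<in> S")
      case True
      show ?thesis
        by (auto intro!: derivative_eq_intros bump_has_derivative V True simp: algebra_simps)
    next
      case False
      then have "x \<notin> cball y \<rho>" using cS by blast
      then have "((\<lambda>x. ?\<phi> x * (V x \<bullet> b)) has_derivative (\<lambda>v. 0)) (at x)"
        by (intro has_derivative_transform_within_open[OF has_derivative_const[of 0], where s = "- cball y \<rho>"])
          (use out in auto)
      then show ?thesis using out \<open>x \<notin> cball y \<rho>\<close> by simp
    qed
    show "continuous_on UNIV (\<lambda>x. (?g x \<bullet> b) * (V x \<bullet> b) + ?\<phi> x * (V' x b \<bullet> b))"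
      by (rule continuous_on_UNIV_zero_extension[OF S(1) closed_cball cS])
        (use out in \<open>auto intro!: continuous_intros contV V' continuous_on_bump continuous_on_bump_grad\<close>)
  qed (use out in auto)
  then have "((\<lambda>x. \<Sum>b\<in>Basis. (?g x \<bullet> b) * (V x \<bullet> b) + ?\<phi> x * (V' x b \<bullet> b)) has_integral (\<Sum>b\<in>(Basis::'a set). 0)) UNIV"
    by (intro has_integral_sum) auto
  then have div0: "((\<lambda>x. ?g x \<bullet> V x + ?\<phi> x * (\<Sum>b\<in>Basis. V' x b \<bullet> b)) has_integral 0) UNIV"
    by (simp add: sum.distrib sum_distrib_left flip: euclidean_inner)
  have cont: "continuous_on UNIV (\<lambda>x. V x \<bullet> ?g x)" "continuous_on UNIV (\<lambda>x. c x * ?\<phi> x)"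
      "continuous_on UNIV (\<lambda>x. ?\<phi> x * E x)"
    by (rule continuous_on_UNIV_zero_extension[OF S(1) closed_cball cS];
        use out in \<open>auto intro!: continuous_intros contV c contE continuous_on_bump continuous_on_bump_grad\<close>)+
  obtain a where a: "cball y \<rho> \<subseteq> cbox (-a) a"
    using bounded_subset_cbox_symmetric[OF bounded_cball] by blast
  have outa: "?\<phi> x = 0" "?g x = 0" if "x \<notin> cbox (-a) a" for x
    using that a out by blast+
  have i1: "((\<lambda>x. V x \<bullet> ?g x) has_integral integral \<Omega> (\<lambda>x. V x \<bullet> ?g x)) UNIV"
    by (rule has_integral_integral_if_zero_outside_cball[OF cont(1)]) (use out cS S in auto)
  have i2: "((\<lambda>x. c x * ?\<phi> x) has_integral integral \<Omega> (\<lambda>x. c x * ?\<phi> x)) UNIV"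
    by (rule has_integral_integral_if_zero_outside_cball[OF cont(2)]) (use out cS S in auto)
  have "integral \<Omega> (\<lambda>x. V x \<bullet> ?g x) = integral \<Omega> (\<lambda>x. c x * ?\<phi> x)"
    using weak[OF bump_C1[of y \<rho>]] cS S closure_bump_support[OF \<rho>(1), of y]
    by (simp add: grad_eqI[OF bump_has_derivative])
  with has_integral_add[OF has_integral_diff[OF div0 i1] i2]
  have "((\<lambda>x. ?\<phi> x * E x) has_integral 0) UNIV"
    by (simp add: inner_commute E_def algebra_simps)
  then have z: "((\<lambda>x. ?\<phi> x * E x * E y) has_integral 0) UNIV"
    using has_integral_mult_left[of "\<lambda>x. ?\<phi> x * E x" 0 UNIV "E y"] by simp
  have "((\<lambda>x. ?\<phi> x * E x * E y) has_integral integral (cbox (-a) a) (\<lambda>x. ?\<phi> x * E x * E y)) UNIV"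
    by (rule has_integral_integral_cbox[OF continuous_on_mult_right[OF cont(3), of "E y"]]) (simp add: outa)
  then have "integral (cbox (-a) a) (\<lambda>x. ?\<phi> x * E x * E y) = 0"
    using z by (rule has_integral_unique)
  moreover have "continuous_on (cbox (-a) a) (\<lambda>x. ?\<phi> x * E x * E y)"
    using continuous_on_mult_right[OF cont(3), of "E y"] by (rule continuous_on_subset) simp
  ultimately have *: "((\<lambda>x. ?\<phi> x * E x * E y) has_integral 0) (cbox (-a) a)"
    by (metis integrable_continuous integrable_integral)
  have "?\<phi> y * E y * E y = 0"
  proof (rule has_integral_0_cbox_imp_0[OF _ _ *])
    show "continuous_on (cbox (-a) a) (\<lambda>x. ?\<phi> x * E x * E y)"
      using continuous_on_mult_right[OF cont(3), of "E y"] continuous_on_subset by blast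
    show "0 \<le> ?\<phi> x * E x * E y" for x
    proof (cases "x \<in> cball y \<rho>")
      case True
      then have "E x * E y > 0" using \<rho> by blast
      then show ?thesis by (simp add: bump_def mult.assoc)
    qed (use out in simp)
    have "ball y \<rho> \<subseteq> interior (cbox (-a) a)"
      using a by (intro interior_maximal) auto
    then show "box (-a) a \<noteq> {}" using \<rho>(1) by (metis centre_in_ball empty_iff interior_cbox subsetD)
    show "y \<in> cbox (-a) a" using a \<rho>(1) by auto
  qed
  then show False using Ey bump_pos[of y y \<rho>] \<rho>(1) by simp
qed

section \<open>The linearised operator and the P-function\<close>

lemma sum_Basis_inner_linear:
  fixes h :: "'a::euclidean_space \<Rightarrow> real"
  assumes "linear h"
  shows "(\<Sum>b\<in>Basis. (v \<bullet> b) * h b) = h v"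
proof -
  have "h v = h (\<Sum>b\<in>Basis. (v \<bullet> b) *\<^sub>R b)" by (simp add: euclidean_representation)
  also have "\<dots> = (\<Sum>b\<in>Basis. (v \<bullet> b) * h b)" using assms by (simp add: linear_sum linear_cmul)
  finally show ?thesis by simp
qed

text \<open>\<open>stretch p g\<close> is the square root of \<open>I + (p - 2) g \<otimes> g / |g|^2\<close>, the coefficient matrix of the linearised
  p-Laplacian. Summing second derivatives over stretched basis vectors keeps that operator a sum of pure second
  derivatives, so the second derivative test along lines suffices.\<close>
definition stretch :: "real \<Rightarrow> 'a::euclidean_space \<Rightarrow> 'a \<Rightarrow> 'a" where
  "stretch p g v = v + ((sqrt (p - 1) - 1) * (g \<bullet> v) / (g \<bullet> g)) *\<^sub>R g"

text \<open>\<open>stretch p g\<close> multiplies \<open>g\<close> by \<open>sqrt (p - 1)\<close>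
  and fixes its orthogonal complement, so the trace changes by p - 2 times the value of
  \<open>k\<close> on the unit vector along \<open>g\<close>. Bilinearity of \<open>k\<close> is
  enough; symmetry is not assumed.\<close>

lemma sum_Basis_stretch:
  fixes k :: "'a::euclidean_space \<Rightarrow> 'a \<Rightarrow> real"
  assumes p: "p \<ge> 1" and g: "g \<noteq> 0" and l: "\<And>x. linear (k x)" and r: "\<And>y. linear (\<lambda>x. k x y)"
  shows "(\<Sum>b\<in>Basis. k (stretch p g b) (stretch p g b)) = (\<Sum>b\<in>Basis. k b b) + (p - 2) * k g g / (g \<bullet> g)"
proof -
  define c where "c = (sqrt (p - 1) - 1) / (g \<bullet> g)"
  have w: "g \<bullet> g > 0" using g by simp
  have "k (stretch p g b) (stretch p g b)
      = k b b + c * ((g \<bullet> b) * k b g) + c * ((g \<bullet> b) * k g b) + c\<^sup>2 * k g g * ((g \<bullet> b) * (g \<bullet> b))" for b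
  proof -
    have "stretch p g b = b + (c * (g \<bullet> b)) *\<^sub>R g" by (simp add: stretch_def c_def)
    then show ?thesis
      by (simp add: linear_add[OF l] linear_add[OF r] linear_cmul[OF l] linear_cmul[OF r] algebra_simps power2_eq_square)
  qed
  then have "(\<Sum>b\<in>Basis. k (stretch p g b) (stretch p g b)) = (\<Sum>b\<in>Basis. k b b)
      + c * (\<Sum>b\<in>Basis. (g \<bullet> b) * k b g) + c * (\<Sum>b\<in>Basis. (g \<bullet> b) * k g b)
      + c\<^sup>2 * k g g * (\<Sum>b\<in>Basis. (g \<bullet> b) * (g \<bullet> b))"
    by (simp add: sum.distrib sum_distrib_left)
  also have "\<dots> = (\<Sum>b\<in>Basis. k b b) + (2 * c + c\<^sup>2 * (g \<bullet> g)) * k g g"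
    using sum_Basis_inner_linear[OF r, of g g] sum_Basis_inner_linear[OF l, of g g] euclidean_inner[of g g]
    by (simp add: algebra_simps)
  also have "2 * c + c\<^sup>2 * (g \<bullet> g) = ((sqrt (p - 1))\<^sup>2 - 1) / (g \<bullet> g)"
    using w by (simp add: c_def field_simps power2_eq_square)
  also have "(sqrt (p - 1))\<^sup>2 = p - 1" using p by simp
  finally show ?thesis by (simp add: field_simps)
qed

text \<open>\<open>G\<close>, \<open>H\<close> and \<open>T\<close> stand for the gradient, the
  Hessian as a linear map, and its derivative: \<open>T x v z\<close> differentiates
  \<open>H _ v\<close> in direction \<open>z\<close>. As parameters they allow vector algebra in
  place of iterated Frechet derivatives.\<close>

locale C3_function =
  fixes \<Omega> :: "'a::euclidean_space set" and u :: "'a \<Rightarrow> real" and G :: "'a \<Rightarrow> 'a"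
    and H :: "'a \<Rightarrow> 'a \<Rightarrow> 'a" and T :: "'a \<Rightarrow> 'a \<Rightarrow> 'a \<Rightarrow> 'a"
  assumes open_dom: "open \<Omega>"
    and u_deriv: "x \<in> \<Omega> \<Longrightarrow> (u has_derivative (\<lambda>v. G x \<bullet> v)) (at x)"
    and G_deriv: "x \<in> \<Omega> \<Longrightarrow> (G has_derivative H x) (at x)"
    and H_deriv: "x \<in> \<Omega> \<Longrightarrow> ((\<lambda>x. H x v) has_derivative T x v) (at x)"
    and H_sym: "x \<in> \<Omega> \<Longrightarrow> H x v \<bullet> z = v \<bullet> H x z"
    and T_sym: "x \<in> \<Omega> \<Longrightarrow> T x v z = T x z v"
begin

lemma H_linear: "x \<in> \<Omega> \<Longrightarrow> linear (H x)"
  using G_deriv has_derivative_linear by blast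

lemma T_linear: "x \<in> \<Omega> \<Longrightarrow> linear (T x v)"
  using H_deriv has_derivative_linear by blast

lemma T_linear_left: "x \<in> \<Omega> \<Longrightarrow> linear (\<lambda>v. T x v z)"
  using T_linear[of x z] by (simp add: T_sym[of x _ z])

text \<open>This is the symmetry of the Hessian differentiated in direction \<open>z\<close>.
  Together with \<open>T_sym\<close> it gives full symmetry of the third derivative.\<close>

lemma T_inner_sym: "x \<in> \<Omega> \<Longrightarrow> T x v z \<bullet> y = v \<bullet> T x y z"
proof -
  assume x: "x \<in> \<Omega>"
  have 1: "((\<lambda>x. H x v \<bullet> y) has_derivative (\<lambda>z. T x v z \<bullet> y)) (at x)"
    by (auto intro!: derivative_eq_intros H_deriv x)
  have "((\<lambda>x. v \<bullet> H x y) has_derivative (\<lambda>z. v \<bullet> T x y z)) (at x)"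
    by (auto intro!: derivative_eq_intros H_deriv x)
  then have "((\<lambda>x. H x v \<bullet> y) has_derivative (\<lambda>z. v \<bullet> T x y z)) (at x)"
    by (rule has_derivative_transform_within_open[OF _ open_dom x]) (simp add: H_sym)
  from has_derivative_unique[OF 1 this] show ?thesis by metis
qed

lemma continuous_on_G: "continuous_on \<Omega> G"
  using G_deriv has_derivative_continuous continuous_at_imp_continuous_on by blast

lemma continuous_on_u: "continuous_on \<Omega> u"
  using u_deriv has_derivative_continuous continuous_at_imp_continuous_on by blast

lemma continuous_on_H: "continuous_on \<Omega> (\<lambda>x. H x v)"
  using H_deriv has_derivative_continuous continuous_at_imp_continuous_on by blast

lemma open_noncritical: "open {x \<in> \<Omega>. G x \<noteq> 0}"
  using continuous_on_open_vimage[OF open_dom, THEN iffD1, OF continuous_on_G, rule_format, of "- {0}"]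
  by (auto simp: vimage_def Int_def conj_commute)

text \<open>The squared norm of the Hessian restricted to the orthogonal complement of the gradient.\<close>
lemma tangential_hessian_norm:
  assumes x: "x \<in> \<Omega>" and g: "G x \<noteq> 0"
  defines "w \<equiv> G x \<bullet> G x" and "s \<equiv> G x \<bullet> H x (G x)" and "k \<equiv> H x (G x) \<bullet> H x (G x)"
  shows "(\<Sum>b\<in>Basis. (norm (H x b - ((G x \<bullet> b) / w) *\<^sub>R H x (G x) - ((H x (G x) \<bullet> b) / w) *\<^sub>R G x
           + (s * (G x \<bullet> b) / w\<^sup>2) *\<^sub>R G x))\<^sup>2) = (\<Sum>b\<in>Basis. H x b \<bullet> H x b) - 2 * k / w + s\<^sup>2 / w\<^sup>2"
proof -
  let ?g = "G x" and ?h = "H x (G x)"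
  have w: "w > 0" using g by (simp add: w_def)
  have 1: "H x b \<bullet> ?g = ?h \<bullet> b" for b using H_sym[OF x, of b ?g] by (simp add: inner_commute)
  \<comment> \<open>The vector is the image of \<open>b\<close> under P H P, with P the orthogonal
    projection along the gradient; its squared length is sorted into products that can be summed
    over the basis.\<close>
  have "(norm (H x b - ((?g \<bullet> b) / w) *\<^sub>R ?h - ((?h \<bullet> b) / w) *\<^sub>R ?g + (s * (?g \<bullet> b) / w\<^sup>2) *\<^sub>R ?g))\<^sup>2
     = H x b \<bullet> H x b + (k / w\<^sup>2 - s\<^sup>2 / w^3) * ((?g \<bullet> b) * (?g \<bullet> b)) - (1 / w) * ((?h \<bullet> b) * (?h \<bullet> b))
       - (2 / w) * ((?g \<bullet> b) * (H x b \<bullet> ?h)) + (2 * s / w\<^sup>2) * ((?g \<bullet> b) * (?h \<bullet> b))" for b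
  proof -
    have e: "(norm (X - a *\<^sub>R Y - c *\<^sub>R Z + d *\<^sub>R Z))\<^sup>2 = X \<bullet> X + a\<^sup>2 * (Y \<bullet> Y) + (d - c)\<^sup>2 * (Z \<bullet> Z)
        - 2 * a * (X \<bullet> Y) + 2 * (d - c) * (X \<bullet> Z) - 2 * a * (d - c) * (Z \<bullet> Y)" for X Y Z :: 'a and a c d
      unfolding power2_norm_eq_inner
      by (simp add: inner_diff_left inner_diff_right inner_add_left inner_add_right inner_commute algebra_simps power2_eq_square)
    show ?thesis
      unfolding e 1 w_def[symmetric] s_def[symmetric] k_def[symmetric]
      using w by (simp add: field_simps power2_eq_square power3_eq_cube)
  qed
  then have "(\<Sum>b\<in>Basis. (norm (H x b - ((?g \<bullet> b) / w) *\<^sub>R ?h - ((?h \<bullet> b) / w) *\<^sub>R ?g + (s * (?g \<bullet> b) / w\<^sup>2) *\<^sub>R ?g))\<^sup>2)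
     = (\<Sum>b\<in>Basis. H x b \<bullet> H x b) + (k / w\<^sup>2 - s\<^sup>2 / w^3) * (\<Sum>b\<in>Basis. (?g \<bullet> b) * (?g \<bullet> b))
       - (1 / w) * (\<Sum>b\<in>Basis. (?h \<bullet> b) * (?h \<bullet> b))
       - (2 / w) * (\<Sum>b\<in>Basis. (?g \<bullet> b) * (H x b \<bullet> ?h)) + (2 * s / w\<^sup>2) * (\<Sum>b\<in>Basis. (?g \<bullet> b) * (?h \<bullet> b))"
    by (simp add: sum.distrib sum_subtractf sum_distrib_left)
  also have "(\<Sum>b\<in>Basis. (?g \<bullet> b) * (?g \<bullet> b)) = w" by (simp add: w_def euclidean_inner[symmetric])
  also have "(\<Sum>b\<in>Basis. (?h \<bullet> b) * (?h \<bullet> b)) = k" by (simp add: k_def euclidean_inner[symmetric])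
  also have "(\<Sum>b\<in>Basis. (?g \<bullet> b) * (?h \<bullet> b)) = s" by (simp add: s_def euclidean_inner[symmetric])
  also have "(\<Sum>b\<in>Basis. (?g \<bullet> b) * (H x b \<bullet> ?h)) = k"
  proof -
    have "linear (\<lambda>b. H x b \<bullet> ?h)"
      using H_linear[OF x] by (auto intro!: linearI simp: linear_add linear_cmul inner_add_left)
    from sum_Basis_inner_linear[OF this] show ?thesis by (simp add: k_def)
  qed
  also have "(\<Sum>b\<in>Basis. H x b \<bullet> H x b) + (k / w\<^sup>2 - s\<^sup>2 / w^3) * w - 1 / w * k - 2 / w * k + 2 * s / w\<^sup>2 * s
      = (\<Sum>b\<in>Basis. H x b \<bullet> H x b) - 2 * k / w + s\<^sup>2 / w\<^sup>2"
    using w by (simp add: field_simps power2_eq_square power3_eq_cube)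
  finally show ?thesis .
qed

end

text \<open>\<open>Ck\<close> speaks of iterated directional derivatives of a scalar;
  \<open>H\<close> and \<open>T\<close> collect those of the gradient coordinates. The symmetry of
  \<open>H\<close> uses continuity of the second derivatives, that of \<open>T\<close> the
  continuity of the third ones.\<close>

lemma C3_function_Ck3:
  fixes u :: "'a::euclidean_space \<Rightarrow> real"
  assumes \<Omega>: "open \<Omega>" and C3: "Ck 3 \<Omega> u"
  shows "\<exists>H T. C3_function \<Omega> u (grad u) H T"
proof -
  define D where "D \<phi> x v = frechet_derivative \<phi> (at x) v" for \<phi> :: "'a \<Rightarrow> real" and x v
  have d1: "(u has_derivative D u x) (at x)" if "x \<in> \<Omega>" for x
    using C3 that unfolding D_def by (simp add: numeral_3_eq_3 frechet_derivative_works)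
  have d2: "((\<lambda>x. D u x v) has_derivative D (\<lambda>x. D u x v) x) (at x)" if "x \<in> \<Omega>" for x v
    using C3 that unfolding D_def by (simp add: numeral_3_eq_3 frechet_derivative_works)
  have d3: "((\<lambda>x. D (\<lambda>x. D u x v) x z) has_derivative D (\<lambda>x. D (\<lambda>x. D u x v) x z) x) (at x)" if "x \<in> \<Omega>" for x v z
    using C3 that unfolding D_def by (simp add: numeral_3_eq_3 frechet_derivative_works)
  have c3: "continuous_on \<Omega> (\<lambda>x. D (\<lambda>x. D (\<lambda>x. D u x v) x z) x y)" for v z y
    using C3 unfolding D_def by (simp add: numeral_3_eq_3)
  have c2: "continuous_on \<Omega> (\<lambda>x. D (\<lambda>x. D u x v) x z)" for v z
    by (intro continuous_at_imp_continuous_on ballI has_derivative_continuous[OF d3])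
  have s2: "D (\<lambda>x. D u x v) x z = D (\<lambda>x. D u x z) x v" if "x \<in> \<Omega>" for x v z
    by (rule second_derivative_symmetric[where f = u and f' = "D u" and f'' = "\<lambda>x v. D (\<lambda>x. D u x v) x", OF \<Omega> that])
      (use d1 d2 c2 in auto)
  have s3: "D (\<lambda>x. D (\<lambda>x. D u x v) x z) x y = D (\<lambda>x. D (\<lambda>x. D u x v) x y) x z" if "x \<in> \<Omega>" for x v z y
    by (rule second_derivative_symmetric[where f = "\<lambda>x. D u x v" and f' = "D (\<lambda>x. D u x v)" and
          f'' = "\<lambda>x z. D (\<lambda>x. D (\<lambda>x. D u x v) x z) x", OF \<Omega> that])
      (use d2 d3 c3 in auto)
  define H where "H x v = (\<Sum>b\<in>Basis. D (\<lambda>x. D u x b) x v *\<^sub>R b)" for x v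
  define T where "T x v z = (\<Sum>b\<in>Basis. D (\<lambda>x. D (\<lambda>x. D u x b) x v) x z *\<^sub>R b)" for x v z
  have G: "(u has_derivative (\<lambda>v. grad u x \<bullet> v)) (at x)" if "x \<in> \<Omega>" for x
    using has_derivative_grad d1[OF that] differentiableI by blast
  have Gv: "grad u x \<bullet> v = D u x v" if "x \<in> \<Omega>" for x v
    using has_derivative_unique[OF G[OF that] d1[OF that]] by metis
  have Geq: "grad u x = (\<Sum>b\<in>Basis. D u x b *\<^sub>R b)" if "x \<in> \<Omega>" for x
    using euclidean_representation[of "grad u x"] by (simp add: Gv[OF that])
  have Gd: "(grad u has_derivative H x) (at x)" if "x \<in> \<Omega>" for x
  proof (rule has_derivative_transform_within_open[OF _ \<Omega> that])
    show "((\<lambda>x. \<Sum>b\<in>Basis. D u x b *\<^sub>R b) has_derivative H x) (at x)"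
      unfolding H_def by (intro has_derivative_sum has_derivative_scaleR_left d2 that)
  qed (simp add: Geq)
  have Hv: "H x v \<bullet> z = D (\<lambda>x. D u x z) x v" if "x \<in> \<Omega>" for x v z
  proof -
    have "((\<lambda>x. grad u x \<bullet> z) has_derivative (\<lambda>v. H x v \<bullet> z)) (at x)"
      by (auto intro!: derivative_eq_intros Gd that)
    then have "((\<lambda>x. D u x z) has_derivative (\<lambda>v. H x v \<bullet> z)) (at x)"
      by (rule has_derivative_transform_within_open[OF _ \<Omega> that]) (simp add: Gv)
    from has_derivative_unique[OF this d2[OF that]] show ?thesis by metis
  qed
  have "C3_function \<Omega> u (grad u) H T"
  proof
    show "((\<lambda>x. H x v) has_derivative T x v) (at x)" if "x \<in> \<Omega>" for x v
      unfolding H_def T_def by (intro has_derivative_sum has_derivative_scaleR_left d3 that)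
    show "H x v \<bullet> z = v \<bullet> H x z" if "x \<in> \<Omega>" for x v z
      using Hv[OF that, of v z] Hv[OF that, of z v] s2[OF that, of z v] by (simp add: inner_commute)
    show "T x v z = T x z v" if "x \<in> \<Omega>" for x v z
      unfolding T_def using s3[OF that] by simp
  qed (use \<Omega> G Gd in auto)
  then show ?thesis by blast
qed

text \<open>\<open>equation\<close> is the p-Laplace equation with the divergence carried out and
  multiplied by |\<nabla>u|^(4-p), which clears the singular powers. It is imposed at noncritical
  points.\<close>

locale p_laplace = C3_function +
  fixes p :: real and f f' F :: "real \<Rightarrow> real"
  assumes p: "p > 1"
    and f_deriv: "(f has_real_derivative f' s) (at s)"
    and F_deriv: "(F has_real_derivative f s) (at s)"
    and equation: "x \<in> \<Omega> \<Longrightarrow> G x \<noteq> 0 \<Longrightarrow>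
      (G x \<bullet> G x) * (\<Sum>b\<in>Basis. H x b \<bullet> b) + (p - 2) * (G x \<bullet> H x (G x)) + f (u x) * (G x \<bullet> G x) powr (2 - p / 2) = 0"

text \<open>On the open set where the gradient does not vanish, the field |\<nabla>u|^(p-2)
  \<nabla>u is continuously differentiable, so testing with bumps supported there yields the
  equation pointwise.\<close>

lemma p_laplace_weak:
  fixes u :: "'a::euclidean_space \<Rightarrow> real"
  assumes C3: "C3_function \<Omega> u (grad u) H T" and p: "p > 1"
    and f: "\<And>s. (f has_real_derivative f' s) (at s)"
    and F: "\<And>s. (F has_real_derivative f s) (at s)"
    and weak: "p_laplace_solution p f \<Omega> u"
  shows "p_laplace \<Omega> u (grad u) H T p f f' F"
proof -
  interpret C3_function \<Omega> u "grad u" H T by (rule C3)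
  let ?G = "grad u" and ?S = "{x \<in> \<Omega>. grad u x \<noteq> 0}"
  define V where "V x = (?G x \<bullet> ?G x) powr (p / 2 - 1) *\<^sub>R ?G x" for x
  define V' where "V' x v = (?G x \<bullet> ?G x) powr (p / 2 - 1) *\<^sub>R H x v
    + ((p - 2) * (?G x \<bullet> ?G x) powr (p / 2 - 2) * (?G x \<bullet> H x v)) *\<^sub>R ?G x" for x v
  \<comment> \<open>At \<open>g = 0\<close> both sides are 0, because \<open>0 powr\<close> any
    exponent is 0; hence the weak formulation can be rewritten on all of \<Omega>, critical points
    included.\<close>
  have powr_norm: "norm g powr (p - 2) = (g \<bullet> g) powr (p / 2 - 1)" for g :: 'a
    by (cases "g = 0") (simp_all add: power2_norm_eq_inner[symmetric] powr_powr right_diff_distrib flip: powr_numeral)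
  have V: "(V has_derivative V' x) (at x)" if "x \<in> ?S" for x
  proof -
    have x: "x \<in> \<Omega>" and w: "?G x \<bullet> ?G x > 0" using that by auto
    have 1: "((\<lambda>x. ?G x \<bullet> ?G x) has_derivative (\<lambda>v. 2 * (?G x \<bullet> H x v))) (at x)"
      by (auto intro!: derivative_eq_intros G_deriv x simp: inner_commute)
    have 2: "((\<lambda>r. r powr (p / 2 - 1)) has_derivative (\<lambda>h. h * ((p / 2 - 1) * (?G x \<bullet> ?G x) powr (p / 2 - 2)))) (at (?G x \<bullet> ?G x))"
      using has_real_derivative_powr[OF w, of "p / 2 - 1"]
      by (simp add: has_field_derivative_def mult_commute_abs mult.commute)
    show ?thesis unfolding V_def[abs_def] V'_def
      by (rule derivative_eq_intros has_derivative_compose[OF 1 2] G_deriv x refl)+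
        (simp add: algebra_simps)
  qed
  have cont: "continuous_on ?S (\<lambda>x. V' x v)" for v
    unfolding V'_def
    by (intro continuous_intros continuous_on_powr continuous_on_subset[OF continuous_on_G]
        continuous_on_subset[OF continuous_on_H]) auto
  have contf: "continuous_on ?S (\<lambda>x. f (u x))"
  proof -
    have "continuous_on UNIV f" using f by (meson DERIV_isCont continuous_at_imp_continuous_on)
    then show ?thesis
      by (rule continuous_on_compose2) (auto intro: continuous_on_subset[OF continuous_on_u])
  qed
  have eq: "(\<Sum>b\<in>Basis. V' x b \<bullet> b) + f (u x) = 0" if "x \<in> ?S" for x
  proof (rule weak_divergence_imp_pointwise[OF open_noncritical _ that V cont contf])
    fix \<phi> :: "'a \<Rightarrow> real"
    assume "Ck 1 UNIV \<phi>" "compact (closure {x. \<phi> x \<noteq> 0})" "closure {x. \<phi> x \<noteq> 0} \<subseteq> \<Omega>"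
    with weak have "integral \<Omega> (\<lambda>x. norm (grad u x) powr (p - 2) * (grad u x \<bullet> grad \<phi> x)) = integral \<Omega> (\<lambda>x. f (u x) * \<phi> x)"
      unfolding p_laplace_solution_def by blast
    then show "integral \<Omega> (\<lambda>x. V x \<bullet> grad \<phi> x) = integral \<Omega> (\<lambda>x. f (u x) * \<phi> x)"
      by (simp add: V_def powr_norm)
  qed auto
  show ?thesis
  proof
    fix x assume x: "x \<in> \<Omega>" "?G x \<noteq> 0"
    define w where "w = ?G x \<bullet> ?G x"
    have w: "w > 0" using x by (simp add: w_def)
    have lin: "linear (\<lambda>b. ?G x \<bullet> H x b)"
      using H_linear[OF x(1)] by (auto intro!: linearI simp: linear_add linear_cmul inner_add_right)
    have "(\<Sum>b\<in>Basis. V' x b \<bullet> b) = w powr (p / 2 - 1) * (\<Sum>b\<in>Basis. H x b \<bullet> b)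
        + (p - 2) * w powr (p / 2 - 2) * (\<Sum>b\<in>Basis. (?G x \<bullet> b) * (?G x \<bullet> H x b))"
      unfolding V'_def w_def by (simp only: inner_add_left inner_scaleR_left sum.distrib sum_distrib_left) (simp add: mult_ac)
    also have "(\<Sum>b\<in>Basis. (?G x \<bullet> b) * (?G x \<bullet> H x b)) = ?G x \<bullet> H x (?G x)"
      by (rule sum_Basis_inner_linear[OF lin])
    finally have "w powr (2 - p / 2) * (w powr (p / 2 - 1) * (\<Sum>b\<in>Basis. H x b \<bullet> b)
        + (p - 2) * w powr (p / 2 - 2) * (?G x \<bullet> H x (?G x)) + f (u x)) = 0"
      using eq[of x] x by simp
    moreover have "w powr (2 - p / 2) * w powr (p / 2 - 1) = w" "w powr (2 - p / 2) * w powr (p / 2 - 2) = 1"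
      using w by (simp_all add: powr_add[symmetric])
    ultimately have "w * (\<Sum>b\<in>Basis. H x b \<bullet> b) + (p - 2) * (?G x \<bullet> H x (?G x)) + f (u x) * w powr (2 - p / 2) = 0"
      by (simp add: distrib_left mult_ac)
    then show "?G x \<bullet> ?G x * (\<Sum>b\<in>Basis. H x b \<bullet> b) + (p - 2) * (?G x \<bullet> H x (?G x))
        + f (u x) * (?G x \<bullet> ?G x) powr (2 - p / 2) = 0" by (simp add: w_def)
  qed (use p f F in auto)
qed

text \<open>The algebra behind the P-function: \<open>w\<close> is \<open>|\<nabla>u|^2\<close>, \<open>r\<close> is \<open>|\<nabla>u|^(-p)\<close>, \<open>s\<close> and \<open>k\<close> are \<open>\<nabla>u \<bullet> D\<^sup>2u \<nabla>u\<close> and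
  \<open>|D\<^sup>2u \<nabla>u|^2\<close>, \<open>h2\<close> is \<open>|D\<^sup>2u|^2\<close>, \<open>t\<close> is the Laplacian, \<open>t3\<close> and \<open>tn\<close> come from third derivatives, \<open>c\<close> and \<open>c'\<close> are
  \<open>f(u)\<close> and \<open>f'(u)\<close>. \<open>E2\<close> is the equation and \<open>E3\<close> its derivative along the gradient.\<close>
lemma P_function_identity:
  fixes w r s k h2 t t3 tn p c c' :: real
  assumes w: "w > 0" and r: "r > 0"
    and E2: "w * t + (p - 2) * s + c * (w\<^sup>2 * r) = 0"
    and E3: "2 * s * t + w * t3 + (p - 2) * (2 * k + tn) + c' * (w^3 * r) + c * ((4 - p) * (w * r) * s) = 0"
  defines "d \<equiv> (p - 1) * s / (r * w) + c * w"
  shows "(p - 1) * ((p / 2 - 1) / (r * w\<^sup>2) * 2 * (k + (p - 2) * s\<^sup>2 / w)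
        + (h2 + (p - 2) * k / w + t3 + (p - 2) * tn / w) / (r * w)) + c' * ((p - 1) * w) + c * (t + (p - 2) * s / w)
    = (p - 1) / (r * w) * (h2 - 2 * k / w + s\<^sup>2 / w\<^sup>2) + 2 * (p - 1) / (r * w\<^sup>2) * (k - s\<^sup>2 / w)
      + r * d * ((p - 1) * d / w - p * c)"
proof -
  have t: "t = - ((p - 2) * s / w + c * w * r)"
    using E2 w by (simp add: field_simps power2_eq_square)
  have t3: "t3 = - (2 * s * t + (p - 2) * (2 * k + tn) + c' * (w^3 * r) + c * ((4 - p) * (w * r) * s)) / w"
    using E3 w by (simp add: field_simps)
  show ?thesis
    unfolding d_def t3 t using w r
    by (simp add: field_simps power2_eq_square power3_eq_cube)
qed

section \<open>Derivatives of the P-function and its elliptic inequality\<close>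

context p_laplace
begin

abbreviation W :: "'a \<Rightarrow> real" where "W x \<equiv> G x \<bullet> G x"

definition Q :: "'a \<Rightarrow> real" where
  "Q x = (p - 1) / p * norm (G x) powr p + F (u x)"

definition dQ :: "'a \<Rightarrow> 'a \<Rightarrow> real" where
  "dQ x v = (p - 1) * W x powr (p / 2 - 1) * (G x \<bullet> H x v) + f (u x) * (G x \<bullet> v)"

definition d2Q :: "'a \<Rightarrow> 'a \<Rightarrow> 'a \<Rightarrow> real" where
  "d2Q x v z = (p - 1) * ((p / 2 - 1) * W x powr (p / 2 - 2) * (2 * (G x \<bullet> H x z)) * (G x \<bullet> H x v)
      + W x powr (p / 2 - 1) * (H x z \<bullet> H x v + G x \<bullet> T x v z))
    + f' (u x) * (G x \<bullet> z) * (G x \<bullet> v) + f (u x) * (H x z \<bullet> v)"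

lemma W_deriv: "x \<in> \<Omega> \<Longrightarrow> (W has_derivative (\<lambda>z. 2 * (G x \<bullet> H x z))) (at x)"
  by (auto intro!: derivative_eq_intros G_deriv simp: inner_commute)

lemma W_powr_deriv:
  assumes "x \<in> \<Omega>" "G x \<noteq> 0"
  shows "((\<lambda>x. W x powr a) has_derivative (\<lambda>z. a * W x powr (a - 1) * (2 * (G x \<bullet> H x z)))) (at x)"
proof -
  have "W x > 0" using assms by simp
  then have "((\<lambda>r. r powr a) has_derivative (\<lambda>h. h * (a * W x powr (a - 1)))) (at (W x))"
    using has_real_derivative_powr[of "W x" a]
    by (simp add: has_field_derivative_def mult_commute_abs mult.commute)
  from has_derivative_compose[OF W_deriv[OF assms(1)] this] show ?thesis
    by (simp add: mult.commute)
qed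

lemma compose_u_deriv:
  assumes "x \<in> \<Omega>" "(h has_real_derivative h') (at (u x))"
  shows "((\<lambda>x. h (u x)) has_derivative (\<lambda>z. h' * (G x \<bullet> z))) (at x)"
  using has_derivative_compose[OF u_deriv[OF assms(1)] assms(2)[unfolded has_field_derivative_def]] .

lemma norm_powr: "norm g powr p = (g \<bullet> g) powr (p / 2)" for g :: 'a
  by (cases "g = 0") (simp_all add: power2_norm_eq_inner[symmetric] powr_powr flip: powr_numeral)

lemma Q_deriv:
  assumes "x \<in> \<Omega>" "G x \<noteq> 0"
  shows "(Q has_derivative dQ x) (at x)"
proof -
  have "((\<lambda>x. (p - 1) / p * W x powr (p / 2) + F (u x)) has_derivative
      (\<lambda>z. (p - 1) / p * (p / 2 * W x powr (p / 2 - 1) * (2 * (G x \<bullet> H x z))) + f (u x) * (G x \<bullet> z))) (at x)"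
    by (intro has_derivative_add has_derivative_mult_right W_powr_deriv compose_u_deriv F_deriv assms)
  moreover have "(\<lambda>z. (p - 1) / p * (p / 2 * W x powr (p / 2 - 1) * (2 * (G x \<bullet> H x z))) + f (u x) * (G x \<bullet> z)) = dQ x"
    using p by (auto simp: dQ_def)
  ultimately show ?thesis
    by (simp add: Q_def[abs_def] norm_powr)
qed

lemma dQ_deriv:
  assumes "x \<in> \<Omega>" "G x \<noteq> 0"
  shows "((\<lambda>x. dQ x v) has_derivative d2Q x v) (at x)"
  unfolding dQ_def
  by (rule derivative_eq_intros W_powr_deriv compose_u_deriv[OF _ f_deriv] G_deriv H_deriv assms refl)+
    (auto simp: d2Q_def algebra_simps fun_eq_iff)

text \<open>The equation holds on an open set, so its derivative along the gradient vanishes. The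
  relation serves to eliminate the third derivatives of u from \<open>LQ\<close>.\<close>

lemma differentiated_equation:
  assumes x: "x \<in> \<Omega>" and g: "G x \<noteq> 0"
  shows "2 * (G x \<bullet> H x (G x)) * (\<Sum>b\<in>Basis. H x b \<bullet> b) + W x * (\<Sum>b\<in>Basis. G x \<bullet> T x b b)
    + (p - 2) * (2 * (H x (G x) \<bullet> H x (G x)) + G x \<bullet> T x (G x) (G x))
    + f' (u x) * (W x * W x powr (2 - p / 2)) + f (u x) * ((4 - p) * W x powr (1 - p / 2) * (G x \<bullet> H x (G x))) = 0"
proof -
  let ?S = "{x \<in> \<Omega>. G x \<noteq> 0}"
  \<comment> \<open>The term \<open>G x \<bullet> H x (G x)\<close> is expanded over the basis
    because \<open>H_deriv\<close> differentiates \<open>H x v\<close> for a fixed vector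
    \<open>v\<close> only.\<close>
  let ?E = "\<lambda>x. W x * (\<Sum>b\<in>Basis. H x b \<bullet> b) + (p - 2) * (\<Sum>b\<in>Basis. (G x \<bullet> b) * (G x \<bullet> H x b)) + f (u x) * W x powr (2 - p / 2)"
  have lin: "linear (\<lambda>b. v \<bullet> H x b)" if "x \<in> \<Omega>" for x v
    using H_linear[OF that] by (auto intro!: linearI simp: linear_add linear_cmul inner_add_right)
  have E0: "?E x = 0" if "x \<in> ?S" for x
    using equation[of x] that by (simp add: sum_Basis_inner_linear[OF lin])
  have d: "(?E has_derivative (\<lambda>z. (2 * (G x \<bullet> H x z)) * (\<Sum>b\<in>Basis. H x b \<bullet> b) + W x * (\<Sum>b\<in>Basis. T x b z \<bullet> b)
     + (p - 2) * (\<Sum>b\<in>Basis. (H x z \<bullet> b) * (G x \<bullet> H x b) + (G x \<bullet> b) * (H x z \<bullet> H x b + G x \<bullet> T x b z))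
     + f' (u x) * (G x \<bullet> z) * W x powr (2 - p / 2) + f (u x) * ((2 - p / 2) * W x powr (2 - p / 2 - 1) * (2 * (G x \<bullet> H x z))))) (at x)"
    by (rule derivative_eq_intros W_powr_deriv W_deriv compose_u_deriv[OF _ f_deriv] G_deriv H_deriv x g refl)+
      (auto simp: fun_eq_iff sum_distrib_left sum.distrib algebra_simps)
  have d0: "(?E has_derivative (\<lambda>_. 0)) (at x)"
    by (rule has_derivative_transform_within_open[OF has_derivative_const[of 0] open_noncritical]) (use E0 x g in auto)
  have "(2 * (G x \<bullet> H x z)) * (\<Sum>b\<in>Basis. H x b \<bullet> b) + W x * (\<Sum>b\<in>Basis. T x b z \<bullet> b)
     + (p - 2) * (\<Sum>b\<in>Basis. (H x z \<bullet> b) * (G x \<bullet> H x b) + (G x \<bullet> b) * (H x z \<bullet> H x b + G x \<bullet> T x b z))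
     + f' (u x) * (G x \<bullet> z) * W x powr (2 - p / 2) + f (u x) * ((2 - p / 2) * W x powr (2 - p / 2 - 1) * (2 * (G x \<bullet> H x z))) = 0" for z
    using fun_cong[OF has_derivative_unique[OF d d0], of z] .
  from this[of "G x"]
  have "(2 * (G x \<bullet> H x (G x))) * (\<Sum>b\<in>Basis. H x b \<bullet> b) + W x * (\<Sum>b\<in>Basis. T x b (G x) \<bullet> b)
     + (p - 2) * ((\<Sum>b\<in>Basis. (H x (G x) \<bullet> b) * (G x \<bullet> H x b)) + (\<Sum>b\<in>Basis. (G x \<bullet> b) * (H x (G x) \<bullet> H x b))
       + (\<Sum>b\<in>Basis. (G x \<bullet> b) * (G x \<bullet> T x b (G x))))
     + f' (u x) * W x * W x powr (2 - p / 2) + f (u x) * ((2 - p / 2) * W x powr (2 - p / 2 - 1) * (2 * (G x \<bullet> H x (G x)))) = 0"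
    by (simp add: sum.distrib distrib_left add.assoc)
  moreover have "(\<Sum>b\<in>Basis. (H x (G x) \<bullet> b) * (G x \<bullet> H x b)) = H x (G x) \<bullet> H x (G x)"
    using sum_Basis_inner_linear[OF lin[OF x], of "H x (G x)" "G x"] H_sym[OF x, of "G x" "H x (G x)"] by simp
  moreover have "(\<Sum>b\<in>Basis. (G x \<bullet> b) * (H x (G x) \<bullet> H x b)) = H x (G x) \<bullet> H x (G x)"
    using sum_Basis_inner_linear[OF lin[OF x], of "G x" "H x (G x)"] by simp
  moreover have "(\<Sum>b\<in>Basis. (G x \<bullet> b) * (G x \<bullet> T x b (G x))) = G x \<bullet> T x (G x) (G x)"
  proof -
    have "linear (\<lambda>b. G x \<bullet> T x b (G x))"
      by (auto intro!: linearI simp: linear_add[OF T_linear_left[OF x]] linear_cmul[OF T_linear_left[OF x]] inner_add_right)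
    from sum_Basis_inner_linear[OF this] show ?thesis .
  qed
  moreover have "T x b (G x) \<bullet> b = G x \<bullet> T x b b" for b
    using T_sym[OF x, of b "G x"] T_inner_sym[OF x, of "G x" b b] by simp
  moreover have "2 - p / 2 - 1 = 1 - p / 2" "(2 - p / 2) * q * (2 * r) = (4 - p) * q * r" for q r
    by (simp_all add: algebra_simps)
  ultimately show ?thesis by (simp add: algebra_simps)
qed

definition LQ :: "'a \<Rightarrow> real" where
  "LQ x = (\<Sum>b\<in>Basis. d2Q x (stretch p (G x) b) (stretch p (G x) b))"

text \<open>A Bochner type identity: the equation and its derivative eliminate the Laplacian and the
  third derivatives. There remain the squared norms of the tangential Hessian and of the tangential
  part of \<open>H x (G x)\<close> with nonnegative weights, and terms that contain the derivative
  of \<open>Q\<close> along the gradient.\<close>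

lemma LQ_eq:
  assumes x: "x \<in> \<Omega>" and g: "G x \<noteq> 0"
  defines "r \<equiv> W x powr (- p / 2)" and "s \<equiv> G x \<bullet> H x (G x)" and "k \<equiv> H x (G x) \<bullet> H x (G x)"
  shows "LQ x = (p - 1) / (r * W x) * ((\<Sum>b\<in>Basis. H x b \<bullet> H x b) - 2 * k / W x + s\<^sup>2 / (W x)\<^sup>2)
      + 2 * (p - 1) / (r * (W x)\<^sup>2) * (k - s\<^sup>2 / W x) + r * dQ x (G x) * ((p - 1) * dQ x (G x) / W x - p * f (u x))"
proof -
  define w where "w = W x"
  have w: "w > 0" using g by (simp add: w_def)
  have r: "r > 0" using g by (simp add: r_def)
  \<comment> \<open>Writing every power of |\<nabla>u| through \<open>w\<close> and
    \<open>r = |\<nabla>u|^(-p)\<close> turns the identity into one between rational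
    functions.\<close>
  have rw: "w powr (p / 2 - 1) = 1 / (r * w)" "w powr (p / 2 - 2) = 1 / (r * w\<^sup>2)"
    "w powr (2 - p / 2) = w\<^sup>2 * r" "w powr (1 - p / 2) = w * r"
  proof -
    have e: "w powr (p / 2) = 1 / r"
      unfolding r_def w_def[symmetric] using w by (simp add: powr_minus field_simps)
    show "w powr (p / 2 - 1) = 1 / (r * w)" "w powr (p / 2 - 2) = 1 / (r * w\<^sup>2)"
      "w powr (2 - p / 2) = w\<^sup>2 * r" "w powr (1 - p / 2) = w * r"
      using w by (simp_all add: powr_diff e)
  qed
  define t where "t = (\<Sum>b\<in>Basis. H x b \<bullet> b)"
  define t3 where "t3 = (\<Sum>b\<in>Basis. G x \<bullet> T x b b)"
  define tn where "tn = G x \<bullet> T x (G x) (G x)"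
  define h2 where "h2 = (\<Sum>b\<in>Basis. H x b \<bullet> H x b)"
  note HL = H_linear[OF x] and TL = T_linear[OF x] and TL' = T_linear_left[OF x]
  have "LQ x = (\<Sum>b\<in>Basis. d2Q x b b) + (p - 2) * d2Q x (G x) (G x) / w"
    unfolding LQ_def w_def
    by (rule sum_Basis_stretch)
      (use p g in \<open>auto intro!: linearI simp: d2Q_def linear_add[OF HL] linear_cmul[OF HL] linear_add[OF TL] linear_cmul[OF TL]
         linear_add[OF TL'] linear_cmul[OF TL'] inner_add_left inner_add_right algebra_simps\<close>)
  also have "(\<Sum>b\<in>Basis. d2Q x b b) = (p - 1) * ((p / 2 - 1) * w powr (p / 2 - 2) * 2 * (\<Sum>b\<in>Basis. (G x \<bullet> H x b) * (G x \<bullet> H x b))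
      + w powr (p / 2 - 1) * (h2 + t3)) + f' (u x) * (\<Sum>b\<in>Basis. (G x \<bullet> b) * (G x \<bullet> b)) + f (u x) * t"
    unfolding d2Q_def h2_def t3_def t_def w_def
    by (simp only: sum.distrib sum_distrib_left distrib_left) (simp add: algebra_simps)
  also have "(\<Sum>b\<in>Basis. (G x \<bullet> H x b) * (G x \<bullet> H x b)) = k"
    unfolding k_def using euclidean_inner[of "H x (G x)" "H x (G x)"] by (simp add: H_sym[OF x])
  also have "(\<Sum>b\<in>Basis. (G x \<bullet> b) * (G x \<bullet> b)) = w"
    unfolding w_def using euclidean_inner[of "G x" "G x"] by simp
  also have "d2Q x (G x) (G x) = (p - 1) * ((p / 2 - 1) * w powr (p / 2 - 2) * (2 * s) * s + w powr (p / 2 - 1) * (k + tn))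
     + f' (u x) * w * w + f (u x) * s"
    unfolding d2Q_def w_def s_def k_def tn_def by (simp add: inner_commute)
  also have "(p - 1) * ((p / 2 - 1) * w powr (p / 2 - 2) * 2 * k + w powr (p / 2 - 1) * (h2 + t3)) + f' (u x) * w + f (u x) * t
      + (p - 2) * ((p - 1) * ((p / 2 - 1) * w powr (p / 2 - 2) * (2 * s) * s + w powr (p / 2 - 1) * (k + tn))
        + f' (u x) * w * w + f (u x) * s) / w
      = (p - 1) * ((p / 2 - 1) / (r * w\<^sup>2) * 2 * (k + (p - 2) * s\<^sup>2 / w)
        + (h2 + (p - 2) * k / w + t3 + (p - 2) * tn / w) / (r * w)) + f' (u x) * ((p - 1) * w) + f (u x) * (t + (p - 2) * s / w)"
    unfolding rw using w r by (simp add: field_simps power2_eq_square)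
  finally have "LQ x = (p - 1) * ((p / 2 - 1) / (r * w\<^sup>2) * 2 * (k + (p - 2) * s\<^sup>2 / w)
        + (h2 + (p - 2) * k / w + t3 + (p - 2) * tn / w) / (r * w)) + f' (u x) * ((p - 1) * w) + f (u x) * (t + (p - 2) * s / w)" .
  moreover have "dQ x (G x) = (p - 1) * s / (r * w) + f (u x) * w"
    unfolding dQ_def s_def w_def[symmetric] rw by simp
  moreover have "w * t + (p - 2) * s + f (u x) * (w\<^sup>2 * r) = 0"
    using equation[OF x g] unfolding w_def[symmetric] s_def[symmetric] t_def[symmetric] rw .
  moreover have "2 * s * t + w * t3 + (p - 2) * (2 * k + tn) + f' (u x) * (w^3 * r) + f (u x) * ((4 - p) * (w * r) * s) = 0"
    using differentiated_equation[OF x g]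
    unfolding w_def[symmetric] s_def[symmetric] t_def[symmetric] t3_def[symmetric] k_def[symmetric] tn_def[symmetric] rw
    by (simp add: power3_eq_cube power2_eq_square mult.assoc)
  ultimately show ?thesis
    using P_function_identity[OF w r, of t p s "f (u x)" t3 k tn "f' (u x)" h2]
    unfolding w_def[symmetric] h2_def[symmetric] by simp
qed

lemma projected_hessian_gradient_norm:
  assumes "x \<in> \<Omega>" "G x \<noteq> 0"
  shows "(norm (H x (G x) - (G x \<bullet> H x (G x) / W x) *\<^sub>R G x))\<^sup>2
    = H x (G x) \<bullet> H x (G x) - (G x \<bullet> H x (G x))\<^sup>2 / W x"
  using assms unfolding power2_norm_eq_inner
  by (simp add: inner_diff_left inner_diff_right inner_commute power2_eq_square)

text \<open>All squares in \<open>LQ_eq\<close>, including that of \<open>dQ x (G x)\<close>, are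
  discarded. What survives is linear in \<open>dQ\<close> and is the drift term.\<close>

lemma LQ_ge:
  assumes x: "x \<in> \<Omega>" and g: "G x \<noteq> 0"
  shows "LQ x \<ge> - p * f (u x) * W x powr (- p / 2) * dQ x (G x)"
proof -
  have w: "W x > 0" using g by simp
  have 1: "(\<Sum>b\<in>Basis. H x b \<bullet> H x b) - 2 * (H x (G x) \<bullet> H x (G x)) / W x + (G x \<bullet> H x (G x))\<^sup>2 / (W x)\<^sup>2 \<ge> 0"
    unfolding tangential_hessian_norm[OF x g, symmetric] by (intro sum_nonneg) simp
  have 2: "H x (G x) \<bullet> H x (G x) - (G x \<bullet> H x (G x))\<^sup>2 / W x \<ge> 0"
    unfolding projected_hessian_gradient_norm[OF x g, symmetric] by simp
  have 3: "W x powr (- p / 2) * dQ x (G x) * ((p - 1) * dQ x (G x) / W x) \<ge> 0"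
  proof -
    have "W x powr (- p / 2) * (p - 1) * (dQ x (G x))\<^sup>2 / W x \<ge> 0" using p w by auto
    then show ?thesis by (simp add: power2_eq_square mult_ac)
  qed
  have "(p - 1) / (W x powr (- p / 2) * W x) \<ge> 0" "2 * (p - 1) / (W x powr (- p / 2) * (W x)\<^sup>2) \<ge> 0"
    using p w by auto
  from mult_nonneg_nonneg[OF this(1) 1] mult_nonneg_nonneg[OF this(2) 2] 3
  show ?thesis unfolding LQ_eq[OF x g] by (simp add: right_diff_distrib algebra_simps)
qed

text \<open>If \<open>Q\<close> is constant, \<open>dQ\<close> and \<open>d2Q\<close> vanish, so
  both squares in \<open>LQ_eq\<close> are 0: one makes \<open>H x (G x)\<close> parallel to the
  gradient, the other kills the tangential Hessian.\<close>

lemma hessian_rank_one_if_Q_const: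
  assumes S: "open S" "S \<subseteq> \<Omega>" "x \<in> S" and g: "\<And>y. y \<in> S \<Longrightarrow> G y \<noteq> 0" and Q: "\<And>y. y \<in> S \<Longrightarrow> Q y = c"
  obtains l where "\<And>v. H x v = (l * (G x \<bullet> v)) *\<^sub>R G x"
proof -
  have x: "x \<in> \<Omega>" and gx: "G x \<noteq> 0" using S g by auto
  have w: "W x > 0" using gx by simp
  have dQ0: "dQ y v = 0" if "y \<in> S" for y v
  proof -
    have "(Q has_derivative (\<lambda>_. 0)) (at y)"
      by (rule has_derivative_transform_within_open[OF has_derivative_const[of c] S(1) that]) (simp add: Q)
    from has_derivative_unique[OF this Q_deriv] that S g show ?thesis by (metis subsetD)
  qed
  have "d2Q x v z = 0" for v z
  proof -
    have "((\<lambda>x. dQ x v) has_derivative (\<lambda>_. 0)) (at x)"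
      by (rule has_derivative_transform_within_open[OF has_derivative_const[of 0] S(1) S(3)]) (simp add: dQ0)
    from has_derivative_unique[OF this dQ_deriv[OF x gx]] show ?thesis by metis
  qed
  then have "LQ x = 0" by (simp add: LQ_def)
  let ?A = "(\<Sum>b\<in>Basis. H x b \<bullet> H x b) - 2 * (H x (G x) \<bullet> H x (G x)) / W x + (G x \<bullet> H x (G x))\<^sup>2 / (W x)\<^sup>2"
  let ?B = "H x (G x) \<bullet> H x (G x) - (G x \<bullet> H x (G x))\<^sup>2 / W x"
  have A: "?A \<ge> 0"
    unfolding tangential_hessian_norm[OF x gx, symmetric] by (intro sum_nonneg) simp
  have B: "?B \<ge> 0"
    unfolding projected_hessian_gradient_norm[OF x gx, symmetric] by simp
  have c: "(p - 1) / (W x powr (- p / 2) * W x) > 0" "2 * (p - 1) / (W x powr (- p / 2) * (W x)\<^sup>2) > 0"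
    using p w by auto
  have "(p - 1) / (W x powr (- p / 2) * W x) * ?A + 2 * (p - 1) / (W x powr (- p / 2) * (W x)\<^sup>2) * ?B = 0"
    using LQ_eq[OF x gx] \<open>LQ x = 0\<close> dQ0[OF S(3)] by simp
  then have "?A = 0" "?B = 0"
    unfolding add_nonneg_eq_0_iff[OF mult_nonneg_nonneg[OF less_imp_le[OF c(1)] A] mult_nonneg_nonneg[OF less_imp_le[OF c(2)] B]]
    using c by (simp_all only: mult_eq_0_iff) auto
  define s where "s = G x \<bullet> H x (G x)"
  have HG: "H x (G x) = (s / W x) *\<^sub>R G x"
    using projected_hessian_gradient_norm[OF x gx] \<open>?B = 0\<close> by (simp add: s_def)
  have "H x b = (s / (W x)\<^sup>2 * (G x \<bullet> b)) *\<^sub>R G x" if "b \<in> Basis" for b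
  proof -
    have "(norm (H x b - ((G x \<bullet> b) / W x) *\<^sub>R H x (G x) - ((H x (G x) \<bullet> b) / W x) *\<^sub>R G x
           + (s * (G x \<bullet> b) / (W x)\<^sup>2) *\<^sub>R G x))\<^sup>2 = 0"
      using sum_nonneg_eq_0_iff[THEN iffD1, OF finite_Basis _ trans[OF tangential_hessian_norm[OF x gx] \<open>?A = 0\<close>]] that
      unfolding s_def by simp
    then show ?thesis using w by (simp add: HG power2_eq_square field_simps)
  qed
  moreover have "linear (\<lambda>v. (s / (W x)\<^sup>2 * (G x \<bullet> v)) *\<^sub>R G x)"
    by (auto intro!: linearI simp: inner_add_right scaleR_left_distrib distrib_left add_divide_distrib)
  ultimately have "H x v = (s / (W x)\<^sup>2 * (G x \<bullet> v)) *\<^sub>R G x" for v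
    using linear_eq_on_span[OF H_linear[OF x], of "\<lambda>v. (s / (W x)\<^sup>2 * (G x \<bullet> v)) *\<^sub>R G x" Basis v] by auto
  with that show thesis by blast
qed

text \<open>At a maximum of \<open>Q - B\<close> the first derivatives agree, so the drift can be
  computed from \<open>B\<close>. The second derivative test along the lines in the stretched basis
  directions bounds \<open>LQ\<close> by the corresponding sum for \<open>B\<close>.\<close>

lemma touching_above:
  assumes y: "y \<in> \<Omega>" and g: "G y \<noteq> 0"
    and max: "\<forall>\<^sub>F x in nhds y. Q x - B x \<le> Q y - B y"
    and B1: "\<And>v. \<forall>\<^sub>F t in nhds 0. ((\<lambda>t. B (y + t *\<^sub>R v)) has_real_derivative B1 v t) (at t)"
    and B2: "\<And>v. (B1 v has_real_derivative B2 v) (at 0)"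
    and \<beta>: "\<And>v. B1 v 0 = \<beta> \<bullet> v"
  shows "(\<Sum>b\<in>Basis. B2 (stretch p (G y) b)) + p * f (u y) * W y powr (- p / 2) * (\<beta> \<bullet> G y) \<ge> 0"
proof -
  have ev: "\<forall>\<^sub>F x in nhds y. x \<in> \<Omega> \<and> G x \<noteq> 0"
    using eventually_nhds_in_open[OF open_noncritical] y g by auto
  have key: "dQ y v = \<beta> \<bullet> v \<and> d2Q y v v \<le> B2 v" for v
  proof -
    have 1: "\<forall>\<^sub>F t in nhds 0. ((\<lambda>t. Q (y + t *\<^sub>R v) - B (y + t *\<^sub>R v)) has_real_derivative dQ (y + t *\<^sub>R v) v - B1 v t) (at t)"
      using B1[of v] eventually_compose_filterlim[OF ev tendsto_along_line[of y v]]
      by eventually_elim (rule DERIV_diff[OF has_real_derivative_along_line[OF Q_deriv]], auto)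
    have 2: "((\<lambda>t. dQ (y + t *\<^sub>R v) v - B1 v t) has_real_derivative d2Q y v v - B2 v) (at 0)"
      by (intro DERIV_diff B2 has_real_derivative_along_line[of "\<lambda>x. dQ x v"]) (simp add: dQ_deriv y g)
    have 3: "\<forall>\<^sub>F t in nhds 0. Q (y + t *\<^sub>R v) - B (y + t *\<^sub>R v) \<le> Q (y + 0 *\<^sub>R v) - B (y + 0 *\<^sub>R v)"
      using eventually_compose_filterlim[OF max tendsto_along_line[of y v]] by simp
    from second_derivative_nonpos_at_local_max[OF 1 2 3] \<beta> show ?thesis by simp
  qed
  have "LQ y \<le> (\<Sum>b\<in>Basis. B2 (stretch p (G y) b))"
    unfolding LQ_def by (intro sum_mono) (simp add: key)
  with LQ_ge[OF y g] key show ?thesis by (simp add: mult.assoc)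
qed

text \<open>The form used for explicit barriers: with a bilinear second derivative,
  \<open>sum_Basis_stretch\<close> turns the stretched sum into a trace plus a term in the gradient
  direction.\<close>

lemma touching_above_bilinear:
  assumes y: "y \<in> \<Omega>" and g: "G y \<noteq> 0"
    and max: "\<forall>\<^sub>F x in nhds y. Q x - B x \<le> Q y - B y"
    and S: "open S" "y \<in> S"
    and b1: "\<And>x. x \<in> S \<Longrightarrow> (B has_derivative (\<lambda>v. b1 x v)) (at x)"
    and b2: "\<And>v. ((\<lambda>x. b1 x v) has_derivative b2 v) (at y)"
    and lin: "\<And>z. linear (\<lambda>v. b2 v z)"
  shows "(\<Sum>b\<in>Basis. b2 b b) + (p - 2) * (b2 (G y) (G y) / W y) + p * f (u y) * W y powr (- p / 2) * b1 y (G y) \<ge> 0"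
proof -
  obtain \<beta> where \<beta>: "\<And>v. b1 y v = \<beta> \<bullet> v"
  proof -
    have "B differentiable (at y)" using b1[OF S(2)] differentiableI by blast
    from has_derivative_unique[OF b1[OF S(2)] has_derivative_grad[OF this]] show thesis
      by (intro that) (rule fun_cong)
  qed
  have "(\<Sum>b\<in>Basis. b2 (stretch p (G y) b) (stretch p (G y) b)) + p * f (u y) * W y powr (- p / 2) * (\<beta> \<bullet> G y) \<ge> 0"
  proof (rule touching_above[OF y g max, where ?B1.0 = "\<lambda>v t. b1 (y + t *\<^sub>R v) v" and ?B2.0 = "\<lambda>v. b2 v v"])
    show "\<forall>\<^sub>F t in nhds 0. ((\<lambda>t. B (y + t *\<^sub>R v)) has_real_derivative b1 (y + t *\<^sub>R v) v) (at t)" for v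
      using eventually_compose_filterlim[OF eventually_nhds_in_open[OF S] tendsto_along_line[of y v]]
      by eventually_elim (intro has_real_derivative_along_line b1)
    show "((\<lambda>t. b1 (y + t *\<^sub>R v) v) has_real_derivative b2 v v) (at 0)" for v
      by (intro has_real_derivative_along_line[of "\<lambda>x. b1 x v"]) (simp add: b2)
  qed (simp add: \<beta>)
  moreover have "(\<Sum>b\<in>Basis. b2 (stretch p (G y) b) (stretch p (G y) b)) = (\<Sum>b\<in>Basis. b2 b b) + (p - 2) * (b2 (G y) (G y) / W y)"
    using sum_Basis_stretch[of p "G y" b2] p g lin has_derivative_linear[OF b2] by simp
  ultimately show ?thesis by (simp add: \<beta>)
qed

text \<open>The matrix I + (p - 2) g \<otimes> g / |g|^2 has eigenvalues 1 and p - 1, both between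
  \<open>min 1 (p - 1)\<close> and p. The lower bound is the ellipticity constant.\<close>

lemma trace_stretched_inner:
  assumes "G y \<noteq> 0"
  shows "\<bar>(X \<bullet> X) + (p - 2) * (X \<bullet> G y)\<^sup>2 / W y\<bar> \<le> p * (X \<bullet> X)"
    and "(X \<bullet> X) + (p - 2) * (X \<bullet> G y)\<^sup>2 / W y \<ge> min 1 (p - 1) * (X \<bullet> X)"
proof -
  define q where "q = (X \<bullet> G y)\<^sup>2 / W y"
  have w: "W y > 0" using assms by simp
  have q: "0 \<le> q" "q \<le> X \<bullet> X"
    using Cauchy_Schwarz_ineq[of X "G y"] w by (auto simp: q_def divide_simps)
  have lower: "X \<bullet> X + (p - 2) * q \<ge> min 1 (p - 1) * (X \<bullet> X)"
  proof (cases "p \<ge> 2")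
    case True
    then have "(p - 2) * q \<ge> 0" using q by simp
    moreover have "min 1 (p - 1) = 1" using True by simp
    ultimately show ?thesis by (simp only: mult_1)
  next
    case False
    then have "(2 - p) * q \<le> (2 - p) * (X \<bullet> X)" using q by (intro mult_left_mono) auto
    then show ?thesis using False by (simp add: min_def algebra_simps)
  qed
  have upper: "X \<bullet> X + (p - 2) * q \<le> p * (X \<bullet> X)"
  proof (cases "p \<ge> 2")
    case True
    then have "(p - 2) * q \<le> (p - 2) * (X \<bullet> X)" using q by (intro mult_left_mono) auto
    moreover have "X \<bullet> X + (p - 2) * (X \<bullet> X) \<le> p * (X \<bullet> X)" by (simp add: algebra_simps)
    ultimately show ?thesis by linarith
  next
    case False
    then have "(p - 2) * q \<le> 0" using q by (simp add: mult_nonpos_nonneg)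
    moreover have "1 * (X \<bullet> X) \<le> p * (X \<bullet> X)" using p by (intro mult_right_mono) auto
    ultimately show ?thesis by simp
  qed
  have "min 1 (p - 1) * (X \<bullet> X) \<ge> 0" using p by simp
  with lower upper show "\<bar>(X \<bullet> X) + (p - 2) * (X \<bullet> G y)\<^sup>2 / W y\<bar> \<le> p * (X \<bullet> X)"
    "(X \<bullet> X) + (p - 2) * (X \<bullet> G y)\<^sup>2 / W y \<ge> min 1 (p - 1) * (X \<bullet> X)"
    by (auto simp: q_def)
qed

text \<open>The linearised operator applied to u itself is prescribed by the equation. This
  evaluates the second derivatives of any barrier that depends on u.\<close>

lemma trace_hessian_stretched:
  assumes y: "y \<in> \<Omega>" and g: "G y \<noteq> 0"
  shows "(\<Sum>b\<in>Basis. H y b \<bullet> b) + (p - 2) * (H y (G y) \<bullet> G y) / W y = - f (u y) * W y * W y powr (- p / 2)"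
proof -
  have w: "W y > 0" using g by simp
  have "W y powr (2 - p / 2) = (W y)\<^sup>2 * W y powr (- p / 2)"
    using w powr_add[of "W y" 2 "- p / 2"] by simp
  with equation[OF y g] w show ?thesis
    by (simp add: field_simps power2_eq_square inner_commute)
qed

section \<open>The maximum principle for the P-function\<close>

text \<open>The barrier is a negative Gaussian about \<open>z\<close>. Its second derivatives
  contain a term quadratic in \<alpha>, bounded below by ellipticity, and everything else is linear
  in \<alpha>; after division by the common factor, contact limits \<alpha> |y - z|^2. The factor
  \<epsilon> cancels.\<close>

lemma touching_gaussian:
  assumes y: "y \<in> \<Omega>" and g: "G y \<noteq> 0" and \<epsilon>: "\<epsilon> > 0" and \<alpha>: "\<alpha> > 0"
    and max: "\<forall>\<^sub>F x in nhds y. Q x + \<epsilon> * exp (- \<alpha> * ((x - z) \<bullet> (x - z))) \<le> Q y + \<epsilon> * exp (- \<alpha> * ((y - z) \<bullet> (y - z)))"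
  shows "2 * \<alpha> * min 1 (p - 1) * ((y - z) \<bullet> (y - z))
    \<le> real DIM('a) + p - 2 + p * \<bar>f (u y)\<bar> * W y powr (- p / 2) * norm (y - z) * norm (G y)"
proof -
  define B where "B x = - \<epsilon> * exp (- \<alpha> * ((x - z) \<bullet> (x - z)))" for x
  define b1 where "b1 x v = 2 * \<alpha> * \<epsilon> * exp (- \<alpha> * ((x - z) \<bullet> (x - z))) * ((x - z) \<bullet> v)" for x v
  define E where "E = exp (- \<alpha> * ((y - z) \<bullet> (y - z)))"
  define b2 where "b2 v h = 2 * \<alpha> * \<epsilon> * E * (h \<bullet> v) - 4 * \<alpha>\<^sup>2 * \<epsilon> * E * ((y - z) \<bullet> h) * ((y - z) \<bullet> v)" for v h
  let ?X = "y - z"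
  have t1: "(\<Sum>b\<in>Basis. b2 b b) + (p - 2) * (b2 (G y) (G y) / W y) + p * f (u y) * W y powr (- p / 2) * b1 y (G y) \<ge> 0"
  proof (rule touching_above_bilinear[OF y g _ open_UNIV UNIV_I, where B = B and ?b1.0 = b1 and ?b2.0 = b2])
    show "\<forall>\<^sub>F x in nhds y. Q x - B x \<le> Q y - B y" using max by (simp add: B_def)
    show "(B has_derivative (\<lambda>v. b1 x v)) (at x)" for x
      unfolding B_def b1_def by (auto intro!: derivative_eq_intros simp: inner_commute algebra_simps fun_eq_iff)
    show "((\<lambda>x. b1 x v) has_derivative b2 v) (at y)" for v
      unfolding b1_def b2_def E_def
      by (auto intro!: derivative_eq_intros simp: inner_commute algebra_simps fun_eq_iff power2_eq_square)
    show "linear (\<lambda>v. b2 v h)" for h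
      by (auto intro!: linearI simp: b2_def inner_add_right algebra_simps)
  qed
  have t2: "(\<Sum>b\<in>Basis. b2 b b) = 2 * \<alpha> * \<epsilon> * E * real DIM('a) - 4 * \<alpha>\<^sup>2 * \<epsilon> * E * (?X \<bullet> ?X)"
  proof -
    have "(\<Sum>b\<in>Basis. b2 b b) = (\<Sum>b\<in>Basis. 2 * \<alpha> * \<epsilon> * E - 4 * \<alpha>\<^sup>2 * \<epsilon> * E * ((?X \<bullet> b) * (?X \<bullet> b)))"
      by (intro sum.cong) (auto simp: b2_def)
    then show ?thesis by (simp add: sum_subtractf sum_distrib_left[symmetric] euclidean_inner[of ?X ?X])
  qed
  have t3: "b2 (G y) (G y) / W y = 2 * \<alpha> * \<epsilon> * E - 4 * \<alpha>\<^sup>2 * \<epsilon> * E * ((?X \<bullet> G y)\<^sup>2 / W y)"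
    using g by (simp add: b2_def field_simps power2_eq_square)
  have t4: "b1 y (G y) = 2 * \<alpha> * \<epsilon> * E * (?X \<bullet> G y)" by (simp add: b1_def E_def)
  have "2 * \<alpha> * \<epsilon> * E * real DIM('a) - 4 * \<alpha>\<^sup>2 * \<epsilon> * E * (?X \<bullet> ?X)
      + (p - 2) * (2 * \<alpha> * \<epsilon> * E - 4 * \<alpha>\<^sup>2 * \<epsilon> * E * ((?X \<bullet> G y)\<^sup>2 / W y))
      + p * f (u y) * W y powr (- p / 2) * (2 * \<alpha> * \<epsilon> * E * (?X \<bullet> G y)) \<ge> 0"
    using t1 unfolding t2 t3 t4 .
  then have "(2 * \<alpha> * \<epsilon> * E) * (real DIM('a) + p - 2 - 2 * \<alpha> * ((?X \<bullet> ?X) + (p - 2) * (?X \<bullet> G y)\<^sup>2 / W y)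
      + p * f (u y) * W y powr (- p / 2) * (?X \<bullet> G y)) \<ge> 0"
    by (simp add: algebra_simps power2_eq_square)
  moreover have "2 * \<alpha> * \<epsilon> * E > 0" using \<alpha> \<epsilon> by (simp add: E_def)
  ultimately have "real DIM('a) + p - 2 - 2 * \<alpha> * ((?X \<bullet> ?X) + (p - 2) * (?X \<bullet> G y)\<^sup>2 / W y)
      + p * f (u y) * W y powr (- p / 2) * (?X \<bullet> G y) \<ge> 0"
    by (simp add: zero_le_mult_iff)
  moreover have "2 * \<alpha> * (min 1 (p - 1) * (?X \<bullet> ?X)) \<le> 2 * \<alpha> * ((?X \<bullet> ?X) + (p - 2) * (?X \<bullet> G y)\<^sup>2 / W y)"
    using trace_stretched_inner(2)[OF g] \<alpha> by (intro mult_left_mono) auto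
  moreover have "p * f (u y) * W y powr (- p / 2) * (?X \<bullet> G y) \<le> p * \<bar>f (u y)\<bar> * W y powr (- p / 2) * (norm ?X * norm (G y))"
  proof -
    have "f (u y) * (?X \<bullet> G y) \<le> \<bar>f (u y)\<bar> * (norm ?X * norm (G y))"
      using abs_ge_self[of "f (u y) * (?X \<bullet> G y)"] mult_left_mono[OF Cauchy_Schwarz_ineq2[of ?X "G y"] abs_ge_zero[of "f (u y)"]]
      by (simp add: abs_mult)
    then have "(p * W y powr (- p / 2)) * (f (u y) * (?X \<bullet> G y)) \<le> (p * W y powr (- p / 2)) * (\<bar>f (u y)\<bar> * (norm ?X * norm (G y)))"
      using p by (intro mult_left_mono) auto
    then show ?thesis by (simp add: mult_ac)
  qed
  ultimately show ?thesis by (simp add: mult.assoc)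
qed

text \<open>Concavity of \<open>A - exp (l * u)\<close> in u produces the term with
  \<open>l\<^sup>2\<close> on the left, while the cutoff contributes only terms with a factor
  \<open>a\<close>. The common factor \<open>\<mu> * \<xi> ^ k\<close> is divided out, so the
  inequality is independent of the multiple \<mu>.\<close>

lemma touching_exponential_barrier:
  fixes k :: nat and l A R \<mu> a e r \<xi> :: real
  assumes y: "y \<in> \<Omega>" and g: "G y \<noteq> 0" and \<mu>: "\<mu> > 0" and R: "R > 0"
    and yR: "(y - x0) \<bullet> (y - x0) < R\<^sup>2"
    and max: "\<forall>\<^sub>F x in nhds y. Q x - \<mu> * (A - exp (l * u x)) * inverse (1 - (x - x0) \<bullet> (x - x0) / R\<^sup>2) ^ k
      \<le> Q y - \<mu> * (A - exp (l * u y)) * inverse (1 - (y - x0) \<bullet> (y - x0) / R\<^sup>2) ^ k"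
  defines "d \<equiv> y - x0" and "e \<equiv> exp (l * u y)" and "a \<equiv> 2 / R\<^sup>2" and "r \<equiv> W y powr (- p / 2)"
  defines "\<xi> \<equiv> inverse (1 - (y - x0) \<bullet> (y - x0) / R\<^sup>2)"
  shows "l\<^sup>2 * e * (p - 1) * W y \<le> l * e * f (u y) * W y * r - 2 * l * e * k * a * \<xi> * (p - 1) * (d \<bullet> G y)
    + (A - e) * (k * (k + 1) * a\<^sup>2 * \<xi>\<^sup>2 * ((d \<bullet> d) + (p - 2) * (d \<bullet> G y)\<^sup>2 / W y) + k * a * \<xi> * (DIM('a) + p - 2))
    + p * f (u y) * r * ((A - e) * k * a * \<xi> * (d \<bullet> G y) - l * e * W y)"
proof -
  define Z where "Z x = inverse (1 - (x - x0) \<bullet> (x - x0) / R\<^sup>2)" for x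
  define S where "S = \<Omega> \<inter> {x. (x - x0) \<bullet> (x - x0) < R\<^sup>2}"
  have S: "open S" unfolding S_def
    by (intro open_Int open_dom open_Collect_less continuous_intros)
  have yS: "y \<in> S" using y yR by (simp add: S_def)
  have Zd: "(Z has_derivative (\<lambda>v. a * (Z x)\<^sup>2 * ((x - x0) \<bullet> v))) (at x)" if "x \<in> S" for x
  proof -
    have nz: "1 - (x - x0) \<bullet> (x - x0) / R\<^sup>2 \<noteq> 0" using that R by (simp add: S_def field_simps)
    have "((\<lambda>x. (x - x0) \<bullet> (x - x0)) has_derivative (\<lambda>v. 2 * ((x - x0) \<bullet> v))) (at x)"
      by (auto intro!: derivative_eq_intros simp: inner_commute)
    then have "((\<lambda>x. 1 - (x - x0) \<bullet> (x - x0) / R\<^sup>2) has_derivative (\<lambda>v. 0 - 2 * ((x - x0) \<bullet> v) / R\<^sup>2)) (at x)"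
      by (intro has_derivative_diff has_derivative_const bounded_linear.has_derivative[OF bounded_linear_divide])
    from Deriv.has_derivative_inverse[OF nz this] show ?thesis
      unfolding Z_def a_def by (simp add: power2_eq_square mult_ac)
  qed
  \<comment> \<open>Since the derivative of \<open>Z\<close> carries \<open>Z\<^sup>2\<close>, the
    exponent rises instead of falling, and the formula also holds for \<open>n = 0\<close>.\<close>
  have Zk: "((\<lambda>x. Z x ^ n) has_derivative (\<lambda>v. n * a * Z x ^ (n + 1) * ((x - x0) \<bullet> v))) (at x)" if "x \<in> S" for x and n :: nat
  proof -
    have "((\<lambda>x. Z x ^ n) has_derivative (\<lambda>v. of_nat n * (a * (Z x)\<^sup>2 * ((x - x0) \<bullet> v)) * Z x ^ (n - 1))) (at x)"
      by (rule has_derivative_power[OF Zd[OF that]])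
    moreover have "of_nat n * (a * (Z x)\<^sup>2 * ((x - x0) \<bullet> v)) * Z x ^ (n - 1) = n * a * Z x ^ (n + 1) * ((x - x0) \<bullet> v)" for v
      by (cases n) (simp_all add: power2_eq_square mult_ac)
    ultimately show ?thesis by (simp only:)
  qed
  have Ed: "((\<lambda>x. exp (l * u x)) has_derivative (\<lambda>v. l * exp (l * u x) * (G x \<bullet> v))) (at x)" if "x \<in> S" for x
    using that by (intro compose_u_deriv[of x "\<lambda>s. exp (l * s)"]) (auto intro!: derivative_eq_intros simp: S_def)
  define B where "B x = \<mu> * ((A - exp (l * u x)) * Z x ^ k)" for x
  define b1 where "b1 x v = \<mu> * ((A - exp (l * u x)) * (k * a * Z x ^ (k + 1) * ((x - x0) \<bullet> v))
      - l * exp (l * u x) * (G x \<bullet> v) * Z x ^ k)" for x v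
  define b2 where "b2 v h = \<mu> * ((A - e) * (k * a * ((k + 1) * a * \<xi> ^ (k + 2) * (d \<bullet> h)) * (d \<bullet> v) + k * a * \<xi> ^ (k + 1) * (h \<bullet> v))
      - l * e * (G y \<bullet> h) * (k * a * \<xi> ^ (k + 1) * (d \<bullet> v))
      - (l * (l * e * (G y \<bullet> h)) * (G y \<bullet> v) + l * e * (H y h \<bullet> v)) * \<xi> ^ k
      - l * e * (G y \<bullet> v) * (k * a * \<xi> ^ (k + 1) * (d \<bullet> h)))" for v h
  have Zy: "Z y = \<xi>" by (simp add: Z_def \<xi>_def)
  have "1 - d \<bullet> d / R\<^sup>2 > 0" using yR R by (simp add: d_def field_simps)
  then have \<xi>: "\<xi> > 0" by (simp add: \<xi>_def d_def)
  have w: "W y > 0" using g by simp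
  have t1: "(\<Sum>b\<in>Basis. b2 b b) + (p - 2) * (b2 (G y) (G y) / W y) + p * f (u y) * W y powr (- p / 2) * b1 y (G y) \<ge> 0"
  proof (rule touching_above_bilinear[OF y g _ S yS, where B = B and ?b1.0 = b1 and ?b2.0 = b2])
    show "\<forall>\<^sub>F x in nhds y. Q x - B x \<le> Q y - B y"
      using max by (simp add: B_def Z_def mult.assoc)
    show "(B has_derivative (\<lambda>v. b1 x v)) (at x)" if "x \<in> S" for x
      unfolding B_def b1_def
      by (rule derivative_eq_intros Zk Ed that refl)+ (simp add: fun_eq_iff algebra_simps)
    show "((\<lambda>x. b1 x v) has_derivative b2 v) (at y)" for v
      unfolding b1_def
      by (rule derivative_eq_intros Zk Ed G_deriv y yS refl)+
        (simp add: fun_eq_iff b2_def Zy d_def[symmetric] e_def[symmetric] algebra_simps)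
    show "linear (\<lambda>v. b2 v h)" for h
      by (auto intro!: linearI simp: b2_def inner_add_right algebra_simps)
  qed
  have t2: "(\<Sum>b\<in>Basis. b2 b b) = \<mu> * \<xi> ^ k * ((A - e) * (k * (k + 1) * a\<^sup>2 * \<xi>\<^sup>2 * (d \<bullet> d) + k * a * \<xi> * DIM('a))
      - 2 * l * e * k * a * \<xi> * (d \<bullet> G y) - l\<^sup>2 * e * W y - l * e * (\<Sum>b\<in>Basis. H y b \<bullet> b))"
  proof -
    have "(\<Sum>b\<in>Basis. b2 b b) = (\<Sum>b\<in>Basis. \<mu> * \<xi> ^ k * ((A - e) * (k * (k + 1) * a\<^sup>2 * \<xi>\<^sup>2)) * ((d \<bullet> b) * (d \<bullet> b))
       + \<mu> * \<xi> ^ k * ((A - e) * (k * a * \<xi>)) - \<mu> * \<xi> ^ k * (2 * l * e * k * a * \<xi>) * ((d \<bullet> b) * (G y \<bullet> b))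
       - \<mu> * \<xi> ^ k * (l\<^sup>2 * e) * ((G y \<bullet> b) * (G y \<bullet> b)) - \<mu> * \<xi> ^ k * (l * e) * (H y b \<bullet> b))"
      by (intro sum.cong) (auto simp: b2_def algebra_simps power2_eq_square)
    also have "\<dots> = \<mu> * \<xi> ^ k * ((A - e) * (k * (k + 1) * a\<^sup>2 * \<xi>\<^sup>2)) * (d \<bullet> d)
       + DIM('a) * (\<mu> * \<xi> ^ k * ((A - e) * (k * a * \<xi>))) - \<mu> * \<xi> ^ k * (2 * l * e * k * a * \<xi>) * (d \<bullet> G y)
       - \<mu> * \<xi> ^ k * (l\<^sup>2 * e) * (G y \<bullet> G y) - \<mu> * \<xi> ^ k * (l * e) * (\<Sum>b\<in>Basis. H y b \<bullet> b)"
      by (simp only: sum_subtractf sum.distrib sum_distrib_left[symmetric] euclidean_inner[of d d] euclidean_inner[of d "G y"]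
          euclidean_inner[of "G y" "G y"] sum_constant) (simp add: mult_ac)
    finally show ?thesis by (simp add: algebra_simps)
  qed
  have t3: "b2 (G y) (G y) / W y = \<mu> * \<xi> ^ k * ((A - e) * (k * (k + 1) * a\<^sup>2 * \<xi>\<^sup>2 * ((d \<bullet> G y)\<^sup>2 / W y) + k * a * \<xi>)
      - 2 * l * e * k * a * \<xi> * (d \<bullet> G y) - l\<^sup>2 * e * W y - l * e * (H y (G y) \<bullet> G y / W y))"
    using w by (simp add: b2_def field_simps power2_eq_square)
  have t4: "b1 y (G y) = \<mu> * \<xi> ^ k * ((A - e) * k * a * \<xi> * (d \<bullet> G y) - l * e * W y)"
    by (simp add: b1_def Zy d_def e_def algebra_simps)
  have "0 \<le> \<mu> * \<xi> ^ k * (((A - e) * (k * (k + 1) * a\<^sup>2 * \<xi>\<^sup>2 * (d \<bullet> d) + k * a * \<xi> * DIM('a))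
      - 2 * l * e * k * a * \<xi> * (d \<bullet> G y) - l\<^sup>2 * e * W y - l * e * (\<Sum>b\<in>Basis. H y b \<bullet> b))
    + (p - 2) * ((A - e) * (k * (k + 1) * a\<^sup>2 * \<xi>\<^sup>2 * ((d \<bullet> G y)\<^sup>2 / W y) + k * a * \<xi>)
      - 2 * l * e * k * a * \<xi> * (d \<bullet> G y) - l\<^sup>2 * e * W y - l * e * (H y (G y) \<bullet> G y / W y))
    + p * f (u y) * r * ((A - e) * k * a * \<xi> * (d \<bullet> G y) - l * e * W y))" (is "_ \<le> _ * ?K")
    using t1 unfolding t2 t3 t4 r_def[symmetric] by (simp only: distrib_left mult.assoc mult.left_commute)
  moreover have "\<mu> * \<xi> ^ k > 0" using \<mu> \<xi> by simp
  ultimately have "?K \<ge> 0" by (simp only: zero_le_mult_iff) auto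
  \<comment> \<open>Grouping the Hessian terms into the trace that the equation evaluates removes
    every second derivative of u.\<close>
  also have "?K = (A - e) * (k * (k + 1) * a\<^sup>2 * \<xi>\<^sup>2 * ((d \<bullet> d) + (p - 2) * (d \<bullet> G y)\<^sup>2 / W y) + k * a * \<xi> * (DIM('a) + p - 2))
     - 2 * l * e * k * a * \<xi> * (p - 1) * (d \<bullet> G y) - l\<^sup>2 * e * (p - 1) * W y
     - l * e * ((\<Sum>b\<in>Basis. H y b \<bullet> b) + (p - 2) * (H y (G y) \<bullet> G y) / W y)
     + p * f (u y) * r * ((A - e) * k * a * \<xi> * (d \<bullet> G y) - l * e * W y)"
    by (simp add: algebra_simps)
  finally show ?thesis
    unfolding trace_hessian_stretched[OF y g] r_def[symmetric] by (simp add: algebra_simps)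
qed

text \<open>The barrier inequality becomes quadratic in |\<nabla>u| and 1 / (R \<zeta>). Zeroth
  order terms are of size C / \<sigma> times |\<nabla>u|^2, because \<open>r\<sigma>\<close> keeps
  the gradient away from 0, and the choice of \<open>l\<close> absorbs them. The resulting constant
  involves neither \<open>R\<close> nor \<mu>.\<close>

lemma contact_gradient_bound:
  fixes k :: nat and l A R \<mu> C \<sigma> :: real
  assumes y: "y \<in> \<Omega>" and g: "G y \<noteq> 0" and \<mu>: "\<mu> > 0" and R: "R > 0"
    and yR: "(y - x0) \<bullet> (y - x0) < R\<^sup>2"
    and max: "\<forall>\<^sub>F x in nhds y. Q x - \<mu> * (A - exp (l * u x)) * inverse (1 - (x - x0) \<bullet> (x - x0) / R\<^sup>2) ^ k
      \<le> Q y - \<mu> * (A - exp (l * u y)) * inverse (1 - (y - x0) \<bullet> (y - x0) / R\<^sup>2) ^ k"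
    and C: "\<bar>f (u y)\<bar> \<le> C" and \<sigma>: "\<sigma> > 0" and l: "l = 2 * C / \<sigma> + 1"
    and uy: "u y \<ge> 0" and A: "exp (l * u y) \<le> A" and r\<sigma>: "W y powr (- p / 2) \<le> 1 / \<sigma>"
  defines "a1 \<equiv> 4 * l * k * (p - 1) + 2 * p * C * A * k / \<sigma>"
    and "b1 \<equiv> A * (4 * (k * (k + 1)) * p + 2 * k * (DIM('a) + p))"
  shows "norm (G y) * (1 - (y - x0) \<bullet> (y - x0) / R\<^sup>2) \<le> (1 + 2 * (a1 + b1) / ((p - 1) * l\<^sup>2)) / R"
proof -
  define \<zeta> where "\<zeta> = 1 - (y - x0) \<bullet> (y - x0) / R\<^sup>2"
  define \<xi> where "\<xi> = inverse \<zeta>"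
  define d where "d = y - x0"
  define e where "e = exp (l * u y)"
  define a where "a = 2 / R\<^sup>2"
  define r where "r = W y powr (- p / 2)"
  define q where "q = norm (G y)"
  \<comment> \<open>\<open>Y\<close> is the natural scale of the cutoff: its first derivatives are
    bounded by multiples of \<open>Y\<close> and its second ones by multiples of
    \<open>Y\<^sup>2\<close>, where \<open>\<xi> \<ge> 1\<close> is used.\<close>
  define Y where "Y = \<xi> / R"
  have \<zeta>: "0 < \<zeta>" "\<zeta> \<le> 1" using yR R by (simp_all add: \<zeta>_def field_simps)
  have \<xi>: "\<xi> \<ge> 1" using \<zeta> by (simp add: \<xi>_def one_le_inverse)
  have Y: "Y > 0" using \<xi> R by (simp add: Y_def)
  have C0: "C \<ge> 0" using C by simp
  have l1: "l \<ge> 1" using C0 \<sigma> by (simp add: l)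
  have e1: "e \<ge> 1" using l1 uy by (simp add: e_def)
  have Ae: "0 \<le> A - e" "A - e \<le> A" "A \<ge> 1" using A[folded e_def] e1 by linarith+
  have q: "q > 0" "W y = q\<^sup>2" using g by (simp_all add: q_def power2_norm_eq_inner)
  have r0: "r \<ge> 0" by (simp add: r_def)
  have dR: "norm d \<le> R" using yR R
    using power2_le_imp_le[of "norm d" R] by (simp add: d_def power2_norm_eq_inner)
  have adG: "a * \<xi> * \<bar>d \<bullet> G y\<bar> \<le> 2 * q * Y"
  proof -
    have "\<bar>d \<bullet> G y\<bar> \<le> R * q"
      using Cauchy_Schwarz_ineq2[of d "G y"] mult_right_mono[OF dR norm_ge_zero[of "G y"]] by (simp add: q_def)
    then have "a * \<xi> * \<bar>d \<bullet> G y\<bar> \<le> a * \<xi> * (R * q)" using \<xi> by (intro mult_left_mono) (auto simp: a_def)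
    also have "\<dots> = 2 * q * Y" using R by (simp add: a_def Y_def field_simps power2_eq_square)
    finally show ?thesis .
  qed
  have a\<xi>: "0 \<le> a * \<xi>" "a * \<xi> \<le> 2 * Y\<^sup>2"
  proof -
    show "0 \<le> a * \<xi>" using \<xi> by (simp add: a_def)
    have "a * \<xi> * 1 \<le> a * \<xi> * \<xi>" using \<xi> by (intro mult_left_mono) (auto simp: a_def)
    then show "a * \<xi> \<le> 2 * Y\<^sup>2" by (simp add: a_def Y_def power2_eq_square)
  qed
  have t0: "l\<^sup>2 * e * (p - 1) * W y \<le> l * e * f (u y) * W y * r - 2 * l * e * k * a * \<xi> * (p - 1) * (d \<bullet> G y)
    + (A - e) * (k * (k + 1) * a\<^sup>2 * \<xi>\<^sup>2 * ((d \<bullet> d) + (p - 2) * (d \<bullet> G y)\<^sup>2 / W y) + k * a * \<xi> * (DIM('a) + p - 2))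
    + p * f (u y) * r * ((A - e) * k * a * \<xi> * (d \<bullet> G y) - l * e * W y)"
    using touching_exponential_barrier[OF y g \<mu> R yR max]
    unfolding d_def e_def a_def r_def \<xi>_def \<zeta>_def .
  \<comment> \<open>The equation enters with coefficient 1 and the drift with -p, together -(p -
    1).\<close>
  have t1: "l * e * f (u y) * W y * r - p * f (u y) * r * (l * e * W y) \<le> (p - 1) * l * e * (C / \<sigma>) * q\<^sup>2"
  proof -
    have "- f (u y) * r \<le> C * (1 / \<sigma>)"
    proof -
      have "- f (u y) * r \<le> C * r" using C r0 by (intro mult_right_mono) auto
      also have "\<dots> \<le> C * (1 / \<sigma>)" using C0 r\<sigma> by (intro mult_left_mono) (auto simp: r_def)
      finally show ?thesis .
    qed
    then have "((p - 1) * l * e * q\<^sup>2) * (- f (u y) * r) \<le> ((p - 1) * l * e * q\<^sup>2) * (C * (1 / \<sigma>))"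
      using p l1 e1 by (intro mult_left_mono) auto
    then show ?thesis using q(2) by (simp add: algebra_simps)
  qed
  have t2: "- 2 * l * e * k * a * \<xi> * (p - 1) * (d \<bullet> G y) \<le> e * (4 * l * k * (p - 1)) * (q * Y)"
  proof -
    have "- (a * \<xi> * (d \<bullet> G y)) \<le> 2 * q * Y"
      using adG abs_ge_minus_self[of "a * \<xi> * (d \<bullet> G y)"] abs_mult[of "a * \<xi>" "d \<bullet> G y"] abs_of_nonneg[OF a\<xi>(1)] by linarith
    then have "(2 * l * e * k * (p - 1)) * (- (a * \<xi> * (d \<bullet> G y))) \<le> (2 * l * e * k * (p - 1)) * (2 * q * Y)"
      using l1 e1 p by (intro mult_left_mono) auto
    then show ?thesis by (simp add: mult_ac)
  qed
  have t3: "(A - e) * (k * (k + 1) * a\<^sup>2 * \<xi>\<^sup>2 * ((d \<bullet> d) + (p - 2) * (d \<bullet> G y)\<^sup>2 / W y) + k * a * \<xi> * (DIM('a) + p - 2))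
     \<le> b1 * Y\<^sup>2"
  proof -
    have "(d \<bullet> d) + (p - 2) * (d \<bullet> G y)\<^sup>2 / W y \<le> p * (d \<bullet> d)"
      using trace_stretched_inner(1)[OF g, of d] by linarith
    also have "\<dots> \<le> p * R\<^sup>2" using yR p by (simp add: d_def)
    finally have "a\<^sup>2 * \<xi>\<^sup>2 * ((d \<bullet> d) + (p - 2) * (d \<bullet> G y)\<^sup>2 / W y) \<le> a\<^sup>2 * \<xi>\<^sup>2 * (p * R\<^sup>2)"
      by (intro mult_left_mono) auto
    also have "\<dots> = 4 * p * Y\<^sup>2" using R by (simp add: a_def Y_def field_simps power2_eq_square)
    finally have 1: "k * (k + 1) * (a\<^sup>2 * \<xi>\<^sup>2 * ((d \<bullet> d) + (p - 2) * (d \<bullet> G y)\<^sup>2 / W y)) \<le> k * (k + 1) * (4 * p * Y\<^sup>2)"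
      by (intro mult_left_mono) auto
    have "a * \<xi> * (DIM('a) + p - 2) \<le> 2 * Y\<^sup>2 * (DIM('a) + p)"
    proof (rule mult_mono[OF a\<xi>(2)])
      have "real DIM('a) \<ge> 1" by (simp add: Suc_leI)
      then show "0 \<le> real DIM('a) + p - 2" using p by linarith
    qed auto
    then have 2: "k * (a * \<xi> * (DIM('a) + p - 2)) \<le> k * (2 * Y\<^sup>2 * (DIM('a) + p))"
      by (intro mult_left_mono) auto
    have 3: "0 \<le> k * (k + 1) * (4 * p * Y\<^sup>2) + k * (2 * Y\<^sup>2 * (DIM('a) + p))" using p by simp
    have "(A - e) * (k * (k + 1) * a\<^sup>2 * \<xi>\<^sup>2 * ((d \<bullet> d) + (p - 2) * (d \<bullet> G y)\<^sup>2 / W y) + k * a * \<xi> * (DIM('a) + p - 2))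
       \<le> (A - e) * (k * (k + 1) * (4 * p * Y\<^sup>2) + k * (2 * Y\<^sup>2 * (DIM('a) + p)))"
      using 1 2 Ae by (intro mult_left_mono) (simp_all add: mult.assoc)
    also have "\<dots> \<le> A * (k * (k + 1) * (4 * p * Y\<^sup>2) + k * (2 * Y\<^sup>2 * (DIM('a) + p)))"
      using Ae 3 by (intro mult_right_mono) auto
    also have "\<dots> = b1 * Y\<^sup>2" by (simp add: b1_def algebra_simps)
    finally show ?thesis .
  qed
  have t4: "p * f (u y) * r * ((A - e) * k * a * \<xi> * (d \<bullet> G y)) \<le> (2 * p * C * A * k / \<sigma>) * (q * Y)"
  proof -
    have "f (u y) * r * (a * \<xi> * (d \<bullet> G y)) \<le> \<bar>f (u y)\<bar> * r * (a * \<xi> * \<bar>d \<bullet> G y\<bar>)"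
      using abs_ge_self[of "f (u y) * r * (a * \<xi> * (d \<bullet> G y))"]
      by (simp only: abs_mult[of "f (u y) * r"] abs_mult[of "a * \<xi>"] abs_mult[of "f (u y)"] abs_of_nonneg[OF a\<xi>(1)] abs_of_nonneg[OF r0])
    also have "\<dots> \<le> (C * (1 / \<sigma>)) * (2 * q * Y)"
      by (rule mult_mono[OF mult_mono[OF C r\<sigma>[folded r_def]] adG]) (use r0 C0 \<sigma> a\<xi>(1) in auto)
    finally have "(p * k * (A - e)) * (f (u y) * r * (a * \<xi> * (d \<bullet> G y))) \<le> (p * k * (A - e)) * ((C * (1 / \<sigma>)) * (2 * q * Y))"
      using p Ae by (intro mult_left_mono) auto
    also have "\<dots> \<le> (p * k * A) * ((C * (1 / \<sigma>)) * (2 * q * Y))"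
      using p Ae C0 \<sigma> q Y by (intro mult_right_mono mult_left_mono) auto
    finally show ?thesis by (simp add: mult_ac)
  qed
  have a1: "a1 \<ge> 0" using l1 p C0 Ae \<sigma> by (simp add: a1_def)
  have b1: "b1 \<ge> 0" using p Ae by (simp add: b1_def)
  define X where "X = (2 * p * C * A * k / \<sigma>) * (q * Y) + b1 * Y\<^sup>2"
  have X: "X \<ge> 0" unfolding X_def using p C0 Ae \<sigma> q Y b1 by simp
  have split: "p * f (u y) * r * ((A - e) * k * a * \<xi> * (d \<bullet> G y) - l * e * W y)
      = p * f (u y) * r * ((A - e) * k * a * \<xi> * (d \<bullet> G y)) - p * f (u y) * r * (l * e * W y)"
    by (simp only: right_diff_distrib)
  have "l\<^sup>2 * e * (p - 1) * W y \<le> (p - 1) * l * e * (C / \<sigma>) * q\<^sup>2 + e * (4 * l * k * (p - 1)) * (q * Y) + X"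
    using t0 t1 t2 t3 t4 unfolding X_def split by linarith
  \<comment> \<open>Terms lacking the factor \<open>e\<close> are given one, so that
    \<open>e\<close> cancels and no exponential remains except in \<open>A\<close>.\<close>
  also have "X \<le> e * X" using mult_right_mono[OF e1 X] by simp
  finally have "e * (l\<^sup>2 * (p - 1) * q\<^sup>2) \<le> e * ((p - 1) * l * (C / \<sigma>) * q\<^sup>2 + (4 * l * k * (p - 1)) * (q * Y) + X)"
    using q(2) by (simp add: distrib_left mult_ac)
  then have "l\<^sup>2 * (p - 1) * q\<^sup>2 \<le> (p - 1) * l * (C / \<sigma>) * q\<^sup>2 + (4 * l * k * (p - 1)) * (q * Y) + X"
    using e1 by simp
  also have "\<dots> = (p - 1) * l * (C / \<sigma>) * q\<^sup>2 + (a1 * (q * Y) + b1 * Y\<^sup>2)"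
    by (simp add: X_def a1_def algebra_simps)
  finally have h1: "l\<^sup>2 * (p - 1) * q\<^sup>2 \<le> (p - 1) * l * (C / \<sigma>) * q\<^sup>2 + (a1 * (q * Y) + b1 * Y\<^sup>2)" .
  \<comment> \<open>The value of \<open>l\<close> makes \<open>C / \<sigma>\<close> at most
    \<open>l / 2\<close>, so this term costs half of the left-hand side.\<close>
  have "(p - 1) * l * (C / \<sigma>) * q\<^sup>2 \<le> (p - 1) * l * (l / 2) * q\<^sup>2"
  proof -
    have "C / \<sigma> \<le> l / 2" using C0 \<sigma> by (simp add: l field_simps)
    then show ?thesis using p l1 by (intro mult_right_mono mult_left_mono) auto
  qed
  also have "(p - 1) * l * (l / 2) * q\<^sup>2 = l\<^sup>2 * (p - 1) * q\<^sup>2 / 2" by (simp add: power2_eq_square)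
  finally have h2: "(p - 1) * l * (C / \<sigma>) * q\<^sup>2 \<le> l\<^sup>2 * (p - 1) * q\<^sup>2 / 2" .
  have absorb: "X \<le> 2 * B" if "D \<le> X / 2" "X \<le> D + B" for X D B :: real using that by linarith
  have "l\<^sup>2 * (p - 1) * q\<^sup>2 \<le> 2 * (a1 * (q * Y) + b1 * Y\<^sup>2)" by (rule absorb[OF h2 h1])
  then have main: "(p - 1) * l\<^sup>2 * q\<^sup>2 \<le> 2 * (a1 * (q * Y) + b1 * Y\<^sup>2)" by (simp only: mult.commute[of "p - 1"])
  \<comment> \<open>Either \<open>q \<le> Y\<close>, which the summand 1 covers, or
    \<open>Y\<^sup>2\<close> is at most \<open>q * Y\<close> and one factor \<open>q\<close>
    cancels.\<close>
  have "q \<le> (1 + 2 * (a1 + b1) / ((p - 1) * l\<^sup>2)) * Y"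
  proof (cases "q \<le> Y")
    case True
    also have "1 * Y \<le> (1 + 2 * (a1 + b1) / ((p - 1) * l\<^sup>2)) * Y"
      using Y a1 b1 p l1 by (intro mult_right_mono) auto
    finally show ?thesis by simp
  next
    case False
    then have "b1 * Y\<^sup>2 \<le> b1 * (q * Y)" using Y b1 by (intro mult_left_mono) (auto simp: power2_eq_square)
    with main have "((p - 1) * l\<^sup>2 * q) * q \<le> (2 * (a1 + b1) * Y) * q"
      by (simp add: power2_eq_square algebra_simps)
    then have "(p - 1) * l\<^sup>2 * q \<le> 2 * (a1 + b1) * Y" using q by simp
    then have "q \<le> 2 * (a1 + b1) / ((p - 1) * l\<^sup>2) * Y" using p l1 by (simp add: field_simps)
    with Y show ?thesis by (simp add: distrib_right)
  qed
  then have "q * \<zeta> \<le> (1 + 2 * (a1 + b1) / ((p - 1) * l\<^sup>2)) * Y * \<zeta>"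
    using \<zeta> by (intro mult_right_mono) auto
  also have "\<dots> = (1 + 2 * (a1 + b1) / ((p - 1) * l\<^sup>2)) / R" using \<zeta> by (simp add: Y_def \<xi>_def)
  finally show ?thesis by (simp only: q_def \<zeta>_def)
qed

section \<open>The global bound for \<open>Q\<close> and the strong maximum principle\<close>

lemma continuous_on_Q: "continuous_on \<Omega> Q"
proof -
  have "continuous_on UNIV F" using F_deriv by (meson DERIV_isCont continuous_at_imp_continuous_on)
  then have "continuous_on \<Omega> (\<lambda>x. F (u x))"
    by (rule continuous_on_compose2[OF _ continuous_on_u]) auto
  then show ?thesis unfolding Q_def[abs_def] using p
    by (intro continuous_intros continuous_on_powr' continuous_on_G) auto
qed

text \<open>As \<open>F\<close> is nonpositive at \<open>u y\<close> and (p - 1) / p is below 1,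
  \<open>Q y\<close> is at most |\<nabla>u|^p. Contact points above the level
  \<open>M + \<sigma>\<close> are thus quantitatively noncritical.\<close>

lemma powr_ge_if_Q_gt:
  assumes F: "F (u y) \<le> 0" and M: "M \<ge> 0" and \<sigma>: "\<sigma> \<ge> 0" and Q: "Q y > M + \<sigma>"
  shows "Q y - M - \<sigma> \<le> norm (G y) powr p" and "\<sigma> \<le> norm (G y) powr p"
proof -
  have "(p - 1) / p * norm (G y) powr p \<le> 1 * norm (G y) powr p"
    using p by (intro mult_right_mono) (auto simp: field_simps)
  then have "Q y \<le> norm (G y) powr p" using F by (simp add: Q_def)
  then show "\<sigma> \<le> norm (G y) powr p" "Q y - M - \<sigma> \<le> norm (G y) powr p" using M Q \<sigma> by simp_all
qed

text \<open>The contact point is the maximiser over a compact set of the quotient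
  \<open>\<Theta>\<close> of \<open>Q - M - \<sigma>\<close> by the barrier, and the maximum is the
  multiple \<mu>. Evaluation at \<open>x0\<close> bounds \<mu> below by \<sigma> / A for every
  \<open>R\<close>, against the upper bound (c / R)^p. \<open>Qb\<close> extends \<open>Q\<close> to
  the closure, where compactness needs it.\<close>

theorem Q_le:
  fixes U M :: real
  assumes x0: "x0 \<in> \<Omega>" and F: "\<And>s. F s \<le> 0" and M: "M \<ge> 0"
    and u: "continuous_on (closure \<Omega>) u" "\<And>x. x \<in> closure \<Omega> \<Longrightarrow> 0 \<le> u x \<and> u x \<le> U"
    and Qb: "continuous_on (closure \<Omega>) Qb" "\<And>x. x \<in> \<Omega> \<Longrightarrow> Qb x = Q x" "\<And>x. x \<in> frontier \<Omega> \<Longrightarrow> Qb x \<le> M"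
  shows "Q x0 \<le> M"
proof (rule ccontr)
  assume "\<not> Q x0 \<le> M"
  \<comment> \<open>Half of the excess raises the level to \<open>M + \<sigma>\<close>; the other
    half keeps \<open>\<Theta> x0\<close> positive.\<close>
  define \<sigma> where "\<sigma> = (Q x0 - M) / 2"
  have \<sigma>: "\<sigma> > 0" using \<open>\<not> Q x0 \<le> M\<close> by (simp add: \<sigma>_def)
  have x0c: "x0 \<in> closure \<Omega>" using x0 closure_subset by blast
  have "continuous_on {0..U} f"
    using f_deriv by (meson DERIV_isCont continuous_at_imp_continuous_on)
  then have "bounded (f ` {0..U})" by (intro compact_imp_bounded compact_continuous_image) auto
  then obtain C where C: "\<And>s. 0 \<le> s \<Longrightarrow> s \<le> U \<Longrightarrow> \<bar>f s\<bar> \<le> C"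
    unfolding bounded_iff by (metis atLeastAtMost_iff imageI real_norm_def)
  have C0: "C \<ge> 0" using C[of "u x0"] u(2)[OF x0c] by (meson abs_ge_zero order_trans)
  define l where "l = 2 * C / \<sigma> + 1"
  \<comment> \<open>This puts \<open>A - exp (l * u x)\<close> between 1 and \<open>A\<close>. The
    exponent \<open>k\<close>, at least p, gives \<open>\<zeta> ^ k \<le> \<zeta> powr p\<close> on
    [0, 1].\<close>
  define A where "A = 1 + exp (l * U)"
  define k where "k = nat \<lceil>p\<rceil>"
  define c where "c = 1 + 2 * ((4 * l * k * (p - 1) + 2 * p * C * A * k / \<sigma>)
      + A * (4 * (k * (k + 1)) * p + 2 * k * (DIM('a) + p))) / ((p - 1) * l\<^sup>2)"
  have l1: "l \<ge> 1" using C0 \<sigma> by (simp add: l_def)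
  have A1: "A > 0" by (simp add: A_def add_pos_pos)
  have kp: "p \<le> real k" using p by (simp add: k_def)
  have c1: "c \<ge> 1" unfolding c_def using l1 A1 p C0 \<sigma> by simp
  have g1: "1 \<le> A - exp (l * u x)" if "x \<in> closure \<Omega>" for x
    using u(2)[OF that] l1 by (simp add: A_def)
  have claim: "\<sigma> / A \<le> (c / R) powr p" if R: "R > 0" for R
  proof -
    let ?K = "closure \<Omega> \<inter> cball x0 R"
    define \<zeta> where "\<zeta> x = 1 - (x - x0) \<bullet> (x - x0) / R\<^sup>2" for x
    define \<Theta> where "\<Theta> x = (Qb x - M - \<sigma>) * \<zeta> x ^ k / (A - exp (l * u x))" for x
    have "compact ?K" by (intro closed_Int_compact closed_closure compact_cball)
    moreover have "x0 \<in> ?K" using x0c R by simp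
    moreover have "continuous_on ?K \<Theta>"
    proof -
      have "R\<^sup>2 \<noteq> 0" "\<forall>x\<in>?K. A - exp (l * u x) \<noteq> 0" using R g1 by force+
      then show ?thesis unfolding \<Theta>_def \<zeta>_def
        by (intro continuous_intros continuous_on_subset[OF Qb(1)] continuous_on_subset[OF u(1)]) auto
    qed
    ultimately obtain y where y: "y \<in> ?K" "\<And>x. x \<in> ?K \<Longrightarrow> \<Theta> x \<le> \<Theta> y"
      using continuous_attains_sup[of ?K \<Theta>] by blast
    define \<mu> where "\<mu> = \<Theta> y"
    have "\<sigma> / A \<le> \<sigma> / (A - exp (l * u x0))"
      using g1[OF x0c] \<sigma> A1 by (intro divide_left_mono) auto
    also have "\<dots> = \<Theta> x0"
    proof -
      have "Qb x0 - M - \<sigma> = \<sigma>" using Qb(2)[OF x0] by (simp add: \<sigma>_def field_simps)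
      then show ?thesis by (simp add: \<Theta>_def \<zeta>_def)
    qed
    also have "\<dots> \<le> \<mu>" unfolding \<mu>_def using x0c R by (intro y(2)) simp
    finally have \<mu>: "\<sigma> / A \<le> \<mu>" .
    then have \<mu>0: "\<mu> > 0" using \<sigma> A1 by (meson divide_pos_pos less_le_trans)
    have \<zeta>01: "0 \<le> \<zeta> x" "\<zeta> x \<le> 1" if "x \<in> cball x0 R" for x
    proof -
      have "norm (x - x0) \<le> R" using that by (simp add: dist_norm norm_minus_commute)
      then have "(x - x0) \<bullet> (x - x0) \<le> R\<^sup>2" using R by (simp add: power_mono flip: power2_norm_eq_inner)
      then show "0 \<le> \<zeta> x" "\<zeta> x \<le> 1" using R by (simp_all add: \<zeta>_def)
    qed
    have gy: "A - exp (l * u y) \<ge> 1" using g1 y(1) by simp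
    have k0: "k > 0" using kp p by (cases k) auto
    have "(Qb y - M - \<sigma>) * \<zeta> y ^ k > 0"
      using \<mu>0 gy unfolding \<mu>_def \<Theta>_def by (simp add: zero_less_divide_iff)
    moreover have "\<zeta> y ^ k \<ge> 0" using \<zeta>01 y(1) by simp
    ultimately have N: "Qb y - M - \<sigma> > 0" and "\<zeta> y ^ k > 0"
      unfolding zero_less_mult_iff by linarith+
    \<comment> \<open>On the sphere of radius \<open>R\<close> the cutoff vanishes, and since
      \<open>k > 0\<close> so does \<open>\<Theta>\<close>; a positive maximum is therefore attained
      inside.\<close>
    then have \<zeta>y: "\<zeta> y > 0" using \<zeta>01(1)[of y] y(1) k0 by (cases "\<zeta> y = 0") (auto simp: power_0_left)
    have "y \<notin> frontier \<Omega>" using Qb(3)[of y] N \<sigma> by auto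
    then have y\<Omega>: "y \<in> \<Omega>" using y(1) open_dom by (auto simp: frontier_def interior_open)
    have Qy: "Q y > M + \<sigma>" using N Qb(2)[OF y\<Omega>] by simp
    note pw = powr_ge_if_Q_gt[OF F M less_imp_le[OF \<sigma>] Qy]
    have Gy: "G y \<noteq> 0" using pw(2) \<sigma> p by auto
    have yR: "(y - x0) \<bullet> (y - x0) < R\<^sup>2" using \<zeta>y R by (simp add: \<zeta>_def field_simps)
    \<comment> \<open>Cleared of denominators, \<open>\<Theta> x \<le> \<mu>\<close> says that
      \<open>Q\<close> minus the barrier is at most \<open>M + \<sigma>\<close>, with equality at
      \<open>y\<close>.\<close>
    have max: "\<forall>\<^sub>F x in nhds y. Q x - \<mu> * (A - exp (l * u x)) * inverse (\<zeta> x) ^ k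
      \<le> Q y - \<mu> * (A - exp (l * u y)) * inverse (\<zeta> y) ^ k"
    proof -
      have eqy: "Q y - \<mu> * (A - exp (l * u y)) * inverse (\<zeta> y) ^ k = M + \<sigma>"
        using \<zeta>y gy Qb(2)[OF y\<Omega>] by (simp add: \<mu>_def \<Theta>_def field_simps)
      have "open (\<Omega> \<inter> ball x0 R)" using open_dom by auto
      moreover have "y \<in> \<Omega> \<inter> ball x0 R"
        using y\<Omega> yR R by (simp add: dist_norm norm_minus_commute power2_less_imp_less flip: power2_norm_eq_inner)
      ultimately have "\<forall>\<^sub>F x in nhds y. x \<in> \<Omega> \<inter> ball x0 R" by (rule eventually_nhds_in_open)
      then show ?thesis
      proof eventually_elim
        case (elim x)
        then have xK: "x \<in> ?K" using closure_subset by auto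
        have "norm (x - x0) < R" using elim by (simp add: dist_norm norm_minus_commute)
        then have "(norm (x - x0))\<^sup>2 < R\<^sup>2" by (intro power_strict_mono) auto
        then have zx: "\<zeta> x > 0" using R by (simp add: \<zeta>_def power2_norm_eq_inner)
        have "(Q x - M - \<sigma>) * \<zeta> x ^ k / (A - exp (l * u x)) \<le> \<mu>"
          using y(2)[OF xK] Qb(2)[of x] elim by (simp add: \<mu>_def \<Theta>_def)
        then have "Q x - M - \<sigma> \<le> \<mu> * (A - exp (l * u x)) * inverse (\<zeta> x) ^ k"
          using zx g1[of x] xK by (simp add: field_simps power_inverse)
        then show ?case unfolding eqy by simp
      qed
    qed
    have "W y powr (- p / 2) \<le> 1 / \<sigma>"
    proof -
      have "W y powr (- p / 2) = 1 / (norm (G y) powr p)" by (simp add: norm_powr powr_minus_divide)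
      also have "\<dots> \<le> 1 / \<sigma>" using pw(2) \<sigma> Gy by (intro divide_left_mono) auto
      finally show ?thesis .
    qed
    then have "norm (G y) * \<zeta> y \<le> c / R"
      using contact_gradient_bound[OF y\<Omega> Gy \<mu>0 R yR max[unfolded \<zeta>_def], of C \<sigma>] C[of "u y"] u(2)[of y] y(1) \<sigma> gy
      unfolding l_def[symmetric] c_def \<zeta>_def by simp
    then have "(norm (G y) * \<zeta> y) powr p \<le> (c / R) powr p"
      using \<zeta>y p by (intro powr_mono2) auto
    moreover have "\<mu> \<le> (norm (G y) * \<zeta> y) powr p"
    proof -
      have "\<mu> = (Q y - M - \<sigma>) * \<zeta> y ^ k / (A - exp (l * u y))" using Qb(2)[OF y\<Omega>] by (simp add: \<mu>_def \<Theta>_def)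
      also have "\<dots> \<le> (Q y - M - \<sigma>) * \<zeta> y ^ k / 1"
        using gy Qy \<zeta>y by (intro divide_left_mono) auto
      also have "\<zeta> y ^ k = \<zeta> y powr real k" using \<zeta>y by (simp add: powr_realpow)
      also have "(Q y - M - \<sigma>) * \<zeta> y powr real k / 1 \<le> norm (G y) powr p * \<zeta> y powr p"
        using pw(1) Qy \<zeta>01(2)[of y] y(1) \<zeta>y kp by (auto intro!: mult_mono powr_mono')
      also have "\<dots> = (norm (G y) * \<zeta> y) powr p" using \<zeta>y by (simp add: powr_mult)
      finally show ?thesis .
    qed
    ultimately show ?thesis using \<mu> by linarith
  qed
  \<comment> \<open>With the radius c / \<tau> the claim reads \<sigma> / A \<le> \<sigma> / (2
    A).\<close>
  define \<tau> where "\<tau> = (\<sigma> / (2 * A)) powr (1 / p)"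
  have \<tau>: "\<tau> > 0" using \<sigma> A1 by (simp add: \<tau>_def)
  have "\<tau> powr p = \<sigma> / (2 * A)" using \<sigma> A1 p by (simp add: \<tau>_def powr_powr)
  moreover have "\<sigma> / A \<le> (c / (c / \<tau>)) powr p" using \<tau> c1 by (intro claim) auto
  moreover have "c / (c / \<tau>) = \<tau>" using c1 by simp
  ultimately show False using \<sigma> A1 by (simp add: field_simps)
qed

text \<open>Hopf's argument. Near a maximum point that is not interior to the maximum set there is a
  ball on which \<open>Q < M\<close> whose boundary meets that set at a single point
  \<open>y\<close>. Adding a small Gaussian about its centre creates an interior maximum near
  \<open>y\<close>, which \<open>touching_gaussian\<close> forbids for large \<alpha>.\<close>

lemma Q_max_set_open:
  assumes le: "\<And>x. x \<in> \<Omega> \<Longrightarrow> Q x \<le> M" and nc: "\<And>x. x \<in> \<Omega> \<Longrightarrow> Q x = M \<Longrightarrow> G x \<noteq> 0"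
  shows "open {x \<in> \<Omega>. Q x = M}"
proof (rule ccontr)
  assume "\<not> ?thesis"
  then obtain s0 where s0: "s0 \<in> \<Omega>" "Q s0 = M" "\<And>e. e > 0 \<Longrightarrow> \<not> ball s0 e \<subseteq> {x \<in> \<Omega>. Q x = M}"
    unfolding open_contains_ball by blast
  obtain \<rho>2 where \<rho>2: "\<rho>2 > 0" "cball s0 \<rho>2 \<subseteq> \<Omega>" using open_dom s0(1) open_contains_cball by blast
  \<comment> \<open>The doubled radius leaves room: all points closer to \<open>z1\<close> than
    \<open>r\<close> lie in \<open>cball s0 (2 * \<rho>)\<close>, so minimality of \<open>y\<close>
    applies to them.\<close>
  define \<rho> where "\<rho> = \<rho>2 / 2"
  have \<rho>: "\<rho> > 0" "cball s0 (2 * \<rho>) \<subseteq> \<Omega>" using \<rho>2 by (simp_all add: \<rho>_def)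
  obtain z1 where z1: "dist s0 z1 < \<rho>" "\<not> (z1 \<in> \<Omega> \<and> Q z1 = M)"
    using s0(3)[OF \<rho>(1)] by (auto simp: subset_iff)
  have z1\<Omega>: "z1 \<in> \<Omega>" using z1(1) \<rho> by (intro subsetD[OF \<rho>(2)]) simp
  let ?S = "{x \<in> cball s0 (2 * \<rho>). Q x = M}"
  have "closed ?S"
    by (rule continuous_closed_preimage_constant[OF continuous_on_subset[OF continuous_on_Q \<rho>(2)] closed_cball])
  moreover have "?S \<noteq> {}" using s0 \<rho> by force
  ultimately obtain y where y: "y \<in> ?S" "\<And>x. x \<in> ?S \<Longrightarrow> dist z1 y \<le> dist z1 x"
    using distance_attains_inf[of ?S z1] by blast
  define r where "r = dist z1 y"
  have y\<Omega>: "y \<in> \<Omega>" and Qy: "Q y = M" using y(1) \<rho>(2) by auto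
  have r0: "r > 0" using z1(2) y\<Omega> Qy by (auto simp: r_def)
  have "r \<le> dist z1 s0" unfolding r_def using s0 \<rho> by (intro y(2)) simp
  then have r\<rho>: "r < \<rho>" using z1(1) by (simp add: dist_commute)
  have less: "Q x < M" if "dist z1 x < r" for x
  proof -
    have "dist s0 x \<le> 2 * \<rho>" using dist_triangle[of s0 x z1] that z1(1) r\<rho> by linarith
    then have "x \<in> \<Omega>" "Q x \<noteq> M" using \<rho>(2) y(2)[of x] that by (auto simp: r_def)
    with le[of x] show ?thesis by simp
  qed
  \<comment> \<open>The ball is halved towards \<open>y\<close>, so that its closure meets the
    maximum set in \<open>y\<close> alone.\<close>
  define z where "z = (1 / 2) *\<^sub>R (z1 + y)"
  have yz: "norm (y - z) = r / 2"
  proof -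
    have "y - z = (1 / 2) *\<^sub>R (y - z1)" by (simp add: z_def algebra_simps flip: scaleR_left.add)
    then show ?thesis by (simp add: r_def dist_norm norm_minus_commute)
  qed
  have less': "Q x < M" if "norm (x - z) \<le> r / 2" "x \<noteq> y" for x
  proof (rule less)
    have "x - z1 = (x - z) + (y - z)" "x - y = (x - z) - (y - z)"
      by (simp_all add: z_def algebra_simps flip: scaleR_left.add)
    \<comment> \<open>The parallelogram law for \<open>x - z\<close> and \<open>y - z\<close> shows
      that only \<open>y\<close> can be at distance \<open>r\<close> from \<open>z1\<close>.\<close>
    then have "(norm (x - z1))\<^sup>2 + (norm (x - y))\<^sup>2 = 2 * (norm (x - z))\<^sup>2 + 2 * (norm (y - z))\<^sup>2"
      unfolding power2_norm_eq_inner by (simp only: inner_add_left inner_add_right inner_diff_left inner_diff_right) simp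
    also have "\<dots> \<le> 2 * (r / 2)\<^sup>2 + 2 * (r / 2)\<^sup>2"
      using that(1) yz by (intro add_mono mult_left_mono power_mono) auto
    also have "\<dots> = r\<^sup>2" by (simp add: power2_eq_square)
    finally have "(norm (x - z1))\<^sup>2 + (norm (x - y))\<^sup>2 \<le> r\<^sup>2" .
    moreover have "(norm (x - y))\<^sup>2 > 0" using that(2) by simp
    ultimately have "(norm (x - z1))\<^sup>2 < r\<^sup>2" by linarith
    then have "norm (x - z1) < r" using r0 by (intro power2_less_imp_less[of _ r]) auto
    then show "dist z1 x < r" by (simp add: dist_norm norm_minus_commute)
  qed
  obtain s1 where s1: "s1 > 0" "cball y s1 \<subseteq> {x \<in> \<Omega>. G x \<noteq> 0}"
    using open_noncritical nc[OF y\<Omega> Qy] y\<Omega> open_contains_cball by blast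
  \<comment> \<open>Within distance r / 4 of \<open>y\<close> the distance to \<open>z\<close> is at
    least r / 4, which bounds below the quantity multiplied by \<alpha>.\<close>
  define s where "s = min s1 (r / 4)"
  have s: "s > 0" "s \<le> r / 4" "cball y s \<subseteq> {x \<in> \<Omega>. G x \<noteq> 0}" using s1 r0 by (auto simp: s_def)
  have s\<Omega>: "cball y s \<subseteq> \<Omega>" using s(3) by blast
  obtain K where K: "\<And>x. x \<in> cball y s \<Longrightarrow> p * \<bar>f (u x)\<bar> * W x powr (- p / 2) * norm (x - z) * norm (G x) \<le> K"
  proof -
    have "continuous_on UNIV f" using f_deriv by (meson DERIV_isCont continuous_at_imp_continuous_on)
    then have "continuous_on (cball y s) (\<lambda>x. f (u x))"
      by (rule continuous_on_compose2[OF _ continuous_on_subset[OF continuous_on_u s\<Omega>]]) auto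
    moreover have "continuous_on (cball y s) G" by (rule continuous_on_subset[OF continuous_on_G s\<Omega>])
    ultimately have "continuous_on (cball y s) (\<lambda>x. p * \<bar>f (u x)\<bar> * W x powr (- p / 2) * norm (x - z) * norm (G x))"
      using s(3) by (intro continuous_intros continuous_on_powr) auto
    then have "bounded ((\<lambda>x. p * \<bar>f (u x)\<bar> * W x powr (- p / 2) * norm (x - z) * norm (G x)) ` cball y s)"
      by (intro compact_imp_bounded compact_continuous_image) auto
    then obtain B where "\<forall>x\<in>cball y s. norm (p * \<bar>f (u x)\<bar> * W x powr (- p / 2) * norm (x - z) * norm (G x)) \<le> B"
      unfolding bounded_iff by blast
    then have "p * \<bar>f (u x)\<bar> * W x powr (- p / 2) * norm (x - z) * norm (G x) \<le> B" if "x \<in> cball y s" for x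
      using that by (auto dest!: bspec[of _ _ x] intro: order_trans[OF abs_ge_self])
    then show thesis by (rule that)
  qed
  define m where "m = min 1 (p - 1)"
  have m: "m > 0" using p by (simp add: m_def)
  \<comment> \<open>Chosen so that the left side of \<open>touching_gaussian\<close> exceeds the
    right one, which is at most \<open>DIM('a) + p - 2 + K\<close>.\<close>
  define \<alpha> where "\<alpha> = (real DIM('a) + p + \<bar>K\<bar>) / (2 * m * (r / 4)\<^sup>2)"
  have \<alpha>: "\<alpha> > 0" unfolding \<alpha>_def using p m r0 by (intro divide_pos_pos) auto
  have \<alpha>': "2 * \<alpha> * m * (r / 4)\<^sup>2 = real DIM('a) + p + \<bar>K\<bar>" using m r0 by (simp add: \<alpha>_def)
  define E where "E x = exp (- \<alpha> * ((x - z) \<bullet> (x - z)))" for x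
  have E1: "E x \<le> 1" for x using \<alpha> by (simp add: E_def)
  \<comment> \<open>The sphere about \<open>y\<close> avoids \<open>y\<close>, so
    \<open>Q < M\<close> on this compact set, with a uniform gap.\<close>
  obtain \<delta> where \<delta>: "\<delta> > 0" "\<And>x. x \<in> sphere y s \<inter> cball z (r / 2) \<Longrightarrow> Q x \<le> M - \<delta>"
  proof (cases "sphere y s \<inter> cball z (r / 2) = {}")
    case True
    then show thesis using that[of 1] by auto
  next
    case False
    have "compact (sphere y s \<inter> cball z (r / 2))" by (intro compact_Int_closed) auto
    moreover have "continuous_on (sphere y s \<inter> cball z (r / 2)) Q"
      by (rule continuous_on_subset[OF continuous_on_Q]) (use s\<Omega> in auto)
    ultimately obtain x1 where x1: "x1 \<in> sphere y s \<inter> cball z (r / 2)"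
      "\<And>x. x \<in> sphere y s \<inter> cball z (r / 2) \<Longrightarrow> Q x \<le> Q x1"
      using continuous_attains_sup[OF _ False] by blast
    have "Q x1 < M" using x1(1) s(1) by (intro less') (auto simp: dist_norm norm_minus_commute)
    then show thesis using x1(2) by (intro that[of "M - Q x1"]) auto
  qed
  define \<epsilon> where "\<epsilon> = \<delta> / 2"
  have \<epsilon>: "\<epsilon> > 0" using \<delta> by (simp add: \<epsilon>_def)
  define h where "h x = Q x + \<epsilon> * E x" for x
  have "continuous_on (cball y s) h"
    unfolding h_def E_def by (intro continuous_intros continuous_on_subset[OF continuous_on_Q s\<Omega>])
  then obtain y' where y': "y' \<in> cball y s" "\<And>x. x \<in> cball y s \<Longrightarrow> h x \<le> h y'"
    using continuous_attains_sup[of "cball y s" h] s(1) by auto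
  have hy: "h y \<le> h y'" using s(1) by (intro y'(2)) simp
  \<comment> \<open>On the sphere \<open>h\<close> stays below \<open>h y\<close>: inside the ball
    about \<open>z\<close> the gap \<delta> outweighs the perturbation, and outside it the Gaussian
    is smaller than at \<open>y\<close> while \<open>Q \<le> M\<close>.\<close>
  have "y' \<in> ball y s"
  proof (rule ccontr)
    assume "y' \<notin> ball y s"
    then have sph: "y' \<in> sphere y s" using y'(1) by auto
    have "h y' < h y"
    proof (cases "y' \<in> cball z (r / 2)")
      case True
      then have "Q y' \<le> M - \<delta>" using sph by (intro \<delta>(2)) simp
      moreover have "\<epsilon> * E y' \<le> \<delta> / 2" using mult_left_mono[OF E1[of y'], of \<epsilon>] \<epsilon> by (simp add: \<epsilon>_def)
      moreover have "\<epsilon> * E y > 0" using \<epsilon> by (simp add: E_def)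
      ultimately show ?thesis using \<delta>(1) Qy by (simp add: h_def)
    next
      case False
      then have "norm (y - z) < norm (y' - z)" using yz by (simp add: dist_norm norm_minus_commute)
      then have "(norm (y - z))\<^sup>2 < (norm (y' - z))\<^sup>2" by (intro power_strict_mono) auto
      then have "E y' < E y" using \<alpha> by (simp add: E_def power2_norm_eq_inner)
      then have "\<epsilon> * E y' < \<epsilon> * E y" using \<epsilon> by simp
      moreover have "Q y' \<le> M" using le y'(1) s\<Omega> by blast
      ultimately show ?thesis using Qy by (simp add: h_def)
    qed
    with hy show False by simp
  qed
  then have "\<forall>\<^sub>F x in nhds y'. x \<in> ball y s" by (intro eventually_nhds_in_open) auto
  then have max: "\<forall>\<^sub>F x in nhds y'. Q x + \<epsilon> * exp (- \<alpha> * ((x - z) \<bullet> (x - z))) \<le> Q y' + \<epsilon> * exp (- \<alpha> * ((y' - z) \<bullet> (y' - z)))"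
  proof eventually_elim
    case (elim x)
    then show ?case using y'(2)[of x] by (simp add: h_def E_def)
  qed
  have y'n: "y' \<in> \<Omega>" "G y' \<noteq> 0" using y'(1) s(3) by auto
  have "r / 4 \<le> norm (y' - z)"
    using norm_triangle_ineq2[of "y - z" "y - y'"] yz y'(1) s(2) by (simp add: dist_norm)
  then have "(r / 4)\<^sup>2 \<le> (y' - z) \<bullet> (y' - z)"
    unfolding power2_norm_eq_inner[symmetric] using r0 by (intro power_mono) auto
  then have "2 * \<alpha> * m * (r / 4)\<^sup>2 \<le> 2 * \<alpha> * m * ((y' - z) \<bullet> (y' - z))"
    using \<alpha> m by (intro mult_left_mono) auto
  also have "\<dots> \<le> real DIM('a) + p - 2 + K"
    using touching_gaussian[OF y'n \<epsilon> \<alpha> max] K[OF y'(1)] by (simp add: m_def)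
  finally show False unfolding \<alpha>' by simp
qed

end

section \<open>The gradient on the boundary\<close>

context C3_function
begin

text \<open>The endpoints may lie on the boundary; there only continuity of u along the segment is
  used.\<close>

lemma mvt_segment:
  assumes t: "t > 0" and in_dom: "\<And>s. 0 < s \<Longrightarrow> s < t \<Longrightarrow> x + s *\<^sub>R v \<in> \<Omega>"
    and cont: "continuous_on {0..t} (\<lambda>s. u (x + s *\<^sub>R v))"
  obtains s where "0 < s" "s < t" "u (x + t *\<^sub>R v) - u x = t * (G (x + s *\<^sub>R v) \<bullet> v)"
proof -
  have d: "((\<lambda>s. u (x + s *\<^sub>R v)) has_real_derivative (G (x + s *\<^sub>R v) \<bullet> v)) (at s)" if "0 < s" "s < t" for s
    by (rule has_real_derivative_along_line[OF u_deriv[OF in_dom[OF that]]])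
  then have "\<exists>l s. 0 < s \<and> s < t \<and> ((\<lambda>s. u (x + s *\<^sub>R v)) has_real_derivative l) (at s)
      \<and> u (x + t *\<^sub>R v) - u (x + 0 *\<^sub>R v) = (t - 0) * l"
    by (intro MVT[OF t cont]) (auto simp: real_differentiable_def)
  then obtain l s where s: "0 < s" "s < t" "((\<lambda>s. u (x + s *\<^sub>R v)) has_real_derivative l) (at s)"
      "u (x + t *\<^sub>R v) - u x = t * l" by auto
  with DERIV_unique[OF s(3) d[OF s(1,2)]] that show thesis by blast
qed

text \<open>As u vanishes at \<open>z\<close> and is positive in \<Omega>, its derivative at
  \<open>z\<close> is nonnegative in every strictly inward direction. A vector with nonnegative
  product with an open half-space of directions is normal to its boundary, so no differentiation
  along the boundary is involved.\<close>

lemma boundary_gradient: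
  assumes n: "exterior_normal \<Omega> z \<nu>" and cu: "continuous_on (closure \<Omega>) u"
    and cG: "continuous_on (closure \<Omega>) Gb" and Gb: "\<And>x. x \<in> \<Omega> \<Longrightarrow> Gb x = G x"
    and uz: "u z = 0" and pos: "\<And>x. x \<in> \<Omega> \<Longrightarrow> u x > 0"
    and normal: "Gb z \<bullet> \<nu> = - \<kappa>" and \<kappa>: "\<kappa> \<ge> 0"
  shows "Gb z = - \<kappa> *\<^sub>R \<nu>"
proof -
  have z: "z \<in> closure \<Omega>" and \<nu>: "norm \<nu> = 1"
    using n by (auto simp: exterior_normal_def frontier_def)
  have inward: "Gb z \<bullet> v \<ge> 0" if v: "v \<bullet> \<nu> < 0" for v
  proof (rule ccontr)
    assume neg: "\<not> Gb z \<bullet> v \<ge> 0"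
    have v0: "norm v > 0" using v by auto
    \<comment> \<open>The product of \<open>v\<close> with \<nu> is then -2 \<epsilon> |v|, so the
      ray from \<open>z\<close> along \<open>v\<close> lies strictly inside the cone of
      \<open>exterior_normal\<close>.\<close>
    define \<epsilon> where "\<epsilon> = - (v \<bullet> \<nu>) / (2 * norm v)"
    have \<epsilon>: "\<epsilon> > 0" unfolding \<epsilon>_def using v v0 by (intro divide_pos_pos) auto
    obtain \<delta> where \<delta>: "\<delta> > 0" "\<And>x. x \<in> ball z \<delta> \<Longrightarrow> (x - z) \<bullet> \<nu> < - \<epsilon> * norm (x - z) \<Longrightarrow> x \<in> \<Omega>"
      using n \<epsilon> unfolding exterior_normal_def by meson
    have "continuous (at z within closure \<Omega>) (\<lambda>x. Gb x \<bullet> v)"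
      using cG z by (intro continuous_intros) (simp add: continuous_on_eq_continuous_within)
    then obtain \<eta> where \<eta>: "\<eta> > 0" "\<And>x. x \<in> closure \<Omega> \<Longrightarrow> dist x z < \<eta> \<Longrightarrow> dist (Gb x \<bullet> v) (Gb z \<bullet> v) < - (Gb z \<bullet> v)"
      using neg unfolding continuous_within_eps_delta by (metis neg_0_less_iff_less not_le)
    define t where "t = min \<delta> \<eta> / (2 * norm v)"
    have t: "t > 0" using \<delta>(1) \<eta>(1) v0 by (simp add: t_def)
    have tv: "t * norm v < \<delta>" "t * norm v < \<eta>" using \<delta>(1) \<eta>(1) v0 by (auto simp: t_def)
    have near: "dist (z + s *\<^sub>R v) z < \<delta>" "dist (z + s *\<^sub>R v) z < \<eta>" if "0 < s" "s \<le> t" for s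
    proof -
      have "dist (z + s *\<^sub>R v) z = s * norm v" using that by (simp add: dist_norm)
      moreover have "s * norm v \<le> t * norm v" using that by (intro mult_right_mono) auto
      ultimately show "dist (z + s *\<^sub>R v) z < \<delta>" "dist (z + s *\<^sub>R v) z < \<eta>" using tv by auto
    qed
    have in_dom: "z + s *\<^sub>R v \<in> \<Omega>" if "0 < s" "s \<le> t" for s
    proof (rule \<delta>(2))
      show "z + s *\<^sub>R v \<in> ball z \<delta>" using near[OF that] by (simp add: dist_commute)
      have "s * (v \<bullet> \<nu>) < s * ((v \<bullet> \<nu>) / 2)" using v that by (intro mult_strict_left_mono) auto
      also have "\<dots> = - \<epsilon> * norm (z + s *\<^sub>R v - z)" using v0 that by (simp add: \<epsilon>_def)
      finally show "(z + s *\<^sub>R v - z) \<bullet> \<nu> < - \<epsilon> * norm (z + s *\<^sub>R v - z)" by simp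
    qed
    have "continuous_on {0..t} (\<lambda>s. u (z + s *\<^sub>R v))"
    proof (rule continuous_on_compose2[OF cu])
      show "(\<lambda>s. z + s *\<^sub>R v) ` {0..t} \<subseteq> closure \<Omega>"
      proof clarsimp
        fix s :: real assume "0 \<le> s" "s \<le> t"
        then show "z + s *\<^sub>R v \<in> closure \<Omega>"
          using z in_dom[of s] closure_subset[of \<Omega>] by (cases "s = 0") auto
      qed
    qed (intro continuous_intros)
    then obtain s where s: "0 < s" "s < t" "u (z + t *\<^sub>R v) - u z = t * (G (z + s *\<^sub>R v) \<bullet> v)"
      using mvt_segment[OF t, of z v] in_dom by (metis less_imp_le)
    have "t * (G (z + s *\<^sub>R v) \<bullet> v) > 0" using s(3) uz pos[OF in_dom[of t]] t by simp
    then have "Gb (z + s *\<^sub>R v) \<bullet> v > 0" using t Gb[OF in_dom[of s]] s by (simp add: zero_less_mult_iff)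
    moreover have "dist (Gb (z + s *\<^sub>R v) \<bullet> v) (Gb z \<bullet> v) < - (Gb z \<bullet> v)"
      using s in_dom[of s] near(2)[of s] closure_subset[of \<Omega>] by (intro \<eta>(2)) auto
    ultimately show False by (simp add: dist_real_def)
  qed
  define \<tau> where "\<tau> = Gb z + \<kappa> *\<^sub>R \<nu>"
  have \<nu>\<nu>: "\<nu> \<bullet> \<nu> = 1" using \<nu> by (simp add: norm_eq_1)
  have \<tau>\<nu>: "\<tau> \<bullet> \<nu> = 0" by (simp add: \<tau>_def inner_add_left normal \<nu>\<nu>)
  \<comment> \<open>The test direction \<open>- \<tau> - e *\<^sub>R \<nu>\<close> opposes the
    tangential part and is tilted inward by \<open>e\<close>. For \<kappa> > 0 a suitable
    \<open>e\<close> bounds the square by its half; for \<kappa> = 0 the value 1 suffices.\<close>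
  have "\<tau> \<bullet> \<tau> \<le> \<kappa> * e" if "e > 0" for e
  proof -
    have "(- \<tau> - e *\<^sub>R \<nu>) \<bullet> \<nu> < 0" using that by (simp add: inner_diff_left \<tau>\<nu> \<nu>\<nu>)
    then have "Gb z \<bullet> (- \<tau> - e *\<^sub>R \<nu>) \<ge> 0" by (rule inward)
    moreover have "Gb z = \<tau> - \<kappa> *\<^sub>R \<nu>" by (simp add: \<tau>_def)
    ultimately show ?thesis
      using \<tau>\<nu> by (simp add: inner_diff_left inner_diff_right \<nu>\<nu> inner_commute[of \<nu> \<tau>] mult.commute)
  qed
  from this[of "(\<tau> \<bullet> \<tau>) / (2 * \<kappa>)"] this[of 1] have "\<not> \<tau> \<bullet> \<tau> > 0"
    using \<kappa> by (cases "\<kappa> = 0") (auto simp del: inner_gt_zero_iff)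
  then have "\<tau> = 0" by simp
  then show ?thesis by (simp add: \<tau>_def add_eq_0_iff)
qed

end

text \<open>The Neumann condition quantifies over exterior normals, so it has content only where one
  exists. Locally \<Omega> is the positivity set of a differentiable function with nonzero gradient
  \<open>m\<close> at \<open>z\<close>, and the normal is \<open>m\<close> reversed and
  normalised.\<close>

lemma exterior_normal_exists:
  assumes dom: "C1_domain \<Omega>" and z: "z \<in> frontier \<Omega>"
  shows "\<exists>\<nu>. exterior_normal \<Omega> z \<nu>"
proof -
  have op: "open \<Omega>" using dom by (simp add: C1_domain_def)
  obtain r e h where r: "r > 0" and e: "norm e = 1" and h: "Ck 1 UNIV (h :: 'a \<Rightarrow> real)"
    and loc: "\<Omega> \<inter> ball z r = {x \<in> ball z r. x \<bullet> e > h (x - (x \<bullet> e) *\<^sub>R e)}"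
    using dom z unfolding C1_domain_def by blast
  have ee: "e \<bullet> e = 1" using e by (simp add: norm_eq_1)
  have mem: "x \<in> \<Omega> \<longleftrightarrow> x \<bullet> e > h (x - (x \<bullet> e) *\<^sub>R e)" if "x \<in> ball z r" for x
    using loc that by blast
  have hd: "h differentiable (at x)" for x using h by simp
  then have hc: "continuous_on UNIV h"
    by (simp add: continuous_at_imp_continuous_on differentiable_imp_continuous_within)
  have cont: "continuous_on UNIV (\<lambda>x. x \<bullet> e - h (x - (x \<bullet> e) *\<^sub>R e))"
    by (intro continuous_intros continuous_on_compose2[OF hc]) auto
  have zr: "z \<in> ball z r" using r by simp
  have z\<Omega>: "z \<notin> \<Omega>" "z \<in> closure \<Omega>" using z op by (auto simp: frontier_def interior_open)
  \<comment> \<open>The open set strictly below the graph misses \<Omega> near \<open>z\<close>,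
    hence contains no point of the closure.\<close>
  have eqz: "z \<bullet> e = h (z - (z \<bullet> e) *\<^sub>R e)"
  proof (rule antisym)
    show "z \<bullet> e \<le> h (z - (z \<bullet> e) *\<^sub>R e)" using mem[OF zr] z\<Omega> by simp
    show "h (z - (z \<bullet> e) *\<^sub>R e) \<le> z \<bullet> e"
    proof (rule ccontr)
      assume "\<not> ?thesis"
      moreover have "open {x. x \<bullet> e - h (x - (x \<bullet> e) *\<^sub>R e) < 0}"
        using open_Collect_less[OF cont continuous_on_const] .
      ultimately have "open (ball z r \<inter> {x. x \<bullet> e - h (x - (x \<bullet> e) *\<^sub>R e) < 0})"
        "z \<in> ball z r \<inter> {x. x \<bullet> e - h (x - (x \<bullet> e) *\<^sub>R e) < 0}" using zr by auto
      then obtain x where "x \<in> \<Omega>" "x \<in> ball z r" "x \<bullet> e - h (x - (x \<bullet> e) *\<^sub>R e) < 0"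
        using z\<Omega>(2) closure_iff_nhds_not_empty[of z \<Omega>] by blast
      with mem show False by force
    qed
  qed
  let ?P = "\<lambda>x. x - (x \<bullet> e) *\<^sub>R e"
  define d where "d = grad h (?P z)"
  \<comment> \<open>\<open>h\<close> is evaluated on the hyperplane orthogonal to \<open>e\<close>
    only, so the component of its gradient along \<open>e\<close> is dropped. Then \<open>m\<close>
    has norm at least 1 and \<epsilon> need not be rescaled.\<close>
  define d' where "d' = ?P d"
  define m where "m = e - d'"
  have Pd: "?P y \<bullet> d = y \<bullet> d'" for y
    by (simp add: d'_def inner_diff_left inner_diff_right inner_commute)
  have d'e: "d' \<bullet> e = 0" by (simp add: d'_def inner_diff_left ee)
  have "m \<bullet> m = 1 + d' \<bullet> d'" by (simp add: m_def inner_diff_left inner_diff_right ee d'e inner_commute[of e d'])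
  then have "(norm m)\<^sup>2 \<ge> 1\<^sup>2" by (simp add: power2_norm_eq_inner)
  then have m1: "norm m \<ge> 1" using power2_le_imp_le[of 1 "norm m"] by simp
  then have m0: "m \<noteq> 0" by auto
  define \<nu> where "\<nu> = - (m /\<^sub>R norm m)"
  have "exterior_normal \<Omega> z \<nu>"
    unfolding exterior_normal_def
  proof (intro conjI z allI impI)
    show "norm \<nu> = 1" using m0 by (simp add: \<nu>_def)
    fix \<epsilon> :: real assume \<epsilon>: "\<epsilon> > 0"
    have "(h has_derivative (\<lambda>v. d \<bullet> v)) (at (?P z))" unfolding d_def by (rule has_derivative_grad[OF hd])
    then obtain \<delta> where \<delta>: "\<delta> > 0" "\<And>y. norm (y - ?P z) < \<delta> \<Longrightarrow> norm (h y - h (?P z) - d \<bullet> (y - ?P z)) \<le> \<epsilon> / 2 * norm (y - ?P z)"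
      using \<epsilon> unfolding has_derivative_at_alt by (metis half_gt_zero)
    have Pn: "norm (?P x - ?P z) \<le> norm (x - z)" for x
    proof -
      have "?P x - ?P z = ?P (x - z)" by (simp add: inner_diff_left algebra_simps)
      moreover have "(norm (?P y))\<^sup>2 \<le> (norm y)\<^sup>2" for y
        by (simp add: power2_norm_eq_inner inner_diff_left inner_diff_right ee inner_commute algebra_simps)
      ultimately show ?thesis by (metis norm_ge_zero power2_le_imp_le)
    qed
    have est: "\<bar>(x \<bullet> e - h (?P x)) - (x - z) \<bullet> m\<bar> \<le> \<epsilon> / 2 * norm (x - z)" if "norm (x - z) < \<delta>" for x
    proof -
      have "norm (h (?P x) - h (?P z) - d \<bullet> (?P x - ?P z)) \<le> \<epsilon> / 2 * norm (?P x - ?P z)"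
        using that Pn[of x] by (intro \<delta>(2)) simp
      also have "\<dots> \<le> \<epsilon> / 2 * norm (x - z)" using Pn[of x] \<epsilon> by (intro mult_left_mono) auto
      also have "d \<bullet> (?P x - ?P z) = (x - z) \<bullet> d'"
        using Pd[of x] Pd[of z] by (simp add: inner_diff_left inner_diff_right inner_commute)
      finally have "\<bar>h (?P x) - h (?P z) - (x - z) \<bullet> d'\<bar> \<le> \<epsilon> / 2 * norm (x - z)" by simp
      moreover have "(x - z) \<bullet> m = x \<bullet> e - h (?P z) - (x - z) \<bullet> d'"
        using eqz by (simp add: m_def inner_diff_left inner_diff_right)
      ultimately show ?thesis by linarith
    qed
    have \<nu>m: "y \<bullet> m = - norm m * (y \<bullet> \<nu>)" for y using m0 by (simp add: \<nu>_def)
    show "\<exists>\<delta>>0. \<forall>x\<in>ball z \<delta>. ((x - z) \<bullet> \<nu> < - \<epsilon> * norm (x - z) \<longrightarrow> x \<in> \<Omega>) \<and> ((x - z) \<bullet> \<nu> > \<epsilon> * norm (x - z) \<longrightarrow> x \<notin> \<Omega>)"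
    proof (intro exI[of _ "min \<delta> r"] conjI ballI impI)
      show "min \<delta> r > 0" using \<delta>(1) r by simp
      fix x assume x: "x \<in> ball z (min \<delta> r)"
      then have xr: "x \<in> ball z r" and xd: "norm (x - z) < \<delta>" by (auto simp: dist_norm norm_minus_commute)
      have half: "\<epsilon> / 2 * norm (x - z) \<le> \<epsilon> * norm (x - z)" using \<epsilon> by (intro mult_right_mono) auto
      have pos: "\<epsilon> * norm (x - z) \<ge> 0" using \<epsilon> by simp
      {
        assume a: "(x - z) \<bullet> \<nu> < - \<epsilon> * norm (x - z)"
        have "1 * (\<epsilon> * norm (x - z)) \<le> norm m * (\<epsilon> * norm (x - z))" using m1 pos by (intro mult_right_mono)
        also have "\<dots> < norm m * (- ((x - z) \<bullet> \<nu>))" using a m1 by (intro mult_strict_left_mono) auto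
        finally have "(x - z) \<bullet> m > \<epsilon> * norm (x - z)" by (simp add: \<nu>m)
        with est[OF xd] half have "x \<bullet> e - h (?P x) > 0" by linarith
        then show "x \<in> \<Omega>" using mem[OF xr] by simp
      }
      {
        assume a: "(x - z) \<bullet> \<nu> > \<epsilon> * norm (x - z)"
        have "1 * (\<epsilon> * norm (x - z)) \<le> norm m * (\<epsilon> * norm (x - z))" using m1 pos by (intro mult_right_mono)
        also have "\<dots> < norm m * ((x - z) \<bullet> \<nu>)" using a m1 by (intro mult_strict_left_mono) auto
        finally have "(x - z) \<bullet> m < - (\<epsilon> * norm (x - z))" by (simp add: \<nu>m)
        with est[OF xd] half have "x \<bullet> e - h (?P x) < 0" by linarith
        then show "x \<notin> \<Omega>" using mem[OF xr] by simp
      }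
    qed
  qed
  then show ?thesis by blast
qed

section \<open>The equality case\<close>

text \<open>A zero of the nonpositive \<open>F\<close> is a maximum, so \<open>f u0 = 0\<close>, and
  differentiability of \<open>f\<close> makes \<open>F\<close> quadratically small there. For p
  \<le> 2 this is the growth which the theorem assumes when p > 2.\<close>

lemma primitive_growth_at_zero:
  fixes F f :: "real \<Rightarrow> real"
  assumes F: "\<And>s. (F has_real_derivative f s) (at s)" and f: "(f has_real_derivative c) (at u0)"
    and nonpos: "\<And>s. F s \<le> 0" and u0: "F u0 = 0" and p: "p \<le> 2"
  shows "\<exists>L \<delta>. \<delta> > 0 \<and> (\<forall>s. \<bar>s - u0\<bar> < \<delta> \<longrightarrow> \<bar>F s\<bar> \<le> L * \<bar>s - u0\<bar> powr p)"
proof -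
  have f0: "f u0 = 0"
    by (rule DERIV_local_max[OF F, of 1]) (use nonpos u0 in auto)
  have "((\<lambda>s. (f s - f u0) / (s - u0)) \<longlongrightarrow> c) (at u0)"
    using f by (simp add: has_field_derivative_iff)
  from tendstoD[OF this, of 1] obtain d where d: "d > 0"
    "\<And>s. s \<noteq> u0 \<Longrightarrow> \<bar>s - u0\<bar> < d \<Longrightarrow> \<bar>(f s - f u0) / (s - u0) - c\<bar> < 1"
    by (auto simp: eventually_at dist_real_def)
  define C where "C = \<bar>c\<bar> + 1"
  have fC: "\<bar>f s\<bar> \<le> C * \<bar>s - u0\<bar>" if "\<bar>s - u0\<bar> < d" for s
  proof (cases "s = u0")
    case False
    have "\<bar>f s / (s - u0) - c\<bar> < 1" using d(2)[OF False that] f0 by simp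
    then have "\<bar>f s / (s - u0)\<bar> \<le> C" unfolding C_def by linarith
    then show ?thesis using False by (simp add: abs_divide divide_le_eq)
  qed (simp add: f0)
  have F2: "\<bar>F s\<bar> \<le> C * \<bar>s - u0\<bar> * \<bar>s - u0\<bar>" if s: "\<bar>s - u0\<bar> < d" for s
  proof -
    have "norm (F s - F u0) \<le> (C * \<bar>s - u0\<bar>) * norm (s - u0)"
    proof (rule field_differentiable_bound[of "closed_segment u0 s" F f])
      fix y assume y: "y \<in> closed_segment u0 s"
      have "\<bar>y - u0\<bar> \<le> \<bar>s - u0\<bar>" using segment_bound[OF y] by (simp add: abs_minus_commute)
      then have "C * \<bar>y - u0\<bar> \<le> C * \<bar>s - u0\<bar>" "\<bar>y - u0\<bar> < d"
        using s by (auto intro!: mult_left_mono simp: C_def)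
      with fC[of y] show "norm (f y) \<le> C * \<bar>s - u0\<bar>" by simp
    qed (auto intro: has_field_derivative_at_within F)
    then show ?thesis by (simp add: u0)
  qed
  \<comment> \<open>Below distance 1 the square is dominated by the power p \<le> 2.\<close>
  have "\<bar>F s\<bar> \<le> C * \<bar>s - u0\<bar> powr p" if s: "\<bar>s - u0\<bar> < min d 1" for s
  proof (cases "s = u0")
    case False
    have "\<bar>F s\<bar> \<le> C * (\<bar>s - u0\<bar> powr 2)"
      using F2[of s] s False by (simp add: power2_eq_square mult.assoc)
    also have "\<dots> \<le> C * \<bar>s - u0\<bar> powr p"
      using s p by (intro mult_left_mono powr_mono') (auto simp: C_def)
    finally show ?thesis .
  qed (simp add: u0)
  then show ?thesis using d(1) by (intro exI[of _ C] exI[of _ "min d 1"]) auto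
qed

context p_laplace
begin

text \<open>At a critical maximum point the growth of \<open>F\<close> yields a linear bound of
  |\<nabla>u| by |u - u0|, and a Gronwall argument makes the level set of \<open>u0\<close> open. It
  is relatively closed too, so u is constant, contrary to its vanishing on the boundary.\<close>

lemma noncritical_at_max:
  assumes conn: "connected \<Omega>" and z: "z \<in> frontier \<Omega>" and cu: "continuous_on (closure \<Omega>) u"
    and uz: "u z = 0" and pos: "\<And>x. x \<in> \<Omega> \<Longrightarrow> u x > 0"
    and F: "\<And>s. F s \<le> 0" and M: "M \<ge> 0" and le: "\<And>x. x \<in> \<Omega> \<Longrightarrow> Q x \<le> M"
    and growth: "\<And>u0. F u0 = 0 \<Longrightarrow> \<exists>L \<delta>. \<delta> > 0 \<and> (\<forall>s. \<bar>s - u0\<bar> < \<delta> \<longrightarrow> \<bar>F s\<bar> \<le> L * \<bar>s - u0\<bar> powr p)"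
    and y: "y \<in> \<Omega>" "Q y = M"
  shows "G y \<noteq> 0"
proof
  assume Gy: "G y = 0"
  define u0 where "u0 = u y"
  have "Q y = F u0" using Gy by (simp add: Q_def u0_def)
  then have M0: "M = 0" and Fu0: "F u0 = 0" using F[of u0] M y by auto
  obtain L \<delta> where \<delta>: "\<delta> > 0" "\<And>s. \<bar>s - u0\<bar> < \<delta> \<Longrightarrow> \<bar>F s\<bar> \<le> L * \<bar>s - u0\<bar> powr p"
    using growth[OF Fu0] by blast
  \<comment> \<open>The p-th root of the constant in |\<nabla>u|^p \<le> p / (p - 1) |L| |u - u0|^p,
    which comes from \<open>Q \<le> 0\<close>.\<close>
  define B where "B = (p / (p - 1) * \<bar>L\<bar>) powr (1 / p)"
  have B0: "B \<ge> 0" by (simp add: B_def)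
  have GB: "norm (G x) \<le> B * \<bar>u x - u0\<bar>" if x: "x \<in> \<Omega>" "\<bar>u x - u0\<bar> < \<delta>" for x
  proof -
    have "(p - 1) / p * norm (G x) powr p \<le> - F (u x)" using le[OF x(1)] M0 by (simp add: Q_def)
    also have "\<dots> \<le> L * \<bar>u x - u0\<bar> powr p" using \<delta>(2)[OF x(2)] by simp
    also have "\<dots> \<le> \<bar>L\<bar> * \<bar>u x - u0\<bar> powr p" by (intro mult_right_mono) auto
    finally have "norm (G x) powr p \<le> p / (p - 1) * \<bar>L\<bar> * \<bar>u x - u0\<bar> powr p"
      using p by (simp add: field_simps)
    then have "(norm (G x) powr p) powr (1 / p) \<le> (p / (p - 1) * \<bar>L\<bar> * \<bar>u x - u0\<bar> powr p) powr (1 / p)"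
      using p by (intro powr_mono2) auto
    moreover have "(t powr p) powr (1 / p) = t" if "t \<ge> 0" for t using p that by (simp add: powr_powr)
    ultimately show ?thesis by (simp only: B_def powr_mult abs_ge_zero norm_ge_zero)
  qed
  let ?S = "{x \<in> \<Omega>. u x = u0}" and ?T = "{x \<in> \<Omega>. u x \<noteq> u0}"
  have "open ?S"
    unfolding open_contains_cball
  proof
    fix x1 assume x1: "x1 \<in> ?S"
    have "open {x \<in> \<Omega>. \<bar>u x - u0\<bar> < \<delta>}"
      using continuous_on_open_vimage[OF open_dom, THEN iffD1, OF continuous_on_u, rule_format, of "ball u0 \<delta>"]
      by (auto simp: vimage_def Int_def conj_commute dist_real_def abs_minus_commute)
    moreover have "x1 \<in> {x \<in> \<Omega>. \<bar>u x - u0\<bar> < \<delta>}" using x1 \<delta>(1) by simp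
    ultimately obtain \<rho>1 where \<rho>1: "\<rho>1 > 0" "cball x1 \<rho>1 \<subseteq> {x \<in> \<Omega>. \<bar>u x - u0\<bar> < \<delta>}"
      using open_contains_cball by blast
    \<comment> \<open>With \<open>B * \<rho> \<le> 1 / 2\<close> the mean value inequality bounds
      the maximum of |u - u0| on the ball by half of itself.\<close>
    define \<rho> where "\<rho> = min \<rho>1 (1 / (2 * (B + 1)))"
    have \<rho>: "\<rho> > 0" "cball x1 \<rho> \<subseteq> {x \<in> \<Omega>. \<bar>u x - u0\<bar> < \<delta>}" "B * \<rho> \<le> 1 / 2"
    proof -
      show "\<rho> > 0" using \<rho>1 B0 by (simp add: \<rho>_def)
      show "cball x1 \<rho> \<subseteq> {x \<in> \<Omega>. \<bar>u x - u0\<bar> < \<delta>}" using \<rho>1(2) by (auto simp: \<rho>_def)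
      have "B * \<rho> \<le> B * (1 / (2 * (B + 1)))" using B0 by (intro mult_left_mono) (auto simp: \<rho>_def)
      also have "\<dots> \<le> 1 / 2" using B0 by (simp add: field_simps)
      finally show "B * \<rho> \<le> 1 / 2" .
    qed
    have \<rho>\<Omega>: "cball x1 \<rho> \<subseteq> \<Omega>" using \<rho>(2) by blast
    have "continuous_on (cball x1 \<rho>) (\<lambda>x. \<bar>u x - u0\<bar>)"
      by (intro continuous_intros continuous_on_subset[OF continuous_on_u \<rho>\<Omega>])
    then obtain x2 where x2: "x2 \<in> cball x1 \<rho>" "\<And>x. x \<in> cball x1 \<rho> \<Longrightarrow> \<bar>u x - u0\<bar> \<le> \<bar>u x2 - u0\<bar>"
      using continuous_attains_sup[of "cball x1 \<rho>"] \<rho>(1) by (metis cball_eq_empty compact_cball not_less_iff_gr_or_eq)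
    define m where "m = \<bar>u x2 - u0\<bar>"
    have "norm (u x2 - u x1) \<le> (B * m) * norm (x2 - x1)"
    proof (rule differentiable_bound[OF convex_cball])
      fix x assume x: "x \<in> cball x1 \<rho>"
      then have x\<Omega>: "x \<in> \<Omega>" "\<bar>u x - u0\<bar> < \<delta>" using \<rho>(2) by auto
      show "(u has_derivative (\<lambda>v. G x \<bullet> v)) (at x within cball x1 \<rho>)"
        using u_deriv[OF x\<Omega>(1)] by (rule has_derivative_at_withinI)
      have "norm (G x) \<le> B * m"
        using GB[OF x\<Omega>] mult_left_mono[OF x2(2)[OF x] B0] by (simp add: m_def)
      then have "\<bar>G x \<bullet> v\<bar> \<le> B * m * norm v" for v
        by (rule order_trans[OF Cauchy_Schwarz_ineq2 mult_right_mono]) simp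
      then show "onorm (\<lambda>v. G x \<bullet> v) \<le> B * m"
        using B0 by (intro onorm_bound) (auto simp: m_def)
    qed (use x2 \<rho> in auto)
    also have "\<dots> \<le> (B * m) * \<rho>"
      using x2(1) B0 by (intro mult_left_mono) (auto simp: m_def dist_norm norm_minus_commute)
    also have "\<dots> = (B * \<rho>) * m" by simp
    also have "\<dots> \<le> 1 / 2 * m" using \<rho>(3) by (intro mult_right_mono) (auto simp: m_def)
    finally have "m \<le> 0" using x1 by (simp add: m_def)
    then have "u x = u0" if "x \<in> cball x1 \<rho>" for x
      using x2(2)[OF that] by (simp add: m_def)
    then show "\<exists>e>0. cball x1 e \<subseteq> ?S" using \<rho>(1) \<rho>\<Omega> by blast
  qed
  moreover have "open ?T"
    using continuous_on_open_vimage[OF open_dom, THEN iffD1, OF continuous_on_u, rule_format, of "- {u0}"]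
    by (auto simp: vimage_def Int_def conj_commute)
  moreover have "y \<in> ?S" using y by (simp add: u0_def)
  ultimately have "?T \<inter> \<Omega> = {}"
    using connectedD[OF conn, of ?S ?T] y by blast
  then have const: "u x = u0" if "x \<in> \<Omega>" for x using that by blast
  have "z \<in> closure \<Omega>" using z by (simp add: frontier_def)
  then have "u z = u0" using continuous_constant_on_closure[OF cu const] by blast
  then show False using uz pos[OF y(1)] by (simp add: u0_def)
qed

text \<open>The rank one Hessian makes the unit gradient a constant \<open>a\<close>. Then \<Omega>
  is invariant under translation by every \<open>v\<close> with
  \<open>a \<bullet> v \<ge> 0\<close>, so it is a half-space, and u is constant in directions
  orthogonal to \<open>a\<close>.\<close>

lemma halfspace_parallel_if_Q_const:
  assumes conn: "connected \<Omega>" and ne: "\<Omega> \<noteq> {}" "\<Omega> \<noteq> UNIV" and cu: "continuous_on (closure \<Omega>) u"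
    and u0: "\<And>z. z \<in> frontier \<Omega> \<Longrightarrow> u z = 0" and pos: "\<And>x. x \<in> \<Omega> \<Longrightarrow> u x > 0"
    and nc: "\<And>x. x \<in> \<Omega> \<Longrightarrow> G x \<noteq> 0" and Q: "\<And>x. x \<in> \<Omega> \<Longrightarrow> Q x = M"
  shows "halfspace \<Omega> \<and> parallel_solution \<Omega> u"
proof -
  define n where "n x = W x powr (- 1 / 2) *\<^sub>R G x" for x
  have "(n has_derivative (\<lambda>_. 0)) (at x)" if x: "x \<in> \<Omega>" for x
  proof -
    obtain l where l: "\<And>v. H x v = (l * (G x \<bullet> v)) *\<^sub>R G x"
      using hessian_rank_one_if_Q_const[OF open_dom order_refl x nc Q] by blast
    have w: "W x > 0" using nc[OF x] by simp
    have "W x powr (- 1 / 2 - 1) * W x = W x powr (- 1 / 2)" using w powr_add[of "W x" "- 1 / 2 - 1" 1] by simp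
    then have e: "- 1 / 2 * W x powr (- 1 / 2 - 1) * (2 * (G x \<bullet> H x v)) = - (l * (G x \<bullet> v)) * W x powr (- 1 / 2)" for v
      by (simp add: l mult_ac)
    have "W x powr (- 1 / 2) *\<^sub>R H x v + (- 1 / 2 * W x powr (- 1 / 2 - 1) * (2 * (G x \<bullet> H x v))) *\<^sub>R G x = 0" for v
      unfolding e unfolding l by (simp add: mult.commute)
    moreover have "(n has_derivative (\<lambda>v. W x powr (- 1 / 2) *\<^sub>R H x v
        + (- 1 / 2 * W x powr (- 1 / 2 - 1) * (2 * (G x \<bullet> H x v))) *\<^sub>R G x)) (at x)"
      unfolding n_def by (intro has_derivative_scaleR W_powr_deriv G_deriv x nc)
    ultimately show ?thesis by (simp only:)
  qed
  then have const: "n x = n x'" if "x \<in> \<Omega>" "x' \<in> \<Omega>" for x x'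
    using has_derivative_zero_unique_connected[OF open_dom conn _ that] by blast
  obtain x1 where x1: "x1 \<in> \<Omega>" using ne by blast
  define a where "a = n x1"
  have G: "G x = norm (G x) *\<^sub>R a" and na: "norm a = 1" if "x \<in> \<Omega>" for x
  proof -
    have "norm (G x) > 0" using nc[OF that] by simp
    moreover have "W x powr (- 1 / 2) = 1 / norm (G x)"
      using nc[OF that] by (simp add: powr_minus_divide powr_half_sqrt norm_eq_sqrt_inner)
    moreover have "a = n x" unfolding a_def using that x1 by (intro const)
    ultimately show "G x = norm (G x) *\<^sub>R a" "norm a = 1" by (auto simp: n_def)
  qed
  have na: "norm a = 1" using na x1 by blast
  have aa: "a \<bullet> a = 1" using na by (simp add: norm_eq_1)
  have cl: "closure \<Omega> = \<Omega> \<union> frontier \<Omega>" by (rule closure_Un_frontier)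
  have move: "x + v \<in> \<Omega>" if x: "x \<in> \<Omega>" and v: "a \<bullet> v \<ge> 0" for x v
  proof (rule ccontr)
    assume nin: "x + v \<notin> \<Omega>"
    \<comment> \<open>The earliest parameter outside \<Omega> gives a boundary point where u is at
      least \<open>u x\<close>, hence positive instead of 0.\<close>
    let ?T = "{t \<in> {0..1}. x + t *\<^sub>R v \<in> - \<Omega>}"
    have "continuous_on {0..1} (\<lambda>t::real. x + t *\<^sub>R v)" by (intro continuous_intros)
    then have "closed ?T"
      using continuous_closed_preimage[of "{0..1}" "\<lambda>t. x + t *\<^sub>R v" "- \<Omega>"] open_dom
      by (auto simp: vimage_def Int_def closed_Compl)
    then have "compact ?T" by (intro bounded_subset[OF bounded_closed_interval, of _ 0 1] compact_eq_bounded_closed[THEN iffD2] conjI) auto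
    moreover have "1 \<in> ?T" using nin by simp
    then have "?T \<noteq> {}" by blast
    ultimately obtain t where t: "t \<in> ?T" "\<And>s. s \<in> ?T \<Longrightarrow> t \<le> s" using compact_attains_inf[of ?T] by blast
    have t0: "t > 0" using t(1) x by (cases "t = 0") auto
    have before: "x + s *\<^sub>R v \<in> \<Omega>" if "0 \<le> s" "s < t" for s
      using t(2)[of s] t(1) that by auto
    have "(\<lambda>s. x + s *\<^sub>R v) ` closure {0..<t} \<subseteq> closure \<Omega>"
      using before closure_subset[of \<Omega>] by (intro image_closure_subset) (auto intro!: continuous_intros)
    then have seg: "(\<lambda>s. x + s *\<^sub>R v) ` {0..t} \<subseteq> closure \<Omega>" using t0 by (simp add: closure_atLeastLessThan)
    have "continuous_on {0..t} (\<lambda>s. u (x + s *\<^sub>R v))"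
      by (rule continuous_on_compose2[OF cu _ seg]) (intro continuous_intros)
    then obtain s where s: "0 < s" "s < t" "u (x + t *\<^sub>R v) - u x = t * (G (x + s *\<^sub>R v) \<bullet> v)"
      using mvt_segment[OF t0, of x v] before by (metis less_imp_le)
    have "G (x + s *\<^sub>R v) \<bullet> v = norm (G (x + s *\<^sub>R v)) * (a \<bullet> v)"
      using G[OF before[of s]] s by (metis inner_scaleR_left less_imp_le)
    then have "t * (G (x + s *\<^sub>R v) \<bullet> v) \<ge> 0" using t0 v by simp
    then have "u (x + t *\<^sub>R v) \<ge> u x" using s(3) by linarith
    moreover have "x + t *\<^sub>R v \<in> closure \<Omega>" using t0 by (intro subsetD[OF seg] imageI) simp
    then have "x + t *\<^sub>R v \<in> frontier \<Omega>" using t(1) cl by auto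
    ultimately show False using u0 pos[OF x] by fastforce
  qed
  define c where "c = Inf ((\<lambda>x. a \<bullet> x) ` \<Omega>)"
  obtain y where y: "y \<notin> \<Omega>" using ne by blast
  \<comment> \<open>Otherwise the translation from \<open>x\<close> to \<open>y\<close> would be
    admissible in \<open>move\<close> and put \<open>y\<close> into \<Omega>.\<close>
  have "a \<bullet> y \<le> a \<bullet> x" if "x \<in> \<Omega>" for x
    using move[OF that, of "y - x"] y by (cases "a \<bullet> y \<le> a \<bullet> x") (auto simp: inner_diff_right)
  then have bdd: "bdd_below ((\<lambda>x. a \<bullet> x) ` \<Omega>)" by (intro bdd_belowI2[where m = "a \<bullet> y"])
  have half: "\<Omega> = {x. a \<bullet> (x - c *\<^sub>R a) > 0}"
  proof (intro set_eqI iffI)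
    fix x assume x: "x \<in> \<Omega>"
    then obtain e where e: "e > 0" "cball x e \<subseteq> \<Omega>" using open_dom open_contains_cball by blast
    have "x - e *\<^sub>R a \<in> cball x e" using e na by (simp add: dist_norm)
    then have "x - e *\<^sub>R a \<in> \<Omega>" using e by blast
    then have "c \<le> a \<bullet> (x - e *\<^sub>R a)" unfolding c_def using bdd by (intro cInf_lower) auto
    then show "x \<in> {x. a \<bullet> (x - c *\<^sub>R a) > 0}" using e(1) by (simp add: inner_diff_right aa)
  next
    fix x assume "x \<in> {x. a \<bullet> (x - c *\<^sub>R a) > 0}"
    then have "c < a \<bullet> x" by (simp add: inner_diff_right aa)
    then obtain x' where "x' \<in> \<Omega>" "a \<bullet> x' < a \<bullet> x"
      unfolding c_def using cInf_lessD[of "(\<lambda>x. a \<bullet> x) ` \<Omega>"] ne by blast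
    then show "x \<in> \<Omega>" using move[of x' "x - x'"] by (simp add: inner_diff_right)
  qed
  have "u x = u (c *\<^sub>R a + (a \<bullet> (x - c *\<^sub>R a)) *\<^sub>R a)" if x: "x \<in> \<Omega>" for x
  proof -
    \<comment> \<open>\<open>v\<close> leads from \<open>x\<close> to its projection on the axis
      spanned by \<open>a\<close>; being orthogonal to \<open>a\<close>, it keeps the whole line in
      \<Omega>.\<close>
    define v where "v = c *\<^sub>R a + (a \<bullet> (x - c *\<^sub>R a)) *\<^sub>R a - x"
    have av: "a \<bullet> v = 0" by (simp add: v_def inner_diff_right inner_add_right aa)
    have seg: "x + s *\<^sub>R v \<in> \<Omega>" for s using move[OF x, of "s *\<^sub>R v"] av by simp
    have "continuous_on {0..1} (\<lambda>s. u (x + s *\<^sub>R v))"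
      by (rule continuous_on_compose2[OF continuous_on_u]) (use seg in \<open>auto intro!: continuous_intros\<close>)
    then obtain s where "u (x + 1 *\<^sub>R v) - u x = 1 * (G (x + s *\<^sub>R v) \<bullet> v)"
      using mvt_segment[OF zero_less_one, of x v] seg by metis
    moreover have "G (x + s *\<^sub>R v) \<bullet> v = 0"
      using G[OF seg[of s]] av by (metis inner_scaleR_left mult_zero_right)
    ultimately show ?thesis by (simp add: v_def)
  qed
  then have "parallel_solution \<Omega> u"
    unfolding parallel_solution_def using half
    by (intro exI[of _ "c *\<^sub>R a"] exI[of _ a] exI[of _ "\<lambda>t. u (c *\<^sub>R a + t *\<^sub>R a)"]) auto
  moreover have "halfspace \<Omega>"
    unfolding halfspace_def using half na by (intro exI[of _ a] exI[of _ "c *\<^sub>R a"]) auto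
  ultimately show ?thesis by simp
qed

end

section \<open>The bound and its rigidity, from the boundary data, the maximum principles and
  connectedness\<close>

theorem theorem1p3:
  fixes \<Omega> :: "'a::euclidean_space set"
    and u :: "'a \<Rightarrow> real" and f F :: "real \<Rightarrow> real" and p \<kappa> :: real
  assumes dim: "DIM('a) \<ge> 2"
    and p: "1 < p"
    and dom: "C1_domain \<Omega>"
    and f_C1: "Ck 1 (UNIV::real set) f"
    and kappa: "\<kappa> \<ge> 0"
    and u_C3: "Ck 3 \<Omega> u"
    and u_bdd: "bounded (u ` \<Omega>)"
    and u_cont: "continuous_on (closure \<Omega>) u"
    and G: "\<exists>G. continuous_on (closure \<Omega>) G \<and> (\<forall>x\<in>\<Omega>. G x = grad u x) \<and>
              (\<forall>z \<nu>. exterior_normal \<Omega> z \<nu> \<longrightarrow> G z \<bullet> \<nu> = - \<kappa>)"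
    and eq: "p_laplace_solution p f \<Omega> u"
    and pos: "\<forall>x\<in>\<Omega>. u x > 0"
    and bdry: "\<forall>z\<in>frontier \<Omega>. u z = 0"
    and F_C2: "Ck 2 (UNIV::real set) F"
    and F_prim: "\<forall>s. (F has_real_derivative f s) (at s)"
    and F_nonpos: "\<forall>s. F s \<le> 0"
  shows "(\<forall>x\<in>\<Omega>. (p - 1) / p * norm (grad u x) powr p + F (u x)
                \<le> max 0 (F 0 + (p - 1) / p * \<kappa> powr p))
       \<and> ((\<exists>x0\<in>\<Omega>. (p - 1) / p * norm (grad u x0) powr p + F (u x0)
                   = max 0 (F 0 + (p - 1) / p * \<kappa> powr p))
          \<and> (p > 2 \<longrightarrow> (\<forall>u0. F u0 = 0 \<longrightarrow> F \<in> O[at u0](\<lambda>s. \<bar>s - u0\<bar> powr p)))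
          \<longrightarrow> (\<exists>c. \<forall>x\<in>\<Omega>. (p - 1) / p * norm (grad u x) powr p + F (u x) = c)
              \<and> halfspace \<Omega> \<and> parallel_solution \<Omega> u)"
proof -
  have op: "open \<Omega>" and conn: "connected \<Omega>" and ne: "\<Omega> \<noteq> {}" "\<Omega> \<noteq> UNIV"
    using dom by (auto simp: C1_domain_def)
  have cl: "closure \<Omega> = \<Omega> \<union> frontier \<Omega>" by (rule closure_Un_frontier)
  obtain Gb where cG: "continuous_on (closure \<Omega>) Gb" and Gb: "\<And>x. x \<in> \<Omega> \<Longrightarrow> Gb x = grad u x"
    and Gn: "\<And>z \<nu>. exterior_normal \<Omega> z \<nu> \<Longrightarrow> Gb z \<bullet> \<nu> = - \<kappa>"
    using G by blast
  obtain H T where C3: "C3_function \<Omega> u (grad u) H T" using C3_function_Ck3[OF op u_C3] by blast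
  have "\<exists>D. (f has_real_derivative D) (at s)" for s
    using f_C1 by (simp add: real_differentiable_def)
  then obtain f' where f': "\<And>s. (f has_real_derivative f' s) (at s)" by metis
  have F': "\<And>s. (F has_real_derivative f s) (at s)" and F0: "\<And>s. F s \<le> 0"
    using F_prim F_nonpos by auto
  have pos': "\<And>x. x \<in> \<Omega> \<Longrightarrow> u x > 0" and bdry': "\<And>z. z \<in> frontier \<Omega> \<Longrightarrow> u z = 0"
    using pos bdry by auto
  interpret p_laplace \<Omega> u "grad u" H T p f f' F
    by (rule p_laplace_weak[OF C3 p f' F' eq])
  define M where "M = max 0 (F 0 + (p - 1) / p * \<kappa> powr p)"
  have M: "M \<ge> 0" by (simp add: M_def)
  have norm_bdry: "norm (Gb z) = \<kappa>" if z: "z \<in> frontier \<Omega>" for z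
  proof -
    obtain \<nu> where \<nu>: "exterior_normal \<Omega> z \<nu>" using exterior_normal_exists[OF dom z] by blast
    have "Gb z = - \<kappa> *\<^sub>R \<nu>"
      by (rule boundary_gradient[OF \<nu> u_cont cG Gb bdry'[OF z] pos' Gn[OF \<nu>] kappa])
    moreover have "norm \<nu> = 1" using \<nu> by (simp add: exterior_normal_def)
    ultimately show ?thesis using kappa by simp
  qed
  obtain U where U: "\<And>x. x \<in> \<Omega> \<Longrightarrow> u x \<le> U"
    using u_bdd unfolding bounded_iff by (metis abs_le_D1 imageI real_norm_def)
  have U0: "0 \<le> u x \<and> u x \<le> U" if "x \<in> closure \<Omega>" for x
  proof (cases "x \<in> \<Omega>")
    case True
    then show ?thesis using U[OF True] pos'[OF True] by simp
  next
    case False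
    then have "u x = 0" using that cl bdry' by auto
    moreover obtain x1 where "x1 \<in> \<Omega>" using ne by blast
    ultimately show ?thesis using U[of x1] pos'[of x1] by simp
  qed
  \<comment> \<open>On the boundary the gradient has length \<kappa> and u vanishes, so
    \<open>Qb\<close> equals the second entry of the maximum \<open>M\<close>.\<close>
  define Qb where "Qb x = (p - 1) / p * norm (Gb x) powr p + F (u x)" for x
  have "continuous_on UNIV F" using F' by (meson DERIV_isCont continuous_at_imp_continuous_on)
  then have "continuous_on (closure \<Omega>) (\<lambda>x. F (u x))"
    by (rule continuous_on_compose2[OF _ u_cont]) auto
  then have cQ: "continuous_on (closure \<Omega>) Qb"
    unfolding Qb_def using p by (intro continuous_intros continuous_on_powr' cG) auto
  have le: "Q x \<le> M" if "x \<in> \<Omega>" for x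
  proof (rule Q_le[OF that F0 M u_cont U0 cQ])
    show "Qb x = Q x" if "x \<in> \<Omega>" for x using Gb[OF that] by (simp add: Qb_def Q_def)
    show "Qb z \<le> M" if "z \<in> frontier \<Omega>" for z
      using norm_bdry[OF that] bdry'[OF that] by (simp add: Qb_def M_def)
  qed
  have rigid: "(\<exists>c. \<forall>x\<in>\<Omega>. Q x = c) \<and> halfspace \<Omega> \<and> parallel_solution \<Omega> u"
    if x0: "x0 \<in> \<Omega>" "Q x0 = M"
      and growth: "p > 2 \<longrightarrow> (\<forall>u0. F u0 = 0 \<longrightarrow> F \<in> O[at u0](\<lambda>s. \<bar>s - u0\<bar> powr p))" for x0
  proof -
    obtain z where z: "z \<in> frontier \<Omega>" using frontier_eq_empty[of \<Omega>] ne by blast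
    have gr: "\<exists>L \<delta>. \<delta> > 0 \<and> (\<forall>s. \<bar>s - u0\<bar> < \<delta> \<longrightarrow> \<bar>F s\<bar> \<le> L * \<bar>s - u0\<bar> powr p)" if Fu0: "F u0 = 0" for u0
    proof (cases "p > 2")
      case True
      then have "F \<in> O[at u0](\<lambda>s. \<bar>s - u0\<bar> powr p)" using growth Fu0 by blast
      then obtain L where "\<forall>\<^sub>F s in at u0. norm (F s) \<le> L * norm (\<bar>s - u0\<bar> powr p)"
        by (elim landau_o.bigE)
      then obtain \<delta> where \<delta>: "\<delta> > 0" "\<And>s. s \<noteq> u0 \<Longrightarrow> \<bar>s - u0\<bar> < \<delta> \<Longrightarrow> \<bar>F s\<bar> \<le> L * \<bar>s - u0\<bar> powr p"
        by (auto simp: eventually_at dist_real_def)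
      \<comment> \<open>The filter \<open>at u0\<close> leaves out \<open>u0\<close> itself, where
        both sides are 0.\<close>
      have "\<bar>F s\<bar> \<le> L * \<bar>s - u0\<bar> powr p" if "\<bar>s - u0\<bar> < \<delta>" for s
        using \<delta>(2)[of s] that Fu0 by (cases "s = u0") auto
      with \<delta>(1) show ?thesis by blast
    next
      case False
      then show ?thesis by (intro primitive_growth_at_zero[OF F' f' F0 Fu0]) simp
    qed
    have nc: "grad u x \<noteq> 0" if "x \<in> \<Omega>" "Q x = M" for x
      by (rule noncritical_at_max[OF conn z u_cont bdry'[OF z] pos' F0 M le gr that])
    have oS: "open {x \<in> \<Omega>. Q x = M}" by (rule Q_max_set_open[OF le nc])
    have oT: "open {x \<in> \<Omega>. Q x \<noteq> M}"
      using continuous_on_open_vimage[OF op, THEN iffD1, OF continuous_on_Q, rule_format, of "- {M}"]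
      by (auto simp: vimage_def Int_def conj_commute)
    have "{x \<in> \<Omega>. Q x \<noteq> M} \<inter> \<Omega> = {}"
      using connectedD[OF conn oS oT] x0 by blast
    then have QM: "Q x = M" if "x \<in> \<Omega>" for x using that by blast
    have "halfspace \<Omega> \<and> parallel_solution \<Omega> u"
      by (rule halfspace_parallel_if_Q_const[OF conn ne u_cont bdry' pos' nc[OF _ QM] QM])
    with QM show ?thesis by blast
  qed
  show ?thesis
    using le rigid unfolding Q_def M_def by blast
qed

end
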